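(* Suppose assumptions (A1)–(A5) and (W1)–(W3), listed in the context, hold with continuous-time measurements $Y(t)=\mathbf P(n)X(t)$, $t\in\mathbb R$. Let $\mathbf W_n=\mathbf W(a(n)2^j)$ be the associated continuous-time wavelet random matrix, and let $$F_{\mathbf W_n}(d\upsilon)=\frac1{p(n)}\sum_{\ell=1}^{p(n)}\delta_{\frac{\log\lambda_\ell(\mathbf W_n)}{\log a(n)}}(d\upsilon)$$ be the empirical spectral distribution of its rescaled log-eigenvalues. Let $F_{2\mathcal H+1}$ be the probability distribution of $2\mathcal H+1$, where $\mathcal H\sim\pi(dH)$. Then $F_{\mathbf W_n}$ converges weakly, in probability, to $F_{2\mathcal H+1}$; that is, for any bounded continuous $g:\mathbb R\to\mathbb R$ and any $\varepsilon>0$, $$\lim_{n\to\infty}\mathbb P\Big(\Big|\int_{\mathbb R}g(\upsilon)F_{\mathbf W_n}(d\upsilon)-\int_{\mathbb R}g(\upsilon)F_{2\mathcal H+1}(d\upsilon)\Big|>\varepsilon\Big)=0.$$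
   Context: Notation: $\mathbb N=\{1,2,\dots\}$; $^*$ is transposition; $\lambda_1(\mathbf A)\le\dots\le\lambda_p(\mathbf A)$ are the ordered eigenvalues of a symmetric matrix $\mathbf A\in\mathbb R^{p\times p}$; $\sigma_1(\mathbf M)\le\dots\le\sigma_p(\mathbf M)$ are the ordered singular values of $\mathbf M\in\mathbb R^{p\times p}$; $GL(p,\mathbb R)$ is the group of invertible $p\times p$ real matrices; $\hat f(x)=\int_{\mathbb R}e^{-\mathrm{i}xt}f(t)\,dt$. Write $a=a(n)$, $p=p(n)$. Random Hurst fractional Brownian motion (rH-fBm): a process $X_{\mathcal H}=\{X_{\mathcal H}(t)\}_{t\in\mathbb R}$ with $\mathcal H\sim\pi(dH)$ such that, conditionally on $\mathcal H=H\in(0,1)$, $X_{\mathcal H}$ is a standard fractional Brownian motion with Hurst exponent $H$ (centered Gaussian with covariance $\frac12(|s|^{2H}+|t|^{2H}-|t-s|^{2H})$). (A1) $\pi(dH)$ is a probability measure with $\pi(0,1)=1$ and finite support $\{\breve H_1,\dots,\breve H_r\}\subset(0,1)$, $r\in\mathbb N$; $\varpi:=\min\operatorname{supp}\pi$. For each $n$, $\mathbb H_n=\mathrm{diag}(\mathcal H_1,\dots,\mathcal H_{p(n)})$ is a $p(n)\times p(n)$ random diagonal matrix whose diagonal entries are chosen independently from $\pi$. (A2) For each $n$, given $\mathbb H_n$, $p(n)$ independent rH-fBm sample paths are generated, the $\ell$-th one based on the diagonal entry $\mathcal H_\ell$. They form the $p(n)$-variate latent process $X=\{X(t)\}$. (A3)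 The measurements are $Y(t)=\mathbf P(n)X(t)\in\mathbb R^{p(n)}$, where $\mathbf P(n)\in GL(p(n),\mathbb R)$ is a random matrix independent of $X$. (A4) $j\in\mathbb N\cup\{0\}$ is fixed. The scaling factors $a(n)$ (dyadic, i.e., powers of 2) and the dimensions $p(n)\in\mathbb N$ satisfy, as $n\to\infty$, $a(n)\le n/2^j$, $\frac{a(n)}n+\frac n{a(n)^{1+2\varpi}}\to0$, $p(n)<\frac n{a(n)2^j}$, $p(n)\to\infty$ and $p(n)=o(\sqrt{n/a(n)})$. The number $n_{a,j}:=n/(a(n)2^j)$ is assumed to be an integer. (A5) $\frac{\log\sigma_1(\mathbf P(n))}{\log a(n)}\to0$ and $\frac{\log\sigma_{p}(\mathbf P(n))}{\log a(n)}\to0$ in probability as $n\to\infty$. Wavelets: $\phi$ and $\psi$ are the scaling function and wavelet of an orthonormal multiresolution analysis of $L^2(\mathbb R)$ and satisfy: (W1) $\psi\in L^2(\mathbb R)$, $\int\psi^2=1$, $\int t^q\psi(t)dt=0$ for $q=0,\dots,N_\psi-1$ and $\int t^{N_\psi}\psi(t)dt\ne0$, for some integer $N_\psi\ge2$; (W2) $\phi,\psi\in L^1(\mathbb R)$ are compactly supported and $\hat\phi(0)=1$; (W3) there are constants $0<A<\infty$ and $\alpha>1$ with $\sup_x|\hat\psi(x)|(1+|x|)^\alpha<A$. Continuous-time wavelet random matrix: $D(a(n)2^j,k)=(a(n)2^j)^{-1/2}\int_{\mathbb R}\psi((a(n)2^j)^{-1}t-k)\,Y(t)\,dt\in\mathbb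 R^{p(n)}$, $k\in\mathbb Z$, and $\mathbf W(a(n)2^j)=\frac1{n_{a,j}}\sum_{k=1}^{n_{a,j}}D(a(n)2^j,k)D(a(n)2^j,k)^*$. *)

theory Defs
  imports "HOL-Probability.Probability" "HOL-Library.Landau_Symbols"
    "Jordan_Normal_Form.Char_Poly"
begin

text \<open>
  Matrices are those of Jordan Normal Form, since the dimension depends on the sample size: their
  entries are indexed from 0, whereas eigenvalues and singular values are indexed from 1.
  Eigenvalues are counted with their multiplicity as roots of the characteristic polynomial; a
  symmetric real matrix of dimension \<open>m\<close> has \<open>m\<close> of them.
\<close>

definition ordered_eigenvalue :: "nat \<Rightarrow> real Matrix.mat \<Rightarrow> real" where
  "ordered_eigenvalue l A = sorted_list_of_multiset (proots (char_poly A)) ! (l - 1)"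

definition ordered_singular_value :: "nat \<Rightarrow> real Matrix.mat \<Rightarrow> real" where
  "ordered_singular_value l A = sqrt (ordered_eigenvalue l (transpose_mat A * A))"

text \<open>The average of the \<open>m\<close> Dirac masses at the rescaled log-eigenvalues, \<open>m\<close> being the dimension.\<close>

definition log_esd :: "real \<Rightarrow> real Matrix.mat \<Rightarrow> real measure" where
  "log_esd a A = distr (uniform_count_measure {1..dim_row A}) borel
     (\<lambda>l. ln (ordered_eigenvalue l A) / ln a)"

definition tendsto_in_prob ::
    "'a measure \<Rightarrow> nat filter \<Rightarrow> (nat \<Rightarrow> 'a \<Rightarrow> real) \<Rightarrow> real \<Rightarrow> bool" where
  "tendsto_in_prob M F f c \<longleftrightarrow>
     (\<forall>\<epsilon>>0. ((\<lambda>n. measure M {\<omega> \<in> space M. \<bar>f n \<omega> - c\<bar> > \<epsilon>}) \<longlongrightarrow> 0) F)"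

text \<open>
  The library's \<open>indep_var\<close> requires both variables to have values in the same type.
\<close>

definition indep_rvs ::
    "'a measure \<Rightarrow> 'b measure \<Rightarrow> ('a \<Rightarrow> 'b) \<Rightarrow> 'c measure \<Rightarrow> ('a \<Rightarrow> 'c) \<Rightarrow> bool" where
  "indep_rvs M N f N' g \<longleftrightarrow> f \<in> M \<rightarrow>\<^sub>M N \<and> g \<in> M \<rightarrow>\<^sub>M N' \<and>
     prob_space.indep_set M {f -` B \<inter> space M |B. B \<in> sets N} {g -` B \<inter> space M |B. B \<in> sets N'}"

definition measure_supp :: "real measure \<Rightarrow> real set" where
  "measure_supp \<mu> = {x. \<forall>U. open U \<and> x \<in> U \<longrightarrow> emeasure \<mu> U > 0}"

text \<open>Constants count as (degenerate) Gaussian variables.\<close>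

definition gaussian_rv :: "'a measure \<Rightarrow> ('a \<Rightarrow> real) \<Rightarrow> bool" where
  "gaussian_rv M Z \<longleftrightarrow> Z \<in> borel_measurable M \<and>
     (\<exists>\<mu>. (AE \<omega> in M. Z \<omega> = \<mu>) \<or> (\<exists>\<sigma>>0. distributed M lborel Z (normal_density \<mu> \<sigma>)))"

definition gaussian_process :: "'a measure \<Rightarrow> (real \<Rightarrow> 'a \<Rightarrow> real) \<Rightarrow> bool" where
  "gaussian_process M B \<longleftrightarrow>
     (\<forall>T c. finite T \<longrightarrow> gaussian_rv M (\<lambda>\<omega>. \<Sum>t\<in>T. c t * B t \<omega>))"

definition standard_fBm :: "'a measure \<Rightarrow> real \<Rightarrow> (real \<Rightarrow> 'a \<Rightarrow> real) \<Rightarrow> bool" where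
  "standard_fBm M h B \<longleftrightarrow> gaussian_process M B \<and>
     (\<forall>t. (LINT \<omega>|M. B t \<omega>) = 0) \<and>
     (\<forall>s t. (LINT \<omega>|M. B s \<omega> * B t \<omega>) =
        (\<bar>s\<bar> powr (2 * h) + \<bar>t\<bar> powr (2 * h) - \<bar>t - s\<bar> powr (2 * h)) / 2)"

text \<open>
  Conditionally on the Hurst exponents \<open>H 0, \<dots>, H (m - 1)\<close>, the processes
  \<open>X 0, \<dots>, X (m - 1)\<close> are independent, \<open>X l\<close> being a standard fractional Brownian motion with
  exponent \<open>H l\<close>. The exponents are meant to be almost surely finitely valued, so that conditioning
  on them is elementary conditioning on the events of positive probability on which they take given
  values; \<open>uniform_measure M E\<close> is the conditional probability given \<open>E\<close>.
\<close>

definition rH_fBm_paths ::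
    "'a measure \<Rightarrow> nat \<Rightarrow> (nat \<Rightarrow> 'a \<Rightarrow> real) \<Rightarrow> (nat \<Rightarrow> real \<Rightarrow> 'a \<Rightarrow> real) \<Rightarrow> bool" where
  "rH_fBm_paths M m H X \<longleftrightarrow>
     (\<forall>h E. E = {\<omega> \<in> space M. \<forall>l<m. H l \<omega> = h l} \<and> measure M E > 0 \<longrightarrow>
        (\<forall>l<m. standard_fBm (uniform_measure M E) (h l) (X l)) \<and>
        prob_space.indep_vars (uniform_measure M E) (\<lambda>_. Pi\<^sub>M UNIV (\<lambda>_. borel))
          (\<lambda>l \<omega> t. X l t \<omega>) {..<m})"

text \<open>
  The scaling function and the wavelet being real, so is \<open>L\<^sup>2(\<real>)\<close>; its elements are represented
  by Borel functions. All subspaces below are invariant under almost everywhere equality, because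
  they are equal to their closure.
\<close>

definition L2R :: "(real \<Rightarrow> real) set" where
  "L2R = {f \<in> borel_measurable borel. integrable lborel (\<lambda>x. (f x)\<^sup>2)}"

definition L2R_inner :: "(real \<Rightarrow> real) \<Rightarrow> (real \<Rightarrow> real) \<Rightarrow> real" where
  "L2R_inner f g = (LINT x|lborel. f x * g x)"

definition L2R_closure :: "(real \<Rightarrow> real) set \<Rightarrow> (real \<Rightarrow> real) set" where
  "L2R_closure A =
     {f \<in> L2R. \<forall>\<epsilon>>0. \<exists>g\<in>A. sqrt (LINT x|lborel. (f x - g x)\<^sup>2) < \<epsilon>}"

definition closed_subspace_L2R :: "(real \<Rightarrow> real) set \<Rightarrow> bool" where
  "closed_subspace_L2R V \<longleftrightarrow> V \<subseteq> L2R \<and> (\<lambda>_. 0) \<in> V \<and>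
     (\<forall>f\<in>V. \<forall>g\<in>V. \<forall>c d. (\<lambda>x. c * f x + d * g x) \<in> V) \<and> L2R_closure V = V"

definition orthonormal_basis_L2R :: "(int \<Rightarrow> real \<Rightarrow> real) \<Rightarrow> (real \<Rightarrow> real) set \<Rightarrow> bool" where
  "orthonormal_basis_L2R e V \<longleftrightarrow> (\<forall>k. e k \<in> V) \<and>
     (\<forall>k l. L2R_inner (e k) (e l) = (if k = l then 1 else 0)) \<and>
     V = L2R_closure {\<lambda>x. \<Sum>k\<in>K. c k * e k x |K c. finite K}"

text \<open>The indexing is the one in which \<open>V i\<close> decreases with \<open>i\<close>.\<close>

definition orthonormal_MRA :: "(int \<Rightarrow> (real \<Rightarrow> real) set) \<Rightarrow> (real \<Rightarrow> real) \<Rightarrow> bool" where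
  "orthonormal_MRA V \<phi> \<longleftrightarrow>
     (\<forall>i. closed_subspace_L2R (V i)) \<and>
     (\<forall>i. V i \<subseteq> V (i - 1)) \<and>
     L2R_closure (\<Union>i. V i) = L2R \<and>
     (\<Inter>i. V i) = {f \<in> L2R. AE x in lborel. f x = 0} \<and>
     (\<forall>i. \<forall>f. f \<in> V i \<longleftrightarrow> (\<lambda>x. f (2 * x)) \<in> V (i - 1)) \<and>
     orthonormal_basis_L2R (\<lambda>k x. \<phi> (x - of_int k)) (V 0)"

text \<open>The translates of the wavelet span the orthogonal complement of \<open>V 0\<close> in \<open>V (-1)\<close>.\<close>

definition MRA_scaling_wavelet :: "(real \<Rightarrow> real) \<Rightarrow> (real \<Rightarrow> real) \<Rightarrow> bool" where
  "MRA_scaling_wavelet \<phi> \<psi> \<longleftrightarrow>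
     (\<exists>V. orthonormal_MRA V \<phi> \<and>
        orthonormal_basis_L2R (\<lambda>k x. \<psi> (x - of_int k))
          {f \<in> V (-1). \<forall>g\<in>V 0. L2R_inner f g = 0})"

definition fourier :: "(real \<Rightarrow> real) \<Rightarrow> real \<Rightarrow> complex" where
  "fourier f x = (LINT t|lborel. exp (- \<i> * of_real (x * t)) * of_real (f t))"

definition wavelet_coeff ::
    "(real \<Rightarrow> real) \<Rightarrow> real \<Rightarrow> nat \<Rightarrow> (real \<Rightarrow> real Matrix.vec) \<Rightarrow> int \<Rightarrow> real Matrix.vec" where
  "wavelet_coeff \<psi> s m y k = Matrix.vec m (\<lambda>i.
     s powr (- 1 / 2) * (LINT t|lborel. \<psi> (t / s - of_int k) * vec_index (y t) i))"

definition wavelet_matrix ::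
    "(real \<Rightarrow> real) \<Rightarrow> real \<Rightarrow> nat \<Rightarrow> nat \<Rightarrow> (real \<Rightarrow> real Matrix.vec) \<Rightarrow> real Matrix.mat" where
  "wavelet_matrix \<psi> s N m y = Matrix.mat m m (\<lambda>(i, i').
     (\<Sum>k=1..N. vec_index (wavelet_coeff \<psi> s m y (int k)) i *
                 vec_index (wavelet_coeff \<psi> s m y (int k)) i') / real N)"

end

theory Submission
  imports Defs
begin

text \<open>
  Mixing by \<open>P\<close> hardly moves the eigenvalues on the scale of powers of \<open>a\<close>. Let \<open>s = a 2\<^sup>j\<close>. The wavelet
  matrix is \<open>W = P B P\<^sup>T\<close>, where \<open>B\<close> is the sample covariance matrix of the wavelet coefficients of the
  latent paths. By self-similarity the coefficients of the \<open>l\<close>-th path are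
  \<open>s\<^bsup>H\<^sub>l + 1/2\<^esup>\<close> times variables whose law does not depend on the scale, so \<open>B = D Q D\<close> with \<open>D\<close> the diagonal
  matrix of the \<open>s\<^bsup>H\<^sub>l + 1/2\<^esup>\<close> and \<open>Q\<close> a normalized Gram matrix. If the forms of \<open>Q\<close> and of \<open>P P\<^sup>T\<close> are bounded from
  above and from below by powers of \<open>a\<close> with exponents close to zero, then the eigenvalues of \<open>W\<close> agree, in
  the order of their ranks and up to such powers, with the numbers \<open>s\<^bsup>2 H\<^sub>l + 1\<^esup>\<close>. Their logarithms
  divided by \<open>log a\<close> are therefore uniformly close to the sorted values of \<open>2 H\<^sub>l + 1\<close>, and the law of large
  numbers for the independent exponents concludes.

  Four facts carry this out. The first is a comparison of ordered eigenvalues in the manner of Courant,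
  Fischer and Ostrowski (\<open>eigenvalue_comparison\<close>), which rests on the spectral theorem. It gives deterministic
  bounds for the eigenvalues of \<open>W\<close> (\<open>wavelet_eigenvalue_bounds\<close>) as soon as \<open>Q\<close> is close to its mean in Frobenius
  norm.

  The second is that \<open>Q\<close> concentrates (\<open>gram_concentration\<close>). Given the exponents, its mean is diagonal, and the
  variance of every entry is \<open>O(1/N)\<close>, where \<open>N\<close> is the number of coefficients; so the expected squared
  Frobenius distance is \<open>O(p\<^sup>2/N)\<close>, which tends to zero because \<open>p = o(sqrt(n/a))\<close>. The variances are
  fourth moments of wavelet integrals. They follow from Isserlis' formula for the process by Fubini's
  theorem (\<open>wint_wick\<close>), and their sum is \<open>O(N)\<close> because the covariance of the coefficients decays
  like the inverse of the lag (\<open>wavelet_cov_decay\<close>), thanks to the vanishing moments of \<open>\<psi>\<close>.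

  The third is that the diagonal mean of \<open>Q\<close> is bounded away from zero, that is, \<open>\<psi>\<close> does not annihilate
  fractional Brownian motion (\<open>wavelet_cov_0_pos\<close>). In the spectral representation the variance is the integral of
  \<open>|x|\<^bsup>-1-2h\<^esup>\<close> times the squared modulus of the Fourier transform of \<open>\<psi>\<close>, and the latter is nonzero near the
  origin, since some moment of \<open>\<psi>\<close> is nonzero. As the exponents have finitely many values, the bounds are uniform, and
  conditioning on the exponents is elementary (\<open>conditional_gram_concentration\<close>).

  The fourth is that the extreme singular values of a random matrix are measurable, so that the hypotheses on
  \<open>P\<close> do bound the probability of the events on which they are too large or too small.
\<close>

section \<open>The spectral theorem for real symmetric matrices\<close>

text \<open>
  A complex eigenvector \<open>v\<close> exists by the fundamental theorem of algebra. By symmetry the form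
  \<open>\<Sum>i j. A\<^sub>i\<^sub>j v\<^sub>j cnj v\<^sub>i\<close> is real, and it is the eigenvalue times \<open>|v|\<^sup>2\<close>, so the eigenvalue is real and hence
  a root of the real characteristic polynomial.
\<close>

lemma symmetric_real_has_eigenvalue:
  fixes A :: "real Matrix.mat"
  assumes A: "A \<in> carrier_mat n n" and sym: "transpose_mat A = A" and n: "n > 0"
  shows "\<exists>e. eigenvalue A e"
proof -
  let ?B = "map_mat complex_of_real A"
  have B: "?B \<in> carrier_mat n n" using A by simp
  have "degree (char_poly ?B) \<noteq> 0" using degree_monic_char_poly[OF B] n by simp
  then have "\<not> constant (poly (char_poly ?B))" by (simp add: constant_degree)
  from fundamental_theorem_of_algebra[OF this]
  obtain z where z: "poly (char_poly ?B) z = 0" by blast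
  then have "eigenvalue ?B z" using eigenvalue_root_char_poly[OF B] by simp
  then obtain v where v: "v \<in> carrier_vec n" "v \<noteq> 0\<^sub>v n" "?B *\<^sub>v v = z \<cdot>\<^sub>v v"
    unfolding eigenvalue_def eigenvector_def using A by auto
  define f where "f i = vec_index v i" for i
  have ev: "(\<Sum>j<n. complex_of_real (A $$ (i,j)) * f j) = z * f i" if i: "i < n" for i
  proof -
    have "vec_index (?B *\<^sub>v v) i = z * f i" using v i by (simp add: f_def)
    moreover have "vec_index (?B *\<^sub>v v) i = (\<Sum>j<n. complex_of_real (A $$ (i,j)) * f j)"
      using A v(1) i by (auto simp: scalar_prod_def f_def lessThan_atLeast0)
    ultimately show ?thesis by simp
  qed
  have symA: "A $$ (i,j) = A $$ (j,i)" if "i < n" "j < n" for i j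
    using arg_cong[OF sym, of "\<lambda>M. M $$ (i,j)"] that A by simp
  define T where "T = (\<Sum>i<n. \<Sum>j<n. complex_of_real (A $$ (i,j)) * f j * cnj (f i))"
  define q where "q = (\<Sum>i<n. (cmod (f i))\<^sup>2)"
  have q: "(\<Sum>i<n. f i * cnj (f i)) = complex_of_real q"
    unfolding q_def by (simp only: of_real_sum complex_norm_square)
  have T1: "T = z * of_real q"
  proof -
    have "T = (\<Sum>i<n. (\<Sum>j<n. complex_of_real (A $$ (i,j)) * f j) * cnj (f i))"
      unfolding T_def by (simp add: sum_distrib_right)
    also have "\<dots> = (\<Sum>i<n. z * (f i * cnj (f i)))" by (intro sum.cong) (auto simp: ev)
    finally show ?thesis by (simp add: sum_distrib_left[symmetric] q)
  qed
  have "cnj T = T"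
  proof -
    have "cnj T = (\<Sum>i<n. \<Sum>j<n. complex_of_real (A $$ (i,j)) * cnj (f j) * f i)"
      unfolding T_def by simp
    also have "\<dots> = (\<Sum>j<n. \<Sum>i<n. complex_of_real (A $$ (i,j)) * cnj (f j) * f i)"
      by (rule sum.swap)
    also have "\<dots> = T" unfolding T_def by (intro sum.cong) (auto simp: symA)
    finally show ?thesis .
  qed
  have "q > 0"
  proof -
    obtain i where i: "i < n" "f i \<noteq> 0"
      using v unfolding f_def by (metis carrier_vecD eq_vecI index_zero_vec(1,2))
    have "(cmod (f i))\<^sup>2 \<le> q" unfolding q_def by (rule member_le_sum) (use i in auto)
    moreover have "(cmod (f i))\<^sup>2 > 0" using i by simp
    ultimately show ?thesis by linarith
  qed
  then have "cnj z = z" using \<open>cnj T = T\<close> by (simp add: T1)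
  then have zr: "z = of_real (Re z)" by (simp add: complex_eq_iff)
  have "poly (map_poly of_real (char_poly A)) (complex_of_real (Re z)) = 0"
    using z unfolding of_real_hom.char_poly_hom[OF A] by (subst zr[symmetric])
  then have "poly (char_poly A) (Re z) = 0" by simp
  then show ?thesis using eigenvalue_root_char_poly[OF A] by blast
qed

lemma scalar_prod_self_pos:
  fixes x :: "real Matrix.vec"
  assumes x: "x \<in> carrier_vec n" "x \<noteq> 0\<^sub>v n"
  shows "0 < x \<bullet> x"
proof -
  obtain k where k: "k < n" "vec_index x k \<noteq> 0"
    using x by (metis carrier_vecD eq_vecI index_zero_vec(1,2))
  have "vec_index x k * vec_index x k \<le> x \<bullet> x"
    unfolding scalar_prod_def by (rule member_le_sum) (use k x in auto)
  moreover have "vec_index x k * vec_index x k > 0" using k by (auto simp: zero_less_mult_iff)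
  ultimately show ?thesis by linarith
qed

text \<open>
  The Householder reflection that exchanges \<open>v\<close> with the first basis vector. If \<open>v\<close> already is the first
  basis vector, then \<open>q = 0\<close> and, as division by zero yields zero, \<open>W\<close> is the identity.
\<close>

lemma reflection_onto_unit_vector:
  fixes v :: "real Matrix.vec"
  assumes v: "v \<in> carrier_vec n" and n: "n > 0" and unit: "v \<bullet> v = 1"
  shows "\<exists>W. W \<in> carrier_mat n n \<and> transpose_mat W = W \<and> W * W = 1\<^sub>m n \<and> col W 0 = v"
proof -
  define w where "w i = vec_index v i - (if i = 0 then 1 else 0)" for i :: nat
  define q where "q = (\<Sum>i<n. (w i)\<^sup>2)"
  define W where "W = Matrix.mat n n (\<lambda>(i,j). (if i = j then 1 else 0) - 2 * w i * w j / q)"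
  have W: "W \<in> carrier_mat n n" by (simp add: W_def)
  have one: "(\<Sum>i<n. (vec_index v i)\<^sup>2) = 1"
    using unit v by (simp add: scalar_prod_def lessThan_atLeast0 power2_eq_square)
  have "q = (\<Sum>i<n. (vec_index v i)\<^sup>2 + (if i = 0 then 1 - 2 * vec_index v 0 else 0))"
    unfolding q_def w_def by (intro sum.cong) (auto simp: power2_eq_square algebra_simps)
  also have "\<dots> = -2 * w 0"
    using n by (simp add: sum.distrib one w_def)
  finally have qw: "q = -2 * w 0" .
  have "W * W = 1\<^sub>m n"
  proof (rule eq_matI)
    fix i j assume ij: "i < dim_row (1\<^sub>m n :: real Matrix.mat)" "j < dim_col (1\<^sub>m n :: real Matrix.mat)"
    have qs: "(\<Sum>k<n. 4 * w i * w j * (w k)\<^sup>2 / (q * q)) = 4 * w i * w j * q / (q * q)"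
      by (simp only: q_def sum_distrib_left sum_divide_distrib)
    from ij have "(W * W) $$ (i,j) = (\<Sum>k<n. ((if i = k then 1 else 0) - 2 * w i * w k / q)
        * ((if k = j then 1 else 0) - 2 * w k * w j / q))"
      by (simp add: W_def scalar_prod_def lessThan_atLeast0)
    also have "\<dots> = (\<Sum>k<n. (if k = i then if i = j then 1 else 0 else 0)
        - (if k = i then 2 * w i * w j / q else 0) - (if k = j then 2 * w i * w j / q else 0)
        + 4 * w i * w j / q / q * (w k)\<^sup>2)"
      by (intro sum.cong) (auto simp: power2_eq_square algebra_simps)
    also have "\<dots> = (if i = j then 1 else 0) - 4 * w i * w j / q + 4 * w i * w j / q / q * q"
      using ij by (simp add: sum.distrib sum_subtractf qs)
    also have "\<dots> = (if i = j then 1 else 0)" by simp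
    finally show "(W * W) $$ (i,j) = 1\<^sub>m n $$ (i,j)" using ij by simp
  qed (auto simp: W_def)
  moreover have "col W 0 = v"
  proof (rule eq_vecI)
    fix i assume i: "i < dim_vec v"
    then have "i < n" using v by simp
    have "vec_index (col W 0) i = (if i = 0 then 1 else 0) - 2 * w i * w 0 / q"
      using \<open>i < n\<close> n by (simp add: W_def)
    also have "\<dots> = vec_index v i"
    proof (cases "q = 0")
      case True
      then have "w i = 0" using \<open>i < n\<close> by (simp add: q_def sum_nonneg_eq_0_iff)
      then show ?thesis by (simp add: w_def)
    next
      case False
      then have "2 * w i * w 0 / q = - w i" by (simp add: field_simps qw)
      then show ?thesis by (simp add: w_def)
    qed
    finally show "vec_index (col W 0) i = vec_index v i" .
  qed (use v W in auto)
  moreover have "transpose_mat W = W" by (rule eq_matI) (auto simp: W_def)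
  ultimately show ?thesis using W by blast
qed

lemma transpose_mult3:
  fixes A :: "real Matrix.mat"
  assumes "A \<in> carrier_mat n n" "B \<in> carrier_mat n n" "C \<in> carrier_mat n n"
  shows "transpose_mat (A * B * C) = transpose_mat C * transpose_mat B * transpose_mat A"
  using assms by (simp add: transpose_mult[of _ n n _ n])

lemma mult_block_diagonal:
  fixes A1 :: "real Matrix.mat"
  assumes "A1 \<in> carrier_mat k k" "A2 \<in> carrier_mat k k" "D1 \<in> carrier_mat n n" "D2 \<in> carrier_mat n n"
  shows "four_block_mat A1 (0\<^sub>m k n) (0\<^sub>m n k) D1 * four_block_mat A2 (0\<^sub>m k n) (0\<^sub>m n k) D2
    = four_block_mat (A1 * A2) (0\<^sub>m k n) (0\<^sub>m n k) (D1 * D2)"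
  using assms by (subst mult_four_block_mat[of _ k k _ n _ n _ _ k _ n]) auto

text \<open>
  Induction on the dimension by deflation: conjugating with a reflection that moves a unit eigenvector
  to the first basis vector leaves a block diagonal symmetric matrix with a \<open>1 \<times> 1\<close> block.
\<close>

lemma spectral_theorem_real_symmetric:
  fixes A :: "real Matrix.mat"
  assumes "A \<in> carrier_mat n n" and "transpose_mat A = A"
  shows "\<exists>U d. U \<in> carrier_mat n n \<and> transpose_mat U * U = 1\<^sub>m n \<and> A * U = U * mat_diag n d"
  using assms
proof (induction n arbitrary: A)
  case 0
  then show ?case by (intro exI[of _ "1\<^sub>m 0"] exI[of _ "\<lambda>_. 0"]) (auto intro!: eq_matI simp: mat_diag_def)
next
  case (Suc n A)
  note A = Suc.prems(1) and sym = Suc.prems(2)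
  obtain e v0 where v0: "v0 \<in> carrier_vec (Suc n)" "v0 \<noteq> 0\<^sub>v (Suc n)" "A *\<^sub>v v0 = e \<cdot>\<^sub>v v0"
    using symmetric_real_has_eigenvalue[OF A sym] A unfolding eigenvalue_def eigenvector_def by auto
  have pos: "v0 \<bullet> v0 > 0" using scalar_prod_self_pos v0 by blast
  define v where "v = (1 / sqrt (v0 \<bullet> v0)) \<cdot>\<^sub>v v0"
  have v: "v \<in> carrier_vec (Suc n)" and unit: "v \<bullet> v = 1"
    using v0 pos by (auto simp: v_def)
  have Av: "A *\<^sub>v v = e \<cdot>\<^sub>v v"
    using v0 A by (simp add: v_def mult_mat_vec smult_smult_assoc mult.commute)
  obtain W where W: "W \<in> carrier_mat (Suc n) (Suc n)" "transpose_mat W = W" "W * W = 1\<^sub>m (Suc n)"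
    and W0: "col W 0 = v"
    using reflection_onto_unit_vector[OF v _ unit] by auto
  define A' where "A' = W * A * W"
  have A': "A' \<in> carrier_mat (Suc n) (Suc n)" using W A by (simp add: A'_def)
  have symA': "transpose_mat A' = A'"
    unfolding A'_def using A W sym transpose_mult3[OF W(1) A W(1)] by simp
  have col0: "A' $$ (i, 0) = (if i = 0 then e else 0)" if "i < Suc n" for i
  proof -
    have "col A' 0 = (W * A) *\<^sub>v v" unfolding A'_def using W A W0 by (subst col_mult2) auto
    also have "\<dots> = W *\<^sub>v (e \<cdot>\<^sub>v v)" using W A v Av by (simp add: assoc_mult_mat_vec[of _ "Suc n" "Suc n" _ "Suc n"])
    also have "\<dots> = e \<cdot>\<^sub>v (W *\<^sub>v v)" using W v by (simp add: mult_mat_vec)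
    also have "W *\<^sub>v v = col (W * W) 0" using W W0 by (subst col_mult2) auto
    finally have "col A' 0 = e \<cdot>\<^sub>v col (1\<^sub>m (Suc n)) 0" using W by simp
    from arg_cong[OF this, of "\<lambda>u. vec_index u i"] show ?thesis using that A' by auto
  qed
  have row0: "A' $$ (0, i) = (if i = 0 then e else 0)" if "i < Suc n" for i
    using col0[OF that] arg_cong[OF symA', of "\<lambda>M. M $$ (0,i)"] A' that by simp
  define A3 where "A3 = Matrix.mat n n (\<lambda>(i,j). A' $$ (Suc i, Suc j))"
  have A3: "A3 \<in> carrier_mat n n" by (simp add: A3_def)
  have symA3: "transpose_mat A3 = A3"
  proof (rule eq_matI)
    fix i j assume "i < dim_row A3" "j < dim_col A3"
    then show "transpose_mat A3 $$ (i,j) = A3 $$ (i,j)"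
      using arg_cong[OF symA', of "\<lambda>M. M $$ (Suc i, Suc j)"] A' by (auto simp: A3_def)
  qed (auto simp: A3_def)
  from Suc.IH[OF A3 symA3] obtain U3 d3 where
    U3: "U3 \<in> carrier_mat n n" "transpose_mat U3 * U3 = 1\<^sub>m n" "A3 * U3 = U3 * mat_diag n d3" by blast
  let ?z = "0\<^sub>m 1 n :: real Matrix.mat" and ?z' = "0\<^sub>m n 1 :: real Matrix.mat"
  define E where "E = Matrix.mat 1 1 (\<lambda>_. e)"
  have E: "E \<in> carrier_mat 1 1" by (simp add: E_def)
  define U' where "U' = four_block_mat (1\<^sub>m 1) ?z ?z' U3"
  define d where "d i = (if i = 0 then e else d3 (i - 1))" for i
  have blk: "A' = four_block_mat E ?z ?z' A3"
    by (rule eq_matI) (use A' in \<open>auto simp: E_def A3_def col0 row0\<close>)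
  have dblk: "mat_diag (Suc n) d = four_block_mat E ?z ?z' (mat_diag n d3)"
    by (rule eq_matI) (auto simp: E_def mat_diag_def d_def)
  have U': "U' \<in> carrier_mat (Suc n) (Suc n)" 
    unfolding U'_def using four_block_carrier_mat[OF one_carrier_mat[of 1] U3(1), of ?z ?z'] by simp
  have orth': "transpose_mat U' * U' = 1\<^sub>m (Suc n)"
  proof -
    have "transpose_mat U' = four_block_mat (1\<^sub>m 1) ?z ?z' (transpose_mat U3)"
      unfolding U'_def using U3 by (subst transpose_four_block_mat) auto
    then have "transpose_mat U' * U' = four_block_mat (1\<^sub>m 1) ?z ?z' (1\<^sub>m n)"
      unfolding U'_def using U3 by (simp only: mult_block_diagonal transpose_carrier_mat one_carrier_mat left_mult_one_mat[OF one_carrier_mat])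
    also have "\<dots> = 1\<^sub>m (Suc n)" by (rule eq_matI) auto
    finally show ?thesis .
  qed
  have "A' * U' = four_block_mat E ?z ?z' (A3 * U3)"
    unfolding blk U'_def using mult_block_diagonal[OF E one_carrier_mat A3 U3(1)] E by simp
  also have "\<dots> = U' * mat_diag (Suc n) d"
    unfolding dblk U'_def U3(3)
    using mult_block_diagonal[OF one_carrier_mat E U3(1) mat_diag_dim[of n d3]] E by simp
  finally have diag': "A' * U' = U' * mat_diag (Suc n) d" .
  let ?N = "Suc n"
  note assoc = assoc_mult_mat[of _ ?N ?N _ ?N _ ?N]
  have AW: "A * W = W * A'"
  proof -
    have "W * A' = (W * W) * (A * W)" unfolding A'_def using W(1) A by (simp add: assoc)
    then show ?thesis using W A by simp
  qed
  have "transpose_mat (W * U') * (W * U') = transpose_mat U' * (W * (W * U'))"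
    using W U' by (simp add: transpose_mult[of _ ?N ?N _ ?N] assoc)
  also have "\<dots> = transpose_mat U' * ((W * W) * U')" using W(1) U' by (simp add: assoc)
  also have "\<dots> = 1\<^sub>m ?N" using W(3) U' orth' by simp
  finally have 1: "transpose_mat (W * U') * (W * U') = 1\<^sub>m ?N" .
  have "A * (W * U') = (A * W) * U'" using A W U' by (simp add: assoc)
  also have "\<dots> = W * (A' * U')" unfolding AW using A' W U' by (simp add: assoc)
  also have "\<dots> = (W * U') * mat_diag ?N d" unfolding diag' using W U' by (simp add: assoc)
  finally have 2: "A * (W * U') = (W * U') * mat_diag ?N d" .
  show ?case using 1 2 W U' by (intro exI[of _ "W * U'"] exI[of _ d]) auto
qed

lemma proots_prod_linear_factors:
  "proots (\<Prod>a\<leftarrow>xs. [:- a, 1:]) = mset (xs :: real list)"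
proof (induction xs)
  case (Cons x xs)
  have "monic (\<Prod>a\<leftarrow>xs. [:- a, 1:])" by (rule monic_prod_list) auto
  then have "(\<Prod>a\<leftarrow>xs. [:- a, 1:]) \<noteq> 0" by auto
  then show ?case using Cons by (simp add: proots_mult del: mult_pCons_left)
qed simp

lemma sorting_permutation:
  fixes d :: "nat \<Rightarrow> real"
  obtains f where "f permutes {..<n}" "\<And>i. i < n \<Longrightarrow> sort (map d [0..<n]) ! i = d (f i)"
proof -
  define xs where "xs = map d [0..<n]"
  obtain f where f: "f permutes {..<length xs}" "permute_list f xs = sort xs"
    using mset_eq_permutation[of "sort xs" xs] by auto
  have fn: "f permutes {..<n}" using f(1) by (simp add: xs_def)
  have "sort xs ! i = d (f i)" if "i < n" for i
  proof -
    have "sort xs ! i = xs ! f i"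
      using f that by (metis permute_list_nth length_map xs_def length_upt diff_zero)
    moreover have "f i < n" using permutes_in_image[OF fn, of i] that by simp
    ultimately show ?thesis by (simp add: xs_def)
  qed
  then show ?thesis using that fn unfolding xs_def by blast
qed

text \<open>
  The spectral theorem in the form used below: in the coordinates \<open>U x\<close> the quadratic form of \<open>A\<close> is
  diagonal, with the eigenvalues in the order of their index. The eigenvalues of the characteristic
  polynomial are those of the spectral theorem because similar matrices have the same one.
\<close>

lemma ordered_spectral_form:
  fixes A :: "real Matrix.mat"
  assumes A: "A \<in> carrier_mat n n" and sym: "transpose_mat A = A"
  obtains U where "U \<in> carrier_mat n n" "U * transpose_mat U = 1\<^sub>m n"
    "\<And>x. x \<in> carrier_vec n \<Longrightarrow> (\<Sum>i<n. (vec_index (U *\<^sub>v x) i)\<^sup>2) = x \<bullet> x"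
    "\<And>x. x \<in> carrier_vec n \<Longrightarrow>
       x \<bullet> (A *\<^sub>v x) = (\<Sum>i<n. ordered_eigenvalue (Suc i) A * (vec_index (U *\<^sub>v x) i)\<^sup>2)"
    "\<And>i j. i \<le> j \<Longrightarrow> j < n \<Longrightarrow> ordered_eigenvalue (Suc i) A \<le> ordered_eigenvalue (Suc j) A"
proof -
  obtain U0 d where U0: "U0 \<in> carrier_mat n n" "transpose_mat U0 * U0 = 1\<^sub>m n"
    "A * U0 = U0 * mat_diag n d"
    using spectral_theorem_real_symmetric[OF A sym] by blast
  define V where "V = transpose_mat U0"
  have V: "V \<in> carrier_mat n n" using U0 by (simp add: V_def)
  have VU: "V * U0 = 1\<^sub>m n" using U0 by (simp add: V_def)
  have UV: "U0 * V = 1\<^sub>m n" using mat_mult_left_right_inverse[OF V U0(1) VU] .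
  note assoc = assoc_mult_mat[of _ n n _ n _ n]
  have Aeq: "A = U0 * mat_diag n d * V"
  proof -
    have "A = A * (U0 * V)" using A UV by simp
    also have "\<dots> = (A * U0) * V" using assoc[OF A U0(1) V] by simp
    finally show ?thesis unfolding U0(3) .
  qed
  define xs where "xs = map d [0..<n]"
  have "similar_mat_wit A (mat_diag n d) U0 V"
    using A U0 V UV VU Aeq by (auto simp: similar_mat_wit_def Let_def)
  then have "similar_mat A (mat_diag n d)" unfolding similar_mat_def by blast
  then have "char_poly A = char_poly (mat_diag n d)" by (rule char_poly_similar)
  also have "\<dots> = (\<Prod>a\<leftarrow>diag_mat (mat_diag n d). [:- a, 1:])"
    by (rule char_poly_upper_triangular[of _ n]) (auto simp: mat_diag_def)
  also have "diag_mat (mat_diag n d) = xs"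
    unfolding diag_mat_def xs_def by (auto simp: mat_diag_def)
  finally have "sorted_list_of_multiset (proots (char_poly A)) = sort xs"
    by (simp add: proots_prod_linear_factors)
  then have oe: "ordered_eigenvalue (Suc i) A = sort xs ! i" for i
    by (simp add: ordered_eigenvalue_def)
  obtain f where fn: "f permutes {..<n}" and nth: "\<And>i. i < n \<Longrightarrow> sort xs ! i = d (f i)"
    unfolding xs_def using sorting_permutation by metis
  have f_lt: "f i < n" if "i < n" for i using permutes_in_image[OF fn, of i] that by simp
  have oe': "ordered_eigenvalue (Suc i) A = d (f i)" if "i < n" for i
    using nth[OF that] by (simp add: oe)
  define U where "U = Matrix.mat n n (\<lambda>(i,j). V $$ (f i, j))"
  have U: "U \<in> carrier_mat n n" by (simp add: U_def)
  have Ux: "vec_index (U *\<^sub>v x) i = vec_index (V *\<^sub>v x) (f i)" if "x \<in> carrier_vec n" "i < n" for x i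
    using that f_lt V by (simp add: U_def scalar_prod_def)
  have reindex: "(\<Sum>i<n. g (f i)) = (\<Sum>i<n. g i)" for g :: "nat \<Rightarrow> real"
    using sum.permute[OF fn, of g] by (simp add: o_def)
  have norm: "(V *\<^sub>v x) \<bullet> (V *\<^sub>v y) = x \<bullet> y" if "x \<in> carrier_vec n" "y \<in> carrier_vec n" for x y
  proof -
    have "(V *\<^sub>v x) \<bullet> (V *\<^sub>v y) = x \<bullet> (U0 *\<^sub>v (V *\<^sub>v y))"
      using that V U0 by (simp add: V_def transpose_vec_mult_scalar[of U0 n n])
    also have "U0 *\<^sub>v (V *\<^sub>v y) = (U0 * V) *\<^sub>v y" using that V U0 by simp
    finally show ?thesis using UV that by simp
  qed
  show ?thesis
  proof
    show "U \<in> carrier_mat n n" by fact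
    show "U * transpose_mat U = 1\<^sub>m n"
    proof (rule eq_matI)
      fix i j assume "i < dim_row (1\<^sub>m n :: real Matrix.mat)" "j < dim_col (1\<^sub>m n :: real Matrix.mat)"
      then have ij: "i < n" "j < n" by auto
      have "(U * transpose_mat U) $$ (i,j) = (\<Sum>k<n. V $$ (f i,k) * V $$ (f j, k))"
        using ij by (simp add: U_def scalar_prod_def lessThan_atLeast0)
      also have "\<dots> = (V * U0) $$ (f i, f j)"
        using f_lt[OF ij(1)] f_lt[OF ij(2)] U0(1) by (simp add: V_def scalar_prod_def lessThan_atLeast0)
      also have "\<dots> = (if i = j then 1 else 0)"
        unfolding VU using f_lt ij permutes_inj[OF fn] by (auto dest: injD)
      finally show "(U * transpose_mat U) $$ (i,j) = 1\<^sub>m n $$ (i,j)" using ij by simp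
    qed (auto simp: U_def)
    fix x :: "real Matrix.vec" assume x: "x \<in> carrier_vec n"
    have "(\<Sum>i<n. (vec_index (U *\<^sub>v x) i)\<^sup>2) = (\<Sum>i<n. (vec_index (V *\<^sub>v x) (f i))\<^sup>2)"
      by (intro sum.cong refl) (simp only: Ux[OF x] lessThan_iff)
    also have "\<dots> = (\<Sum>i<n. (vec_index (V *\<^sub>v x) i)\<^sup>2)" by (rule reindex)
    also have "\<dots> = (V *\<^sub>v x) \<bullet> (V *\<^sub>v x)"
      using V by (simp add: scalar_prod_def[of "V *\<^sub>v x"] power2_eq_square lessThan_atLeast0)
    finally show "(\<Sum>i<n. (vec_index (U *\<^sub>v x) i)\<^sup>2) = x \<bullet> x" using norm[OF x x] by simp
    have "x \<bullet> (A *\<^sub>v x) = x \<bullet> (U0 *\<^sub>v (mat_diag n d *\<^sub>v (V *\<^sub>v x)))"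
      unfolding Aeq using U0 V x by (simp add: assoc_mult_mat_vec[of _ n n _ n])
    also have "\<dots> = (V *\<^sub>v x) \<bullet> (mat_diag n d *\<^sub>v (V *\<^sub>v x))"
      unfolding V_def
      by (rule transpose_vec_mult_scalar[symmetric, OF U0(1)])
        (use x U0(1) in \<open>auto intro!: mult_mat_vec_carrier[of _ n n]\<close>)
    also have "\<dots> = (\<Sum>i<n. vec_index (V *\<^sub>v x) i * (\<Sum>j<n. (if i = j then d j else 0) * vec_index (V *\<^sub>v x) j))"
      using V x by (simp add: scalar_prod_def[of "V *\<^sub>v x"] lessThan_atLeast0)
        (auto intro!: sum.cong simp: mat_diag_def scalar_prod_def)
    also have "\<dots> = (\<Sum>i<n. d i * (vec_index (V *\<^sub>v x) i)\<^sup>2)"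
    proof (intro sum.cong refl)
      fix i assume i: "i \<in> {..<n}"
      have "(\<Sum>j<n. (if i = j then d j else 0) * vec_index (V *\<^sub>v x) j)
        = (\<Sum>j<n. if j = i then d i * vec_index (V *\<^sub>v x) i else 0)"
        by (intro sum.cong) auto
      also have "\<dots> = d i * vec_index (V *\<^sub>v x) i" using i by simp
      finally show "vec_index (V *\<^sub>v x) i * (\<Sum>j<n. (if i = j then d j else 0) * vec_index (V *\<^sub>v x) j)
        = d i * (vec_index (V *\<^sub>v x) i)\<^sup>2" by (simp add: power2_eq_square)
    qed
    also have "\<dots> = (\<Sum>i<n. d (f i) * (vec_index (V *\<^sub>v x) (f i))\<^sup>2)"
      by (rule reindex[symmetric])
    also have "\<dots> = (\<Sum>i<n. ordered_eigenvalue (Suc i) A * (vec_index (U *\<^sub>v x) i)\<^sup>2)"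
      by (intro sum.cong refl) (simp only: Ux[OF x] oe' lessThan_iff)
    finally show "x \<bullet> (A *\<^sub>v x) = (\<Sum>i<n. ordered_eigenvalue (Suc i) A * (vec_index (U *\<^sub>v x) i)\<^sup>2)" .
  next
    fix i j :: nat assume "i \<le> j" "j < n"
    then show "ordered_eigenvalue (Suc i) A \<le> ordered_eigenvalue (Suc j) A"
      unfolding oe by (intro sorted_nth_mono) (auto simp: xs_def)
  qed
qed

section \<open>Comparison of ordered eigenvalues\<close>

text \<open>
  A two-sided version of Ostrowski's inequality, by the argument of Courant and Fischer. The vectors on
  which the first \<open>i\<close> of the coordinates \<open>(Q x)\<^bsub>f l\<^esub>\<close> and the last \<open>n - 1 - i\<close> of the spectral coordinates
  \<open>(U x)\<^sub>l\<close> vanish are the solutions of \<open>n - 1\<close> linear equations in \<open>n\<close> unknowns, so there is a nonzero one; on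
  it the form is at most \<open>ordered_eigenvalue (Suc i) A\<close> times \<open>|x|\<^sup>2\<close> and at least \<open>c \<alpha> d\<^bsub>f i\<^esub>\<close> times \<open>|x|\<^sup>2\<close>. For the upper bound the
  roles of the two families of coordinates are exchanged.
\<close>

lemma eigenvalue_comparison:
  fixes A Q :: "real Matrix.mat" and d :: "nat \<Rightarrow> real"
  assumes A: "A \<in> carrier_mat n n" and sym: "transpose_mat A = A" and Q: "Q \<in> carrier_mat n n"
    and f: "bij_betw f {..<n} {..<n}" and mono: "\<And>i j. i \<le> j \<Longrightarrow> j < n \<Longrightarrow> d (f i) \<le> d (f j)"
    and d0: "\<And>i. i < n \<Longrightarrow> 0 \<le> d i"
    and \<alpha>: "0 \<le> \<alpha>" "\<And>x. x \<in> carrier_vec n \<Longrightarrow> \<alpha> * (x \<bullet> x) \<le> (Q *\<^sub>v x) \<bullet> (Q *\<^sub>v x)"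
    and \<beta>: "\<And>x. x \<in> carrier_vec n \<Longrightarrow> (Q *\<^sub>v x) \<bullet> (Q *\<^sub>v x) \<le> \<beta> * (x \<bullet> x)"
    and c: "0 \<le> c" "\<And>x. x \<in> carrier_vec n \<Longrightarrow>
          c * (\<Sum>l<n. d l * (vec_index (Q *\<^sub>v x) l)\<^sup>2) \<le> x \<bullet> (A *\<^sub>v x)"
    and C: "0 \<le> C" "\<And>x. x \<in> carrier_vec n \<Longrightarrow>
          x \<bullet> (A *\<^sub>v x) \<le> C * (\<Sum>l<n. d l * (vec_index (Q *\<^sub>v x) l)\<^sup>2)"
    and i: "i < n"
  shows "c * \<alpha> * d (f i) \<le> ordered_eigenvalue (Suc i) A"
    and "ordered_eigenvalue (Suc i) A \<le> C * \<beta> * d (f i)"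
proof -
  let ?ev = "\<lambda>k. ordered_eigenvalue (Suc k) A"
  obtain U where U: "U \<in> carrier_mat n n" and "U * transpose_mat U = 1\<^sub>m n"
    and norm: "\<And>x. x \<in> carrier_vec n \<Longrightarrow> (\<Sum>i<n. (vec_index (U *\<^sub>v x) i)\<^sup>2) = x \<bullet> x"
    and form: "\<And>x. x \<in> carrier_vec n \<Longrightarrow>
       x \<bullet> (A *\<^sub>v x) = (\<Sum>i<n. ?ev i * (vec_index (U *\<^sub>v x) i)\<^sup>2)"
    and ev_mono: "\<And>i j. i \<le> j \<Longrightarrow> j < n \<Longrightarrow> ?ev i \<le> ?ev j"
    by (rule ordered_spectral_form[OF A sym]) (rule that, assumption+)
  have f_lt: "f k < n" if "k < n" for k using bij_betwE[OF f] that by auto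
  have Qnorm: "(Q *\<^sub>v x) \<bullet> (Q *\<^sub>v x) = (\<Sum>l<n. (vec_index (Q *\<^sub>v x) (f l))\<^sup>2)" if "x \<in> carrier_vec n" for x
    using sum.reindex_bij_betw[OF f, of "\<lambda>l. (vec_index (Q *\<^sub>v x) l)\<^sup>2"] that Q
    by (simp add: scalar_prod_def[of "Q *\<^sub>v x"] power2_eq_square lessThan_atLeast0)
  have Qform: "(\<Sum>l<n. d l * (vec_index (Q *\<^sub>v x) l)\<^sup>2) = (\<Sum>l<n. d (f l) * (vec_index (Q *\<^sub>v x) (f l))\<^sup>2)" for x
    using sum.reindex_bij_betw[OF f, of "\<lambda>l. d l * (vec_index (Q *\<^sub>v x) l)\<^sup>2"] by simp
  have ex: "\<exists>x :: real Matrix.vec. x \<in> carrier_vec n \<and> 0 < x \<bullet> x \<and> (\<forall>k<n. k \<noteq> i \<longrightarrow> (\<Sum>j<n. r k j * vec_index x j) = 0)"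
    for r :: "nat \<Rightarrow> nat \<Rightarrow> real"
  proof -
    \<comment> \<open>row \<open>i\<close> is free, so it is filled with zeros: a singular square matrix has a nonzero kernel\<close>
    define R where "R = Matrix.mat n n (\<lambda>(k,j). if k = i then 0 else r k j)"
    have R: "R \<in> carrier_mat n n" by (simp add: R_def)
    have "R = mat\<^sub>r n n (\<lambda>k. if k = i then 0\<^sub>v n else Matrix.vec n (r k))"
      by (rule eq_matI) (auto simp: R_def)
    then have "det R = 0" using det_row_0[OF i, of "\<lambda>k. Matrix.vec n (r k)"] by auto
    then obtain x where x: "x \<in> carrier_vec n" "x \<noteq> 0\<^sub>v n" "R *\<^sub>v x = 0\<^sub>v n"
      using det_0_iff_vec_prod_zero_field[OF R] by auto
    have "(\<Sum>j<n. r k j * vec_index x j) = 0" if "k < n" "k \<noteq> i" for k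
      using arg_cong[OF x(3), of "\<lambda>v. vec_index v k"] that x(1) R
      by (simp add: R_def scalar_prod_def lessThan_atLeast0)
    then show ?thesis using x scalar_prod_self_pos by blast
  qed
  have Urow: "vec_index (U *\<^sub>v x) k = (\<Sum>j<n. U $$ (k,j) * vec_index x j)"
    if "k < n" "x \<in> carrier_vec n" for k x
    using that U by (simp add: scalar_prod_def lessThan_atLeast0)
  have Qrow: "vec_index (Q *\<^sub>v x) (f k) = (\<Sum>j<n. Q $$ (f k,j) * vec_index x j)"
    if "k < n" "x \<in> carrier_vec n" for k x
    using that Q f_lt[of k] by (simp add: scalar_prod_def lessThan_atLeast0)
  show "c * \<alpha> * d (f i) \<le> ?ev i"
  proof -
    obtain x :: "real Matrix.vec" where x: "x \<in> carrier_vec n" "0 < x \<bullet> x"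
      and xr: "\<And>k. k < n \<Longrightarrow> k \<noteq> i \<Longrightarrow>
        (\<Sum>j<n. (if k < i then Q $$ (f k,j) else U $$ (k,j)) * vec_index x j) = 0"
      using ex[of "\<lambda>k j. if k < i then Q $$ (f k,j) else U $$ (k,j)"] by blast
    have Q0: "vec_index (Q *\<^sub>v x) (f k) = 0" if "k < i" for k
      using xr[of k] that i by (subst Qrow) (use x in auto)
    have U0: "vec_index (U *\<^sub>v x) k = 0" if "i < k" "k < n" for k
      using xr[of k] that by (subst Urow) (use x in auto)
    have "c * (\<alpha> * (x \<bullet> x) * d (f i)) \<le> c * (\<Sum>l<n. d (f l) * (vec_index (Q *\<^sub>v x) (f l))\<^sup>2)"
    proof (intro mult_left_mono c)
      have "\<alpha> * (x \<bullet> x) * d (f i) \<le> (\<Sum>l<n. (vec_index (Q *\<^sub>v x) (f l))\<^sup>2) * d (f i)"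
        using \<alpha>(2)[OF x(1)] d0[OF f_lt[OF i]] Qnorm[OF x(1)] by (intro mult_right_mono) auto
      also have "\<dots> \<le> (\<Sum>l<n. d (f l) * (vec_index (Q *\<^sub>v x) (f l))\<^sup>2)"
        unfolding sum_distrib_right
      proof (rule sum_mono)
        fix l assume l: "l \<in> {..<n}"
        show "(vec_index (Q *\<^sub>v x) (f l))\<^sup>2 * d (f i) \<le> d (f l) * (vec_index (Q *\<^sub>v x) (f l))\<^sup>2"
        proof (cases "l < i")
          case False
          then have "d (f i) \<le> d (f l)" using mono[of i l] l by auto
          then show ?thesis by (subst mult.commute) (intro mult_right_mono zero_le_power2)
        qed (simp add: Q0)
      qed
      finally show "\<alpha> * (x \<bullet> x) * d (f i) \<le> (\<Sum>l<n. d (f l) * (vec_index (Q *\<^sub>v x) (f l))\<^sup>2)" .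
    qed
    also have "\<dots> \<le> x \<bullet> (A *\<^sub>v x)" using c(2)[OF x(1)] by (simp add: Qform)
    also have "\<dots> \<le> ?ev i * (x \<bullet> x)"
      unfolding form[OF x(1)] norm[OF x(1), symmetric] sum_distrib_left
    proof (rule sum_mono)
      fix k assume k: "k \<in> {..<n}"
      show "?ev k * (vec_index (U *\<^sub>v x) k)\<^sup>2 \<le> ?ev i * (vec_index (U *\<^sub>v x) k)\<^sup>2"
        using ev_mono[of k i] i k U0[of k] by (cases "k \<le> i") (auto intro: mult_right_mono)
    qed
    finally have "(c * \<alpha> * d (f i)) * (x \<bullet> x) \<le> ?ev i * (x \<bullet> x)" by (simp add: mult_ac)
    then show ?thesis using x(2) by simp
  qed
  show "?ev i \<le> C * \<beta> * d (f i)"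
  proof -
    obtain x :: "real Matrix.vec" where x: "x \<in> carrier_vec n" "0 < x \<bullet> x"
      and xr: "\<And>k. k < n \<Longrightarrow> k \<noteq> i \<Longrightarrow>
        (\<Sum>j<n. (if k < i then U $$ (k,j) else Q $$ (f k,j)) * vec_index x j) = 0"
      using ex[of "\<lambda>k j. if k < i then U $$ (k,j) else Q $$ (f k,j)"] by blast
    have Q0: "vec_index (Q *\<^sub>v x) (f k) = 0" if "i < k" "k < n" for k
      using xr[of k] that by (subst Qrow) (use x in auto)
    have U0: "vec_index (U *\<^sub>v x) k = 0" if "k < i" for k
      using xr[of k] that i by (subst Urow) (use x in auto)
    have "?ev i * (x \<bullet> x) \<le> x \<bullet> (A *\<^sub>v x)"
      unfolding form[OF x(1)] norm[OF x(1), symmetric] sum_distrib_left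
    proof (rule sum_mono)
      fix k assume k: "k \<in> {..<n}"
      show "?ev i * (vec_index (U *\<^sub>v x) k)\<^sup>2 \<le> ?ev k * (vec_index (U *\<^sub>v x) k)\<^sup>2"
        using ev_mono[of i k] i k U0[of k] by (cases "i \<le> k") (auto intro: mult_right_mono)
    qed
    also have "\<dots> \<le> C * (\<Sum>l<n. d (f l) * (vec_index (Q *\<^sub>v x) (f l))\<^sup>2)"
      using C(2)[OF x(1)] by (simp add: Qform)
    also have "\<dots> \<le> C * (\<beta> * (x \<bullet> x) * d (f i))"
    proof (intro mult_left_mono C)
      have "(\<Sum>l<n. d (f l) * (vec_index (Q *\<^sub>v x) (f l))\<^sup>2) \<le> (\<Sum>l<n. (vec_index (Q *\<^sub>v x) (f l))\<^sup>2) * d (f i)"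
        unfolding sum_distrib_right
      proof (rule sum_mono)
        fix l assume l: "l \<in> {..<n}"
        show "d (f l) * (vec_index (Q *\<^sub>v x) (f l))\<^sup>2 \<le> (vec_index (Q *\<^sub>v x) (f l))\<^sup>2 * d (f i)"
        proof (cases "i < l")
          case False
          then have "d (f l) \<le> d (f i)" using mono[of l i] i by auto
          then show ?thesis by (subst mult.commute) (intro mult_left_mono zero_le_power2)
        qed (use l in \<open>simp add: Q0\<close>)
      qed
      also have "\<dots> \<le> \<beta> * (x \<bullet> x) * d (f i)"
        using \<beta>[OF x(1)] d0[OF f_lt[OF i]] Qnorm[OF x(1)] by (intro mult_right_mono) auto
      finally show "(\<Sum>l<n. d (f l) * (vec_index (Q *\<^sub>v x) (f l))\<^sup>2) \<le> \<beta> * (x \<bullet> x) * d (f i)" .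
    qed
    finally have "?ev i * (x \<bullet> x) \<le> (C * \<beta> * d (f i)) * (x \<bullet> x)" by (simp add: mult_ac)
    then show ?thesis using x(2) by simp
  qed
qed

text \<open>
  Only the extreme eigenvalues are bounded by the quadratic form on all vectors; every eigenvalue is a
  value of the form at some unit vector.
\<close>

lemma
  fixes A :: "real Matrix.mat"
  assumes A: "A \<in> carrier_mat n n" and sym: "transpose_mat A = A"
  shows rayleigh_lower: "x \<in> carrier_vec n \<Longrightarrow> ordered_eigenvalue 1 A * (x \<bullet> x) \<le> x \<bullet> (A *\<^sub>v x)"
    and rayleigh_upper: "x \<in> carrier_vec n \<Longrightarrow> x \<bullet> (A *\<^sub>v x) \<le> ordered_eigenvalue n A * (x \<bullet> x)"
    and rayleigh_attained: "i < n \<Longrightarrow>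
      \<exists>x :: real Matrix.vec. x \<in> carrier_vec n \<and> x \<bullet> x = 1 \<and> x \<bullet> (A *\<^sub>v x) = ordered_eigenvalue (Suc i) A"
proof -
  let ?ev = "\<lambda>k. ordered_eigenvalue (Suc k) A"
  obtain U where U: "U \<in> carrier_mat n n" "U * transpose_mat U = 1\<^sub>m n"
    and norm: "\<And>x. x \<in> carrier_vec n \<Longrightarrow> (\<Sum>i<n. (vec_index (U *\<^sub>v x) i)\<^sup>2) = x \<bullet> x"
    and form: "\<And>x. x \<in> carrier_vec n \<Longrightarrow>
       x \<bullet> (A *\<^sub>v x) = (\<Sum>i<n. ?ev i * (vec_index (U *\<^sub>v x) i)\<^sup>2)"
    and ev_mono: "\<And>i j. i \<le> j \<Longrightarrow> j < n \<Longrightarrow> ?ev i \<le> ?ev j"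
    by (rule ordered_spectral_form[OF A sym]) (rule that, assumption+)
  show "ordered_eigenvalue 1 A * (x \<bullet> x) \<le> x \<bullet> (A *\<^sub>v x)" if x: "x \<in> carrier_vec n"
    unfolding form[OF x] norm[OF x, symmetric] sum_distrib_left
    by (intro sum_mono mult_right_mono) (use ev_mono[of 0] in auto)
  show "x \<bullet> (A *\<^sub>v x) \<le> ordered_eigenvalue n A * (x \<bullet> x)" if x: "x \<in> carrier_vec n"
    unfolding form[OF x] norm[OF x, symmetric] sum_distrib_left
  proof (intro sum_mono mult_right_mono)
    fix i assume "i \<in> {..<n}"
    then show "ordered_eigenvalue (Suc i) A \<le> ordered_eigenvalue n A" using ev_mono[of i "n - 1"] by auto
  qed auto
  assume i: "i < n"
  define x where "x = col (transpose_mat U) i"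
  have x: "x \<in> carrier_vec n" using U i by (auto simp: x_def)
  have "U *\<^sub>v x = col (U * transpose_mat U) i"
    unfolding x_def using U i by (subst col_mult2[of U n n _ n]) auto
  then have Ux: "vec_index (U *\<^sub>v x) k = (if k = i then 1 else 0)" if "k < n" for k
    unfolding U(2) using that i by simp
  have "(\<Sum>k<n. (vec_index (U *\<^sub>v x) k)\<^sup>2) = (\<Sum>k<n. if k = i then 1 else 0)"
    by (intro sum.cong refl) (simp only: lessThan_iff Ux, simp)
  then have 1: "x \<bullet> x = 1" using norm[OF x] i by simp
  have "(\<Sum>k<n. ?ev k * (vec_index (U *\<^sub>v x) k)\<^sup>2) = (\<Sum>k<n. if k = i then ?ev i else 0)"
    by (intro sum.cong refl) (simp only: lessThan_iff Ux, simp)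
  then have "x \<bullet> (A *\<^sub>v x) = ?ev i" using form[OF x] i by simp
  with 1 x show "\<exists>x :: real Matrix.vec. x \<in> carrier_vec n \<and> x \<bullet> x = 1 \<and> x \<bullet> (A *\<^sub>v x) = ?ev i" by blast
qed

text \<open>
  The singular values are defined through \<open>P\<^sup>T P\<close>, while the quadratic form of \<open>P B P\<^sup>T\<close> involves \<open>|P\<^sup>T x|\<close>, that
  is, \<open>P P\<^sup>T\<close>. As \<open>P\<close> is invertible, these two matrices are similar.
\<close>

lemma
  fixes P :: "real Matrix.mat"
  assumes P: "P \<in> carrier_mat n n" and inv: "invertible_mat P" and n: "n \<ge> 1"
  shows singular_value_pos: "ordered_singular_value 1 P > 0" "ordered_singular_value n P > 0"
    and singular_value_lower: "x \<in> carrier_vec n \<Longrightarrow>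
      (ordered_singular_value 1 P)\<^sup>2 * (x \<bullet> x) \<le> (transpose_mat P *\<^sub>v x) \<bullet> (transpose_mat P *\<^sub>v x)"
    and singular_value_upper: "x \<in> carrier_vec n \<Longrightarrow>
      (transpose_mat P *\<^sub>v x) \<bullet> (transpose_mat P *\<^sub>v x) \<le> (ordered_singular_value n P)\<^sup>2 * (x \<bullet> x)"
proof -
  define B where "B = P * transpose_mat P"
  have B: "B \<in> carrier_mat n n" using P by (simp add: B_def)
  have symB: "transpose_mat B = B" unfolding B_def using P by (simp add: transpose_mult[of _ n n _ n])
  obtain R where R: "P * R = 1\<^sub>m n" "R * P = 1\<^sub>m (dim_row R)"
    using inv P unfolding invertible_mat_def inverts_mat_def by auto
  have Rc: "R \<in> carrier_mat n n"
    using arg_cong[OF R(1), of dim_col] arg_cong[OF R(2), of dim_col] P by auto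
  note assoc = assoc_mult_mat[of _ n n _ n _ n]
  have "P * (transpose_mat P * P) * R = P * transpose_mat P * (P * R)" using P Rc by (simp add: assoc)
  also have "\<dots> = B" using P R by (simp add: B_def)
  finally have "similar_mat_wit B (transpose_mat P * P) P R"
    using P Rc R B by (auto simp: similar_mat_wit_def Let_def)
  then have "char_poly B = char_poly (transpose_mat P * P)"
    by (intro char_poly_similar) (auto simp: similar_mat_def)
  then have ev: "ordered_eigenvalue l (transpose_mat P * P) = ordered_eigenvalue l B" for l
    by (simp add: ordered_eigenvalue_def)
  have form: "x \<bullet> (B *\<^sub>v x) = (transpose_mat P *\<^sub>v x) \<bullet> (transpose_mat P *\<^sub>v x)"
    if "x \<in> carrier_vec n" for x
    using that P by (simp add: B_def transpose_vec_mult_scalar[of P n n])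
  have pos: "ordered_eigenvalue (Suc i) B > 0" if i: "i < n" for i
  proof -
    obtain x :: "real Matrix.vec" where x: "x \<in> carrier_vec n" "x \<bullet> x = 1" "x \<bullet> (B *\<^sub>v x) = ordered_eigenvalue (Suc i) B"
      using rayleigh_attained[OF B symB i] by blast
    let ?y = "transpose_mat P *\<^sub>v x"
    have y: "?y \<in> carrier_vec n" using P x by auto
    have "?y \<noteq> 0\<^sub>v n"
    proof
      assume "?y = 0\<^sub>v n"
      then have "transpose_mat R *\<^sub>v ?y = 0\<^sub>v n" using Rc by auto
      moreover have "transpose_mat R *\<^sub>v ?y = transpose_mat (P * R) *\<^sub>v x"
        using P Rc x by (simp add: transpose_mult[of _ n n _ n])
      ultimately have "x = 0\<^sub>v n" using R x by simp
      then show False using x by simp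
    qed
    then have "0 < ?y \<bullet> ?y" by (rule scalar_prod_self_pos[OF y])
    then show ?thesis using form[OF x(1)] x(3) by linarith
  qed
  have nn: "Suc (n - 1) = n" using n by simp
  have p1: "ordered_eigenvalue 1 B > 0" using pos[of 0] n by simp
  have pn: "ordered_eigenvalue n B > 0" using pos[of "n - 1"] n nn by simp
  show "ordered_singular_value 1 P > 0" "ordered_singular_value n P > 0"
    using p1 pn by (auto simp: ordered_singular_value_def ev)
  have sq: "(ordered_singular_value 1 P)\<^sup>2 = ordered_eigenvalue 1 B"
    "(ordered_singular_value n P)\<^sup>2 = ordered_eigenvalue n B"
    using p1 pn by (auto simp: ordered_singular_value_def ev)
  show "(ordered_singular_value 1 P)\<^sup>2 * (x \<bullet> x) \<le> (transpose_mat P *\<^sub>v x) \<bullet> (transpose_mat P *\<^sub>v x)"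
    "(transpose_mat P *\<^sub>v x) \<bullet> (transpose_mat P *\<^sub>v x) \<le> (ordered_singular_value n P)\<^sup>2 * (x \<bullet> x)"
    if "x \<in> carrier_vec n"
    unfolding sq form[OF that, symmetric] using rayleigh_lower[OF B symB that] rayleigh_upper[OF B symB that] by auto
qed

section \<open>Measurability of the extreme singular values\<close>

lemma real_limit_of_rationals: "\<exists>q :: nat \<Rightarrow> rat. (\<lambda>k. real_of_rat (q k)) \<longlonglongrightarrow> x"
proof -
  have "\<forall>k. \<exists>q. x - inverse (real (Suc k)) < real_of_rat q \<and> real_of_rat q < x"
    by (intro allI of_rat_dense) simp
  then obtain q where q: "x - inverse (real (Suc k)) < real_of_rat (q k)" "real_of_rat (q k) < x" for k
    by metis
  have lim: "(\<lambda>k. x - inverse (real (Suc k))) \<longlonglongrightarrow> x"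
    using tendsto_diff[OF tendsto_const LIMSEQ_inverse_real_of_nat, of x] by simp
  have "(\<lambda>k. real_of_rat (q k)) \<longlonglongrightarrow> x"
    by (rule tendsto_sandwich[OF _ _ lim tendsto_const]) (auto intro!: always_eventually less_imp_le q simp del: of_nat_Suc)
  then show ?thesis by blast
qed

text \<open>
  By continuity of the form in \<open>x\<close>, rational vectors suffice; so the event is a countable union. Lists serve
  to index a countable family of vectors: those of length \<open>n\<close> give all rational vectors, and the others do no
  harm, since any vector at which the form is negative is a witness.
\<close>

lemma sets_quadratic_form_neg:
  fixes a :: "'a \<Rightarrow> nat \<Rightarrow> nat \<Rightarrow> real"
  assumes [measurable]: "\<And>i j. i < n \<Longrightarrow> j < n \<Longrightarrow> (\<lambda>\<omega>. a \<omega> i j) \<in> borel_measurable M"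
  shows "{\<omega> \<in> space M. \<exists>x. (\<Sum>i<n. \<Sum>j<n. a \<omega> i j * x i * x j) < 0} \<in> sets M"
proof -
  let ?q = "\<lambda>\<omega> x. \<Sum>i<n. \<Sum>j<n. a \<omega> i j * x i * x j"
  let ?r = "\<lambda>xs i. real_of_rat (xs ! i)"
  have dense: "(\<exists>x. ?q \<omega> x < 0) \<longleftrightarrow> (\<exists>xs. ?q \<omega> (?r xs) < 0)" for \<omega>
  proof
    assume "\<exists>x. ?q \<omega> x < 0"
    then obtain x where x: "?q \<omega> x < 0" by blast
    have "\<forall>i. \<exists>q :: nat \<Rightarrow> rat. (\<lambda>k. real_of_rat (q k)) \<longlonglongrightarrow> x i"
      by (intro allI real_limit_of_rationals)
    from choice[OF this] obtain q :: "nat \<Rightarrow> nat \<Rightarrow> rat" where q: "\<And>i. (\<lambda>k. real_of_rat (q i k)) \<longlonglongrightarrow> x i"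
      by blast
    have "(\<lambda>k. ?q \<omega> (\<lambda>i. real_of_rat (q i k))) \<longlonglongrightarrow> ?q \<omega> x"
      by (intro tendsto_intros q)
    from order_tendstoD(2)[OF this x] obtain k where k: "?q \<omega> (\<lambda>i. real_of_rat (q i k)) < 0"
      by (auto simp: eventually_sequentially)
    have "?q \<omega> (?r (map (\<lambda>i. q i k) [0..<n])) = ?q \<omega> (\<lambda>i. real_of_rat (q i k))"
      by (intro sum.cong refl) auto
    with k have "?q \<omega> (?r (map (\<lambda>i. q i k) [0..<n])) < 0" by (simp only:)
    then show "\<exists>xs. ?q \<omega> (?r xs) < 0" by (rule exI)
  next
    assume "\<exists>xs. ?q \<omega> (?r xs) < 0"
    then obtain xs where "?q \<omega> (?r xs) < 0" by (elim exE)
    then show "\<exists>x. ?q \<omega> x < 0" by (rule exI[of "\<lambda>x. ?q \<omega> x < 0"])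
  qed
  have [measurable]: "(\<lambda>\<omega>. ?q \<omega> (?r xs)) \<in> borel_measurable M" for xs
    by (intro borel_measurable_sum borel_measurable_times borel_measurable_const) (use assms in auto)
  show ?thesis unfolding dense by measurable
qed

text \<open>
  The smallest eigenvalue is less than \<open>c\<close> exactly if the form \<open>A - c\<close> takes a negative value, and the largest
  one exceeds \<open>c\<close> exactly if \<open>c - A\<close> does.
\<close>

lemma
  fixes A :: "'a \<Rightarrow> real Matrix.mat"
  assumes n: "n \<ge> 1" and A: "\<And>\<omega>. \<omega> \<in> space M \<Longrightarrow> A \<omega> \<in> carrier_mat n n"
    and sym: "\<And>\<omega>. \<omega> \<in> space M \<Longrightarrow> transpose_mat (A \<omega>) = A \<omega>"
    and meas: "\<And>i j. i < n \<Longrightarrow> j < n \<Longrightarrow> (\<lambda>\<omega>. A \<omega> $$ (i,j)) \<in> borel_measurable M"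
  shows measurable_smallest_eigenvalue: "(\<lambda>\<omega>. ordered_eigenvalue 1 (A \<omega>)) \<in> borel_measurable M"
    and measurable_largest_eigenvalue: "(\<lambda>\<omega>. ordered_eigenvalue n (A \<omega>)) \<in> borel_measurable M"
proof -
  let ?D = "\<lambda>c i j. if i = j then c else (0::real)"
  have form: "(\<Sum>i<n. \<Sum>j<n. A \<omega> $$ (i,j) * x i * x j) = Matrix.vec n x \<bullet> (A \<omega> *\<^sub>v Matrix.vec n x)"
    if "\<omega> \<in> space M" for \<omega> x
    using A[OF that] by (simp add: scalar_prod_def lessThan_atLeast0 sum_distrib_left mult_ac)
  have diag: "(\<Sum>i<n. \<Sum>j<n. ?D c i j * x i * x j) = c * (Matrix.vec n x \<bullet> Matrix.vec n x)" for c x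
  proof -
    have "(\<Sum>j<n. ?D c i j * x i * x j) = c * x i * x i" if "i < n" for i
    proof -
      have "(\<Sum>j<n. ?D c i j * x i * x j) = (\<Sum>j<n. if j = i then c * x i * x i else 0)"
        by (intro sum.cong) auto
      then show ?thesis using that by simp
    qed
    then show ?thesis by (simp add: scalar_prod_def lessThan_atLeast0 sum_distrib_left mult_ac)
  qed
  have vecx: "\<exists>f. x = Matrix.vec n f" if "x \<in> carrier_vec n" for x :: "real Matrix.vec"
    using that by (intro exI[of _ "vec_index x"]) auto
  have pos: "Matrix.vec n x \<bullet> Matrix.vec n x \<ge> 0" for x :: "nat \<Rightarrow> real"
    unfolding scalar_prod_def by (intro sum_nonneg) auto
  have lt: "ordered_eigenvalue 1 (A \<omega>) < c \<longleftrightarrow>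
      (\<exists>x. (\<Sum>i<n. \<Sum>j<n. (A \<omega> $$ (i,j) - ?D c i j) * x i * x j) < 0)" if w: "\<omega> \<in> space M" for \<omega> c
  proof -
    have eq: "(\<Sum>i<n. \<Sum>j<n. (A \<omega> $$ (i,j) - ?D c i j) * x i * x j)
        = Matrix.vec n x \<bullet> (A \<omega> *\<^sub>v Matrix.vec n x) - c * (Matrix.vec n x \<bullet> Matrix.vec n x)" for x
      unfolding form[OF w, symmetric] diag[symmetric] by (simp add: sum_subtractf left_diff_distrib)
    show ?thesis unfolding eq
    proof
      assume c: "ordered_eigenvalue 1 (A \<omega>) < c"
      obtain x :: "real Matrix.vec" where x: "x \<in> carrier_vec n" "x \<bullet> x = 1"
        "x \<bullet> (A \<omega> *\<^sub>v x) = ordered_eigenvalue 1 (A \<omega>)"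
        using rayleigh_attained[OF A[OF w] sym[OF w], of 0] n by auto
      obtain f where f: "x = Matrix.vec n f" using vecx[OF x(1)] by blast
      show "\<exists>x. Matrix.vec n x \<bullet> (A \<omega> *\<^sub>v Matrix.vec n x) - c * (Matrix.vec n x \<bullet> Matrix.vec n x) < 0"
        using x c unfolding f by (intro exI[of _ f]) simp
    next
      assume "\<exists>x. Matrix.vec n x \<bullet> (A \<omega> *\<^sub>v Matrix.vec n x) - c * (Matrix.vec n x \<bullet> Matrix.vec n x) < 0"
      then obtain x where "Matrix.vec n x \<bullet> (A \<omega> *\<^sub>v Matrix.vec n x) < c * (Matrix.vec n x \<bullet> Matrix.vec n x)" by auto
      with rayleigh_lower[OF A[OF w] sym[OF w], of "Matrix.vec n x"]
      have "ordered_eigenvalue 1 (A \<omega>) * (Matrix.vec n x \<bullet> Matrix.vec n x) < c * (Matrix.vec n x \<bullet> Matrix.vec n x)" by simp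
      then show "ordered_eigenvalue 1 (A \<omega>) < c" using pos[of x] by (metis mult_right_mono not_less)
    qed
  qed
  have gt: "c < ordered_eigenvalue n (A \<omega>) \<longleftrightarrow>
      (\<exists>x. (\<Sum>i<n. \<Sum>j<n. (?D c i j - A \<omega> $$ (i,j)) * x i * x j) < 0)" if w: "\<omega> \<in> space M" for \<omega> c
  proof -
    have eq: "(\<Sum>i<n. \<Sum>j<n. (?D c i j - A \<omega> $$ (i,j)) * x i * x j)
        = c * (Matrix.vec n x \<bullet> Matrix.vec n x) - Matrix.vec n x \<bullet> (A \<omega> *\<^sub>v Matrix.vec n x)" for x
      unfolding form[OF w, symmetric] diag[symmetric] by (simp add: sum_subtractf left_diff_distrib)
    show ?thesis unfolding eq
    proof
      assume c: "c < ordered_eigenvalue n (A \<omega>)"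
      obtain x :: "real Matrix.vec" where x: "x \<in> carrier_vec n" "x \<bullet> x = 1"
        "x \<bullet> (A \<omega> *\<^sub>v x) = ordered_eigenvalue n (A \<omega>)"
        using rayleigh_attained[OF A[OF w] sym[OF w], of "n - 1"] n by auto
      obtain f where f: "x = Matrix.vec n f" using vecx[OF x(1)] by blast
      show "\<exists>x. c * (Matrix.vec n x \<bullet> Matrix.vec n x) - Matrix.vec n x \<bullet> (A \<omega> *\<^sub>v Matrix.vec n x) < 0"
        using x c unfolding f by (intro exI[of _ f]) simp
    next
      assume "\<exists>x. c * (Matrix.vec n x \<bullet> Matrix.vec n x) - Matrix.vec n x \<bullet> (A \<omega> *\<^sub>v Matrix.vec n x) < 0"
      then obtain x where "Matrix.vec n x \<bullet> (A \<omega> *\<^sub>v Matrix.vec n x) > c * (Matrix.vec n x \<bullet> Matrix.vec n x)" by auto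
      with rayleigh_upper[OF A[OF w] sym[OF w], of "Matrix.vec n x"]
      have "c * (Matrix.vec n x \<bullet> Matrix.vec n x) < ordered_eigenvalue n (A \<omega>) * (Matrix.vec n x \<bullet> Matrix.vec n x)" by simp
      then show "c < ordered_eigenvalue n (A \<omega>)" using pos[of x] by (metis mult_right_mono not_less)
    qed
  qed
  show "(\<lambda>\<omega>. ordered_eigenvalue 1 (A \<omega>)) \<in> borel_measurable M"
  proof (rule borel_measurableI_less)
    fix c
    have "{\<omega> \<in> space M. ordered_eigenvalue 1 (A \<omega>) < c} =
      {\<omega> \<in> space M. \<exists>x. (\<Sum>i<n. \<Sum>j<n. (A \<omega> $$ (i,j) - ?D c i j) * x i * x j) < 0}"
      using lt by blast
    also have "\<dots> \<in> sets M" by (rule sets_quadratic_form_neg) (use meas in simp)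
    finally show "{\<omega> \<in> space M. ordered_eigenvalue 1 (A \<omega>) < c} \<in> sets M" .
  qed
  show "(\<lambda>\<omega>. ordered_eigenvalue n (A \<omega>)) \<in> borel_measurable M"
  proof (rule borel_measurableI_greater)
    fix c
    have "{\<omega> \<in> space M. c < ordered_eigenvalue n (A \<omega>)} =
      {\<omega> \<in> space M. \<exists>x. (\<Sum>i<n. \<Sum>j<n. (?D c i j - A \<omega> $$ (i,j)) * x i * x j) < 0}"
      using gt by blast
    also have "\<dots> \<in> sets M" by (rule sets_quadratic_form_neg) (use meas in simp)
    finally show "{\<omega> \<in> space M. c < ordered_eigenvalue n (A \<omega>)} \<in> sets M" .
  qed
qed

text \<open>
  Convergence in probability bounds the measure of deviation sets, and a set that is not measurable has
  measure zero by convention. It is measurability that gives such a bound its meaning.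
\<close>

lemma measurable_extreme_singular_values:
  fixes P :: "'a \<Rightarrow> real Matrix.mat"
  assumes n: "n \<ge> 1" and P: "\<And>\<omega>. \<omega> \<in> space M \<Longrightarrow> P \<omega> \<in> carrier_mat n n"
    and meas: "\<And>i j. i < n \<Longrightarrow> j < n \<Longrightarrow> (\<lambda>\<omega>. P \<omega> $$ (i,j)) \<in> borel_measurable M"
  shows "(\<lambda>\<omega>. ordered_singular_value 1 (P \<omega>)) \<in> borel_measurable M"
    and "(\<lambda>\<omega>. ordered_singular_value n (P \<omega>)) \<in> borel_measurable M"
proof -
  have entry: "(\<lambda>\<omega>. (transpose_mat (P \<omega>) * P \<omega>) $$ (i,j)) \<in> borel_measurable M" if ij: "i < n" "j < n" for i j
  proof (subst measurable_cong)
    fix \<omega> assume "\<omega> \<in> space M"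
    from P[OF this] show "(transpose_mat (P \<omega>) * P \<omega>) $$ (i,j) = (\<Sum>k<n. P \<omega> $$ (k,i) * P \<omega> $$ (k,j))"
      using ij by (simp add: scalar_prod_def lessThan_atLeast0)
  qed (use ij meas in \<open>intro borel_measurable_sum borel_measurable_times, auto\<close>)
  have c: "\<And>\<omega>. \<omega> \<in> space M \<Longrightarrow> transpose_mat (P \<omega>) * P \<omega> \<in> carrier_mat n n"
    and s: "\<And>\<omega>. \<omega> \<in> space M \<Longrightarrow> transpose_mat (transpose_mat (P \<omega>) * P \<omega>) = transpose_mat (P \<omega>) * P \<omega>"
    using P by (auto simp: transpose_mult[of _ n n _ n] intro!: mult_carrier_mat[of _ n n _ n])
  have [measurable]: "(\<lambda>\<omega>. ordered_eigenvalue 1 (transpose_mat (P \<omega>) * P \<omega>)) \<in> borel_measurable M"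
    by (rule measurable_smallest_eigenvalue[OF n c s entry])
  show "(\<lambda>\<omega>. ordered_singular_value 1 (P \<omega>)) \<in> borel_measurable M"
    unfolding ordered_singular_value_def by measurable
  have [measurable]: "(\<lambda>\<omega>. ordered_eigenvalue n (transpose_mat (P \<omega>) * P \<omega>)) \<in> borel_measurable M"
    by (rule measurable_largest_eigenvalue[OF n c s entry])
  show "(\<lambda>\<omega>. ordered_singular_value n (P \<omega>)) \<in> borel_measurable M"
    unfolding ordered_singular_value_def by measurable
qed

section \<open>The wavelet covariance of fractional Brownian motion\<close>

text \<open>
  For a fractional Brownian motion \<open>B\<close> with exponent \<open>h\<close> and a function \<open>\<psi>\<close> of integral zero, this is the
  covariance of \<open>\<integral>\<psi>(u) B(k + u) du\<close> and \<open>\<integral>\<psi>(u) B(k' + u) du\<close> at the lag \<open>x = k - k'\<close>. Of the three terms of the covariance of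
  \<open>B\<close> only the one that depends on both times survives the integration.
\<close>

definition wavelet_cov :: "(real \<Rightarrow> real) \<Rightarrow> real \<Rightarrow> real \<Rightarrow> real" where
  "wavelet_cov \<psi> h x =
     - (LINT u|lborel. \<psi> u * (LINT v|lborel. \<psi> v * \<bar>u - v + x\<bar> powr (2 * h))) / 2"

locale compact_wavelet =
  fixes \<psi> :: "real \<Rightarrow> real" and R :: real
  assumes int: "integrable lborel \<psi>"
    and R: "1 \<le> R"
    and supp: "\<And>t. R < \<bar>t\<bar> \<Longrightarrow> \<psi> t = 0"
    and moment0: "(LINT t|lborel. \<psi> t) = 0"
    and moment1: "(LINT t|lborel. t * \<psi> t) = 0"
begin

lemma meas [measurable]: "\<psi> \<in> borel_measurable borel"
  using borel_measurable_integrable[OF int] by simp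

definition mass :: real where "mass = (LINT t|lborel. \<bar>\<psi> t\<bar>)"

lemma mass_nonneg: "0 \<le> mass" by (simp add: mass_def)

text \<open>
  All integrals against \<open>\<psi>\<close> are controlled by the values of the other factor on \<open>[-R, R]\<close>.
\<close>

lemma
  fixes g :: "real \<Rightarrow> real"
  assumes g [measurable]: "g \<in> borel_measurable borel" and bound: "\<And>t. \<bar>t\<bar> \<le> R \<Longrightarrow> \<bar>g t\<bar> \<le> B"
  shows integrable_mult_bounded: "integrable lborel (\<lambda>t. \<psi> t * g t)"
    and integral_mult_bounded: "\<bar>LINT t|lborel. \<psi> t * g t\<bar> \<le> mass * B"
proof -
  have le: "\<bar>\<psi> t * g t\<bar> \<le> \<bar>\<psi> t\<bar> * B" for t
    using supp[of t] bound[of t] by (cases "R < \<bar>t\<bar>") (auto simp: abs_mult intro: mult_left_mono)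
  have iB: "integrable lborel (\<lambda>t. \<bar>\<psi> t\<bar> * B)" using int by simp
  show i: "integrable lborel (\<lambda>t. \<psi> t * g t)"
    by (rule Bochner_Integration.integrable_bound[OF iB])
      (use order_trans[OF le abs_ge_self] in \<open>auto intro!: AE_I2\<close>)
  have "\<bar>LINT t|lborel. \<psi> t * g t\<bar> \<le> (LINT t|lborel. \<bar>\<psi> t\<bar> * B)"
    using i iB le by (intro integral_abs_bound[THEN order_trans] integral_mono) auto
  then show "\<bar>LINT t|lborel. \<psi> t * g t\<bar> \<le> mass * B" by (simp add: mass_def)
qed

lemma integrable_mult_power: "integrable lborel (\<lambda>t. \<psi> t * t ^ q)"
  by (rule integrable_mult_bounded[where B = "R ^ q"]) (auto simp: power_abs intro: power_mono)

text \<open>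
  Taylor's formula of order three at \<open>|x|\<close>. The third derivative of \<open>y\<^bsup>2h\<^esup>\<close> is of order \<open>y\<^bsup>2h-3\<^esup>\<close>, which is at most
  \<open>y\<^bsup>-1\<^esup>\<close> for \<open>y \<ge> 1\<close>, whatever \<open>h < 1\<close>.
\<close>

lemma power_remainder:
  fixes h x w :: real
  assumes h: "0 < h" "h < 1" and x: "4 * R \<le> \<bar>x\<bar>" and w: "\<bar>w\<bar> \<le> 2 * R"
  shows "\<bar>\<bar>w + x\<bar> powr (2 * h) - (\<bar>x\<bar> powr (2 * h) + sgn x * (2 * h) * \<bar>x\<bar> powr (2 * h - 1) * w
      + h * (2 * h - 1) * \<bar>x\<bar> powr (2 * h - 2) * w\<^sup>2)\<bar> \<le> 16 * R ^ 3 / \<bar>x\<bar>"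
proof (cases "w = 0")
  case True
  then show ?thesis using R by simp
next
  case False
  define f where "f = (\<lambda>y :: real. y powr (2 * h))"
  define df where "df m = (\<lambda>y :: real. (\<Prod>i<m. 2 * h - real i) * y powr (2 * h - real m))" for m :: nat
  define y0 where "y0 = \<bar>x\<bar>"
  define y where "y = y0 + sgn x * w"
  have x0: "x \<noteq> 0" using x R by auto
  have sg: "\<bar>sgn x\<bar> = 1" using x0 by (auto simp: sgn_if)
  have sw: "\<bar>sgn x * w\<bar> \<le> 2 * R" using sg w by (simp add: abs_mult)
  have y0: "y0 / 2 \<le> y" "y \<le> 2 * y0" "y0 > 0" "1 \<le> y0 / 2" "2 * R \<le> y0 / 2"
    using sw x R unfolding y_def y0_def by linarith+
  have yw: "\<bar>w + x\<bar> = y"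
    using y0(1,3) unfolding y_def y0_def by (cases x "0 :: real" rule: linorder_cases) (auto simp: abs_if split: if_splits)
  \<comment> \<open>on \<open>[y0/2, 2 y0]\<close> the argument stays in \<open>[1, \<infinity>)\<close>, away from the singularity at 0\<close>
  have "\<exists>t. (if y < y0 then y < t \<and> t < y0 else y0 < t \<and> t < y) \<and>
      f y = (\<Sum>m<3. df m y0 / fact m * (y - y0) ^ m) + df 3 t / fact 3 * (y - y0) ^ 3"
  proof (rule Taylor)
    show "df 0 = f" by (auto simp: df_def f_def)
    show "\<forall>m t. m < 3 \<and> y0 / 2 \<le> t \<and> t \<le> 2 * y0 \<longrightarrow> (df m has_real_derivative df (Suc m) t) (at t)"
    proof (intro allI impI)
      fix m :: nat and t assume "m < 3 \<and> y0 / 2 \<le> t \<and> t \<le> 2 * y0"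
      then have "t > 0" using y0 by linarith
      have "((\<lambda>y. (\<Prod>i<m. 2 * h - real i) * y powr (2 * h - real m)) has_real_derivative
          (\<Prod>i<m. 2 * h - real i) * ((2 * h - real m) * t powr (2 * h - real m - 1))) (at t)"
        by (intro DERIV_cmult has_real_derivative_powr \<open>t > 0\<close>)
      then show "(df m has_real_derivative df (Suc m) t) (at t)"
        by (simp add: df_def algebra_simps)
    qed
  qed (use y0 False x0 in \<open>auto simp: y_def sgn_zero_iff\<close>)
  then obtain t where t': "if y < y0 then y < t \<and> t < y0 else y0 < t \<and> t < y" and
    ft: "f y = (\<Sum>m<3. df m y0 / fact m * (y - y0) ^ m) + df 3 t / fact 3 * (y - y0) ^ 3"
    by blast
  have t: "y0 / 2 \<le> t" using t' y0 by (auto split: if_splits)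
  have sq: "(sgn x * w)\<^sup>2 = w\<^sup>2" using sg by (metis abs_mult mult_1 power2_abs)
  have "\<bar>w + x\<bar> powr (2 * h) - (\<bar>x\<bar> powr (2 * h) + sgn x * (2 * h) * \<bar>x\<bar> powr (2 * h - 1) * w
      + h * (2 * h - 1) * \<bar>x\<bar> powr (2 * h - 2) * w\<^sup>2) = df 3 t / 6 * (sgn x * w) ^ 3"
    using ft unfolding yw
    by (simp add: numeral_3_eq_3 f_def df_def y_def sq y0_def[symmetric] fact_numeral)
       (simp add: x0 sq[unfolded power2_eq_square] algebra_simps power2_eq_square)
  also have "\<bar>\<dots>\<bar> \<le> 6 * (2 / y0) / 6 * (2 * R) ^ 3"
  proof -
    have "t \<ge> 1" "t > 0" using t y0 by linarith+
    have "t powr (2 * h - 3) \<le> t powr (- 1)" using \<open>t \<ge> 1\<close> h by (intro powr_mono) auto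
    also have "\<dots> = 1 / t" using \<open>t > 0\<close> by (simp add: powr_minus_divide)
    also have "\<dots> \<le> 2 / y0" using t y0 \<open>t > 0\<close> by (simp add: field_simps)
    finally have p: "t powr (2 * h - 3) \<le> 2 / y0" .
    have "\<bar>2 * h * (2 * h - 1) * (2 * h - 2)\<bar> \<le> 2 * 1 * 2"
      unfolding abs_mult using h by (intro mult_mono) auto
    then have "\<bar>2 * h * (2 * h - 1) * (2 * h - 2)\<bar> \<le> 6" by simp
    moreover have "df 3 t = 2 * h * (2 * h - 1) * (2 * h - 2) * t powr (2 * h - 3)"
      by (simp add: df_def numeral_3_eq_3)
    ultimately have "\<bar>df 3 t\<bar> \<le> 6 * (2 / y0)"
      using p by (simp only: abs_mult[of _ "t powr (2 * h - 3)"]) (intro mult_mono; simp)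
    moreover have "\<bar>sgn x * w\<bar> ^ 3 \<le> (2 * R) ^ 3" using sw by (intro power_mono) auto
    ultimately show ?thesis unfolding abs_mult[of "df 3 t / 6"] power_abs
      using y0(3) by (intro mult_mono) auto
  qed
  also have "\<dots> \<le> 16 * R ^ 3 / \<bar>x\<bar>" by (simp add: y0_def power_mult_distrib)
  finally show ?thesis .
qed

text \<open>
  Two vanishing moments of \<open>\<psi>\<close> annihilate every polynomial of degree at most three in \<open>u - v\<close> under
  \<open>\<integral>\<integral>\<psi>(u)\<psi>(v) du dv\<close>, since each of its monomials has degree at most one in \<open>u\<close> or in \<open>v\<close>. The quadratic Taylor polynomial
  of \<open>|u - v + x|\<^bsup>2h\<^esup>\<close> therefore contributes nothing, and the remainder is of order \<open>1/|x|\<close>. For small \<open>x\<close> the bound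
  is trivial; the constant 90 comes from that case, where \<open>(6R)\<^sup>2 / 2 = 18 R\<^sup>2\<close> and \<open>1 + |x| \<le> 5 R\<close>. What matters
  later is that the squares are summable over the lags, for all \<open>h\<close> in \<open>(0,1)\<close>.
\<close>

lemma wavelet_cov_decay:
  assumes h: "0 < h" "h < 1"
  shows "\<bar>wavelet_cov \<psi> h x\<bar> \<le> 90 * R ^ 3 * mass\<^sup>2 / (1 + \<bar>x\<bar>)"
proof (cases "4 * R \<le> \<bar>x\<bar>")
  case True
  then have x: "1 \<le> \<bar>x\<bar>" using R by linarith
  define a0 where "a0 = \<bar>x\<bar> powr (2 * h)"
  define a1 where "a1 = sgn x * (2 * h) * \<bar>x\<bar> powr (2 * h - 1)"
  define a2 where "a2 = h * (2 * h - 1) * \<bar>x\<bar> powr (2 * h - 2)"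
  define rem where "rem u v = \<bar>u - v + x\<bar> powr (2 * h) - (a0 + a1 * (u - v) + a2 * (u - v)\<^sup>2)" for u v
  define m2 where "m2 = (LINT v|lborel. \<psi> v * v\<^sup>2)"
  let ?B = "16 * R ^ 3 / \<bar>x\<bar>"
  have rem: "\<bar>rem u v\<bar> \<le> ?B" if "\<bar>u\<bar> \<le> R" "\<bar>v\<bar> \<le> R" for u v
    unfolding rem_def a0_def a1_def a2_def by (rule power_remainder[OF h True]) (use that in linarith)
  have rem_meas [measurable]: "(\<lambda>(u,v). rem u v) \<in> borel_measurable (borel \<Otimes>\<^sub>M borel)"
    unfolding rem_def by measurable
  have poly: "integrable lborel (\<lambda>v. \<psi> v * (a0 + a1 * (u - v) + a2 * (u - v)\<^sup>2))"
    "(LINT v|lborel. \<psi> v * (a0 + a1 * (u - v) + a2 * (u - v)\<^sup>2)) = a2 * m2" for u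
  proof -
    have i: "integrable lborel (\<lambda>v. v * \<psi> v)" "integrable lborel (\<lambda>v. \<psi> v * v\<^sup>2)"
      using integrable_mult_power[of 1] integrable_mult_power[of 2] by (auto simp: mult.commute)
    have eq: "(\<lambda>v. \<psi> v * (a0 + a1 * (u - v) + a2 * (u - v)\<^sup>2)) =
      (\<lambda>v. (a0 + a1 * u + a2 * u\<^sup>2) * \<psi> v - (a1 + 2 * a2 * u) * (v * \<psi> v) + a2 * (\<psi> v * v\<^sup>2))"
      by (auto simp: power2_eq_square algebra_simps)
    show "integrable lborel (\<lambda>v. \<psi> v * (a0 + a1 * (u - v) + a2 * (u - v)\<^sup>2))"
      unfolding eq using i int
      by (intro Bochner_Integration.integrable_add Bochner_Integration.integrable_diff integrable_mult_right)
    show "(LINT v|lborel. \<psi> v * (a0 + a1 * (u - v) + a2 * (u - v)\<^sup>2)) = a2 * m2"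
      unfolding eq using i int by (simp add: moment0 moment1 m2_def)
  qed
  have split: "(LINT v|lborel. \<psi> v * \<bar>u - v + x\<bar> powr (2 * h)) = (LINT v|lborel. \<psi> v * rem u v) + a2 * m2"
    if u: "\<bar>u\<bar> \<le> R" for u
  proof -
    have "integrable lborel (\<lambda>v. \<psi> v * rem u v)"
      by (rule integrable_mult_bounded[where B = ?B]) (use rem[OF u] in auto)
    moreover note poly(1)[of u]
    ultimately have "(LINT v|lborel. \<psi> v * rem u v) + a2 * m2
      = (LINT v|lborel. \<psi> v * rem u v + \<psi> v * (a0 + a1 * (u - v) + a2 * (u - v)\<^sup>2))"
      unfolding poly(2)[of u, symmetric] by (rule Bochner_Integration.integral_add[symmetric])
    also have "\<dots> = (LINT v|lborel. \<psi> v * \<bar>u - v + x\<bar> powr (2 * h))"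
      by (simp add: rem_def algebra_simps)
    finally show ?thesis by simp
  qed
  define first where "first u = (LINT v|lborel. \<psi> v * rem u v)" for u
  have first_meas [measurable]: "first \<in> borel_measurable borel"
    unfolding first_def by measurable
  have first: "\<bar>first u\<bar> \<le> mass * ?B" if "\<bar>u\<bar> \<le> R" for u
    unfolding first_def by (rule integral_mult_bounded) (use rem[OF that] in auto)
  have i1: "integrable lborel (\<lambda>u. \<psi> u * first u)"
    by (rule integrable_mult_bounded[where B = "mass * ?B"]) (use first in auto)
  have "(LINT u|lborel. \<psi> u * (LINT v|lborel. \<psi> v * \<bar>u - v + x\<bar> powr (2 * h)))
      = (LINT u|lborel. \<psi> u * first u + (a2 * m2) * \<psi> u)"
  proof (intro Bochner_Integration.integral_cong refl)
    fix u show "\<psi> u * (LINT v|lborel. \<psi> v * \<bar>u - v + x\<bar> powr (2 * h)) = \<psi> u * first u + (a2 * m2) * \<psi> u"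
      using split[of u] supp[of u] unfolding first_def by (cases "R < \<bar>u\<bar>") (auto simp: algebra_simps)
  qed
  also have "\<dots> = (LINT u|lborel. \<psi> u * first u)"
    using i1 int by (simp add: moment0)
  finally have "\<bar>wavelet_cov \<psi> h x\<bar> = \<bar>LINT u|lborel. \<psi> u * first u\<bar> / 2"
    by (simp add: wavelet_cov_def)
  also have "\<dots> \<le> mass * (mass * ?B) / 2"
    by (intro divide_right_mono integral_mult_bounded) (use first in auto)
  also have "\<dots> = 8 * (R ^ 3 * mass\<^sup>2) * (1 / \<bar>x\<bar>)" by (simp add: power2_eq_square)
  also have "\<dots> \<le> 8 * (R ^ 3 * mass\<^sup>2) * (2 / (1 + \<bar>x\<bar>))"
    using x R by (intro mult_left_mono) (auto simp: field_simps)
  also have "\<dots> \<le> 90 * (R ^ 3 * mass\<^sup>2) / (1 + \<bar>x\<bar>)"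
    using R by (simp add: field_simps)
  finally show ?thesis by simp
next
  case False
  have bound: "\<bar>\<bar>u - v + x\<bar> powr (2 * h)\<bar> \<le> (6 * R) ^ 2" if "\<bar>u\<bar> \<le> R" "\<bar>v\<bar> \<le> R" for u v
  proof -
    have "\<bar>u - v + x\<bar> powr (2 * h) \<le> (6 * R) powr (2 * h)"
      using that False h by (intro powr_mono2) linarith+
    also have "\<dots> \<le> (6 * R) powr 2" using h R by (intro powr_mono) auto
    also have "\<dots> = (6 * R) ^ 2" using R by (simp add: powr_numeral)
    finally show ?thesis by simp
  qed
  have inner: "\<bar>LINT v|lborel. \<psi> v * \<bar>u - v + x\<bar> powr (2 * h)\<bar> \<le> mass * (6 * R) ^ 2" if "\<bar>u\<bar> \<le> R" for u
    by (rule integral_mult_bounded) (use bound[OF that] in auto)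
  have "\<bar>wavelet_cov \<psi> h x\<bar> = \<bar>LINT u|lborel. \<psi> u * (LINT v|lborel. \<psi> v * \<bar>u - v + x\<bar> powr (2 * h))\<bar> / 2"
    by (simp add: wavelet_cov_def)
  also have "\<dots> \<le> mass * (mass * (6 * R) ^ 2) / 2"
    by (rule divide_right_mono[OF integral_mult_bounded]) (use inner in auto)
  also have "\<dots> = 18 * R\<^sup>2 * mass\<^sup>2" by (simp add: power2_eq_square)
  also have "\<dots> \<le> 90 * R ^ 3 * mass\<^sup>2 / (1 + \<bar>x\<bar>)"
  proof -
    have "18 * R\<^sup>2 * mass\<^sup>2 * (1 + \<bar>x\<bar>) \<le> 18 * R\<^sup>2 * mass\<^sup>2 * (5 * R)"
      using False R by (intro mult_left_mono) auto
    then show ?thesis by (simp add: field_simps power2_eq_square power3_eq_cube)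
  qed
  finally show ?thesis .
qed

end

section \<open>Positivity of the wavelet variance\<close>

context compact_wavelet begin

text \<open>
  Fubini's theorem for \<open>\<psi>(v) G(v, x)\<close>, which is dominated by the product \<open>|\<psi>(v)| b(x)\<close>.
\<close>

lemma
  fixes G :: "real \<Rightarrow> real \<Rightarrow> real"
  assumes G [measurable]: "(\<lambda>(v, x). G v x) \<in> borel_measurable (borel \<Otimes>\<^sub>M borel)"
    and b: "integrable lborel b" and bound: "\<And>v x. \<bar>v\<bar> \<le> R \<Longrightarrow> \<bar>G v x\<bar> \<le> b x"
  shows wavelet_Fubini: "(LINT v|lborel. \<psi> v * (LINT x|lborel. G v x)) = (LINT x|lborel. (LINT v|lborel. \<psi> v * G v x))"
    and wavelet_Fubini_integrable: "integrable lborel (\<lambda>x. LINT v|lborel. \<psi> v * G v x)"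
proof -
  have b0: "0 \<le> b x" for x using bound[of 0 x] R by auto
  have [measurable]: "b \<in> borel_measurable borel" using borel_measurable_integrable[OF b] by simp
  have dom: "integrable (lborel \<Otimes>\<^sub>M lborel) (\<lambda>(v, x). \<bar>\<psi> v\<bar> * b x)"
    by (rule lborel_pair.Fubini_integrable)
      (use b int b0 in \<open>auto simp: abs_mult\<close>)
  have i: "integrable (lborel \<Otimes>\<^sub>M lborel) (\<lambda>(v, x). \<psi> v * G v x)"
  proof (rule Bochner_Integration.integrable_bound[OF dom])
    have "\<bar>\<psi> v * G v x\<bar> \<le> \<bar>\<psi> v\<bar> * b x" for v x
      using supp[of v] bound[of v x] by (cases "R < \<bar>v\<bar>") (auto simp: abs_mult intro: mult_left_mono)
    then show "AE z in lborel \<Otimes>\<^sub>M lborel. norm (case z of (v, x) \<Rightarrow> \<psi> v * G v x) \<le> norm (case z of (v, x) \<Rightarrow> \<bar>\<psi> v\<bar> * b x)"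
      by (intro AE_I2) (auto simp: b0)
  qed measurable
  have "(LINT v|lborel. \<psi> v * (LINT x|lborel. G v x)) = (LINT v|lborel. (LINT x|lborel. \<psi> v * G v x))"
    by simp
  also have "\<dots> = (LINT x|lborel. (LINT v|lborel. \<psi> v * G v x))"
    by (rule lborel_pair.Fubini_integral[OF i, symmetric])
  finally show "(LINT v|lborel. \<psi> v * (LINT x|lborel. G v x)) = (LINT x|lborel. (LINT v|lborel. \<psi> v * G v x))" .
  show "integrable lborel (\<lambda>x. LINT v|lborel. \<psi> v * G v x)"
    using lborel_pair.integrable_snd[OF i] by simp
qed

end

text \<open>
  Up to a constant, the density in the harmonizable representation of fractional Brownian motion, restricted
  to positive frequencies.
\<close>

definition spectral_weight :: "real \<Rightarrow> real \<Rightarrow> real" where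
  "spectral_weight h x = indicator {0<..} x * x powr (- 1 - 2 * h)"

lemma spectral_weight_measurable [measurable]: "spectral_weight h \<in> borel_measurable borel"
  unfolding spectral_weight_def by measurable

lemma spectral_weight_nonneg: "0 \<le> spectral_weight h x"
  by (simp add: spectral_weight_def)

text \<open>
  Near 0 the integrand is \<open>x\<^bsup>1-2h\<^esup>\<close>, integrable for \<open>h < 1\<close>; near infinity it is \<open>x\<^bsup>-1-2h\<^esup>\<close>, integrable for \<open>h > 0\<close>.
\<close>

lemma integrable_truncated_spectral_weight:
  assumes h: "0 < h" "h < 1"
  shows "integrable lborel (\<lambda>x. min 1 (x\<^sup>2) * spectral_weight h x)"
proof -
  have "(\<lambda>x. x powr (1 - 2 * h)) absolutely_integrable_on {0..1}"
    using integrable_on_powr_from_0[of "1 - 2 * h" 1] h by (subst absolutely_integrable_on_iff_nonneg) auto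
  then have 1: "integrable lborel (\<lambda>x. indicator {0..1} x * x powr (1 - 2 * h))"
    unfolding set_integrable_def by (subst (asm) integrable_completion) auto
  have "(\<lambda>x. x powr (- 1 - 2 * h)) integrable_on {1..}"
    using has_integral_powr_to_inf[of "- 1 - 2 * h" 1] h by (auto simp: integrable_on_def)
  then have "(\<lambda>x. x powr (- 1 - 2 * h)) absolutely_integrable_on {1..}"
    by (subst absolutely_integrable_on_iff_nonneg) auto
  then have 2: "integrable lborel (\<lambda>x. indicator {1..} x * x powr (- 1 - 2 * h))"
    unfolding set_integrable_def by (subst (asm) integrable_completion) auto
  have le: "\<bar>min 1 (x\<^sup>2) * spectral_weight h x\<bar> \<le>
      indicator {0..1} x * x powr (1 - 2 * h) + indicator {1..} x * x powr (- 1 - 2 * h)" for x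
  proof (cases "0 < x")
    case True
    have "x\<^sup>2 * x powr (- 1 - 2 * h) = x powr (2 + (- 1 - 2 * h))"
      using True by (subst powr_add) (simp add: powr_numeral)
    then have "x\<^sup>2 * x powr (- 1 - 2 * h) = x powr (1 - 2 * h)" by simp
    then have A: "min 1 (x\<^sup>2) * x powr (- 1 - 2 * h) \<le> x powr (1 - 2 * h)"
      by (metis min.cobounded2 mult_right_mono powr_ge_zero)
    have B: "min 1 (x\<^sup>2) * x powr (- 1 - 2 * h) \<le> 1 * x powr (- 1 - 2 * h)"
      by (intro mult_right_mono) auto
    have nn: "0 \<le> min 1 (x\<^sup>2) * x powr (- 1 - 2 * h)" by (intro mult_nonneg_nonneg) auto
    show ?thesis
    proof (cases "x \<le> 1")
      case True
      have "min 1 (x\<^sup>2) * spectral_weight h x = min 1 (x\<^sup>2) * x powr (- 1 - 2 * h)"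
        using \<open>0 < x\<close> by (simp add: spectral_weight_def)
      moreover have "indicator {0..1} x * x powr (1 - 2 * h) = x powr (1 - 2 * h)" using True \<open>0 < x\<close> by simp
      moreover have "0 \<le> indicator {1..} x * x powr (- 1 - 2 * h)" by simp
      ultimately show ?thesis using A nn by linarith
    next
      case False
      have "min 1 (x\<^sup>2) * spectral_weight h x = min 1 (x\<^sup>2) * x powr (- 1 - 2 * h)"
        using \<open>0 < x\<close> by (simp add: spectral_weight_def)
      moreover have "indicator {1..} x * x powr (- 1 - 2 * h) = 1 * x powr (- 1 - 2 * h)" using False by simp
      moreover have "0 \<le> indicator {0..1} x * x powr (1 - 2 * h)" by simp
      ultimately show ?thesis using B nn by linarith
    qed
  qed (auto simp: spectral_weight_def indicator_def)
  show ?thesis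
    by (rule Bochner_Integration.integrable_bound[OF Bochner_Integration.integrable_add[OF 1 2]])
      (use order_trans[OF le abs_ge_self] in \<open>auto intro!: AE_I2\<close>)
qed

lemma one_minus_cos_le:
  fixes x y B :: real
  assumes "\<bar>y\<bar> \<le> B" "1 \<le> B"
  shows "\<bar>(1 - cos (y * x)) * spectral_weight h x\<bar> \<le> 2 * B\<^sup>2 * (min 1 (x\<^sup>2) * spectral_weight h x)"
proof -
  have "1 - cos (y * x) = 2 * (sin (y * x / 2))\<^sup>2"
    using cos_double_sin[of "y * x / 2"] by simp
  also have "\<dots> \<le> 2 * (y * x / 2)\<^sup>2"
    using abs_sin_x_le_abs_x[of "y * x / 2"] unfolding abs_le_square_iff by (intro mult_left_mono) auto
  also have "2 * (y * x / 2)\<^sup>2 = y\<^sup>2 * x\<^sup>2 / 2" by (simp add: power_mult_distrib power_divide)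
  also have "\<dots> \<le> 2 * (B\<^sup>2 * x\<^sup>2)"
  proof -
    have "y\<^sup>2 \<le> B\<^sup>2" using assms abs_le_square_iff[of y B] by simp
    then have "y\<^sup>2 * x\<^sup>2 \<le> B\<^sup>2 * x\<^sup>2" by (rule mult_right_mono) simp
    moreover have "0 \<le> B\<^sup>2 * x\<^sup>2" by simp
    ultimately show ?thesis by linarith
  qed
  finally have 1: "1 - cos (y * x) \<le> 2 * B\<^sup>2 * x\<^sup>2" by simp
  have "1 \<le> B\<^sup>2" using assms by (simp add: one_le_power)
  then have 2: "1 - cos (y * x) \<le> 2 * B\<^sup>2 * 1" using cos_ge_minus_one[of "y * x"] by linarith
  have "1 - cos (y * x) \<le> 2 * B\<^sup>2 * min 1 (x\<^sup>2)" using 1 2 by (simp add: min_def)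
  then have "(1 - cos (y * x)) * spectral_weight h x \<le> 2 * B\<^sup>2 * min 1 (x\<^sup>2) * spectral_weight h x"
    by (intro mult_right_mono spectral_weight_nonneg)
  moreover have "0 \<le> (1 - cos (y * x)) * spectral_weight h x"
    using spectral_weight_nonneg by (intro mult_nonneg_nonneg) auto
  ultimately show ?thesis by simp
qed

text \<open>
  The substitution \<open>x \<mapsto> x / |y|\<close>. This is the representation that makes \<open>-|u - v|\<^bsup>2h\<^esup>\<close> conditionally positive
  definite: against functions of integral zero it is a positive mixture of the kernels \<open>cos((u - v) x)\<close>.
\<close>

lemma power_as_cosine_transform:
  "(LINT x|lborel. (1 - cos (y * x)) * spectral_weight h x)
     = \<bar>y\<bar> powr (2 * h) * (LINT x|lborel. (1 - cos x) * spectral_weight h x)"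
proof (cases "y = 0")
  case False
  let ?a = "\<bar>y\<bar>"
  have a: "?a > 0" using False by simp
  have cosa: "cos (y * x) = cos (?a * x)" for x by (cases "y \<ge> 0") auto
  have "(LINT x|lborel. (1 - cos (?a * x)) * spectral_weight h x)
    = \<bar>1 / ?a\<bar> *\<^sub>R (LINT x|lborel. (1 - cos (?a * (0 + 1 / ?a * x))) * spectral_weight h (0 + 1 / ?a * x))"
    using a by (intro lborel_integral_real_affine) auto
  also have "\<dots> = 1 / ?a * (LINT x|lborel. ?a powr (1 + 2 * h) * ((1 - cos x) * spectral_weight h x))"
  proof -
    have "(1 - cos (?a * (0 + 1 / ?a * x))) * spectral_weight h (0 + 1 / ?a * x)
      = ?a powr (1 + 2 * h) * ((1 - cos x) * spectral_weight h x)" for x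
    proof (cases "x > 0")
      case True
      have "(1 / ?a * x) powr (- 1 - 2 * h) = (1 / ?a) powr (- (1 + 2 * h)) * x powr (- 1 - 2 * h)"
        using True a by (subst powr_mult) (auto simp: algebra_simps)
      also have "(1 / ?a) powr (- (1 + 2 * h)) = ?a powr (1 + 2 * h)"
        unfolding powr_minus using a by (simp add: powr_divide)
      finally show ?thesis using True a by (simp add: spectral_weight_def indicator_def)
    next
      case False
      then show ?thesis using a by (simp add: spectral_weight_def indicator_def zero_less_divide_iff)
    qed
    then have "(\<lambda>x. (1 - cos (?a * (0 + 1 / ?a * x))) * spectral_weight h (0 + 1 / ?a * x))
      = (\<lambda>x. ?a powr (1 + 2 * h) * ((1 - cos x) * spectral_weight h x))" by (rule ext)
    then show ?thesis by (simp only: real_scaleR_def) simp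
  qed
  also have "\<dots> = 1 / ?a * ?a powr (1 + 2 * h) * (LINT x|lborel. (1 - cos x) * spectral_weight h x)" by simp
  also have "1 / ?a * ?a powr (1 + 2 * h) = ?a powr (2 * h)" using a by (simp add: powr_add)
  finally show ?thesis by (simp add: cosa)
qed simp

context compact_wavelet begin

text \<open>
  The Fourier transform of \<open>\<psi>\<close> with the characteristic function's sign in the exponent.
\<close>

definition ft :: "real \<Rightarrow> complex" where
  "ft x = (LINT t|lborel. of_real (\<psi> t) * iexp (x * t))"

lemma ft_parts:
  shows "(LINT t|lborel. \<psi> t * cos (t * x)) = Re (ft x)" "(LINT t|lborel. \<psi> t * sin (t * x)) = Im (ft x)"
proof -
  have i: "complex_integrable lborel (\<lambda>t. of_real (\<psi> t) * iexp (x * t))"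
    by (rule Bochner_Integration.integrable_bound[OF int]) (auto simp: norm_mult)
  have "Re (ft x) = (LINT t|lborel. Re (of_real (\<psi> t) * iexp (x * t)))"
    unfolding ft_def by (rule integral_Re[OF i, symmetric])
  then show "(LINT t|lborel. \<psi> t * cos (t * x)) = Re (ft x)"
    by (simp add: Re_exp mult.commute)
  have "Im (ft x) = (LINT t|lborel. Im (of_real (\<psi> t) * iexp (x * t)))"
    unfolding ft_def by (rule integral_Im[OF i, symmetric])
  then show "(LINT t|lborel. \<psi> t * sin (t * x)) = Im (ft x)"
    by (simp add: Im_exp mult.commute)
qed

lemma ft_measurable [measurable]: "ft \<in> borel_measurable borel"
  unfolding ft_def by measurable

text \<open>
  Integrating \<open>1 - cos((u - v) x)\<close> against \<open>\<psi>(u) \<psi>(v)\<close> gives \<open>-|ft x|\<^sup>2\<close> because \<open>\<psi>\<close> has integral zero. The two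
  exchanges of integrals are justified by the bound \<open>1 - cos(y x) \<le> 2 B\<^sup>2 min 1 x\<^sup>2\<close> for \<open>|y| \<le> B\<close> and \<open>B \<ge> 1\<close>.
\<close>

lemma wavelet_cov_spectral:
  assumes h: "0 < h" "h < 1"
  shows "integrable lborel (\<lambda>x. (cmod (ft x))\<^sup>2 * spectral_weight h x)"
    and "2 * wavelet_cov \<psi> h 0 * (LINT x|lborel. (1 - cos x) * spectral_weight h x)
     = (LINT x|lborel. (cmod (ft x))\<^sup>2 * spectral_weight h x)"
proof -
  define \<rho> where "\<rho> = spectral_weight h"
  define K where "K = (LINT x|lborel. (1 - cos x) * \<rho> x)"
  have [measurable]: "\<rho> \<in> borel_measurable borel" unfolding \<rho>_def by measurable
  let ?w = "\<lambda>x. 2 * (2 * R)\<^sup>2 * (min 1 (x\<^sup>2) * \<rho> x)"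
  have w: "integrable lborel ?w"
    using integrable_truncated_spectral_weight[OF h] unfolding \<rho>_def by simp
  define g where "g u x = - (cos (u * x) * Re (ft x) + sin (u * x) * Im (ft x))" for u x
  have trig: "integrable lborel (\<lambda>t. \<psi> t * cos (t * x))" "integrable lborel (\<lambda>t. \<psi> t * sin (t * x))" for x
    by (rule integrable_mult_bounded[where B = 1]; simp)+
  have inner: "(LINT v|lborel. \<psi> v * (1 - cos ((u - v) * x))) = g u x" for u x
  proof -
    have "(\<lambda>v. \<psi> v * (1 - cos ((u - v) * x))) =
        (\<lambda>v. \<psi> v - cos (u * x) * (\<psi> v * cos (v * x)) - sin (u * x) * (\<psi> v * sin (v * x)))"
      by (auto simp: left_diff_distrib cos_diff algebra_simps)
    then show ?thesis using trig[of x] int by (simp add: moment0 ft_parts g_def)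
  qed
  have cosw: "\<bar>(1 - cos ((u - v) * x)) * \<rho> x\<bar> \<le> ?w x" if "\<bar>u\<bar> \<le> R" "\<bar>v\<bar> \<le> R" for u v x
    unfolding \<rho>_def using that R by (intro one_minus_cos_le) linarith+
  have gw: "\<bar>g u x * \<rho> x\<bar> \<le> mass * ?w x" if "\<bar>u\<bar> \<le> R" for u x
  proof -
    have "g u x * \<rho> x = (LINT v|lborel. \<psi> v * ((1 - cos ((u - v) * x)) * \<rho> x))"
      unfolding inner[symmetric] by (simp add: mult.assoc[symmetric])
    then show ?thesis using cosw[OF that] by (simp only:) (rule integral_mult_bounded, auto)
  qed
  have step1: "K * (LINT v|lborel. \<psi> v * \<bar>u - v + 0\<bar> powr (2 * h)) = (LINT x|lborel. g u x * \<rho> x)"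
    if u: "\<bar>u\<bar> \<le> R" for u
  proof -
    have "K * (LINT v|lborel. \<psi> v * \<bar>u - v + 0\<bar> powr (2 * h))
        = (LINT v|lborel. \<psi> v * (LINT x|lborel. (1 - cos ((u - v) * x)) * \<rho> x))"
      unfolding \<rho>_def power_as_cosine_transform K_def
      by (subst integral_mult_right_zero[symmetric]) (simp add: mult_ac)
    also have "\<dots> = (LINT x|lborel. (LINT v|lborel. \<psi> v * ((1 - cos ((u - v) * x)) * \<rho> x)))"
      by (rule wavelet_Fubini[OF _ w cosw[OF u]]) measurable
    also have "\<dots> = (LINT x|lborel. g u x * \<rho> x)"
      unfolding inner[symmetric] by (simp add: mult.assoc[symmetric])
    finally show ?thesis .
  qed
  have g_meas [measurable]: "(\<lambda>(u, x). g u x) \<in> borel_measurable (borel \<Otimes>\<^sub>M borel)"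
    unfolding g_def by measurable
  have w': "integrable lborel (\<lambda>x. mass * ?w x)" using w by simp
  have gm: "(\<lambda>(u, x). g u x * \<rho> x) \<in> borel_measurable (borel \<Otimes>\<^sub>M borel)" by measurable
  have outer: "(LINT u|lborel. \<psi> u * (g u x * \<rho> x)) = - ((cmod (ft x))\<^sup>2 * \<rho> x)" for x
  proof -
    have "(\<lambda>u. \<psi> u * (g u x * \<rho> x)) =
        (\<lambda>u. - (Re (ft x) * \<rho> x) * (\<psi> u * cos (u * x)) - (Im (ft x) * \<rho> x) * (\<psi> u * sin (u * x)))"
      by (auto simp: g_def algebra_simps)
    then show ?thesis using trig[of x]
      by (simp add: ft_parts cmod_power2) (simp add: algebra_simps power2_eq_square)
  qed
  show "integrable lborel (\<lambda>x. (cmod (ft x))\<^sup>2 * spectral_weight h x)"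
    using wavelet_Fubini_integrable[OF gm w' gw] unfolding outer unfolding \<rho>_def by simp
  have "2 * wavelet_cov \<psi> h 0 * K
      = - (LINT u|lborel. \<psi> u * (K * (LINT v|lborel. \<psi> v * \<bar>u - v + 0\<bar> powr (2 * h))))"
    unfolding wavelet_cov_def by (subst integral_mult_right_zero[symmetric]) (simp add: mult_ac)
  also have "(LINT u|lborel. \<psi> u * (K * (LINT v|lborel. \<psi> v * \<bar>u - v + 0\<bar> powr (2 * h))))
      = (LINT u|lborel. \<psi> u * (LINT x|lborel. g u x * \<rho> x))"
  proof (intro Bochner_Integration.integral_cong refl)
    fix u show "\<psi> u * (K * (LINT v|lborel. \<psi> v * \<bar>u - v + 0\<bar> powr (2 * h))) = \<psi> u * (LINT x|lborel. g u x * \<rho> x)"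
      using step1[of u] supp[of u] by (cases "R < \<bar>u\<bar>") auto
  qed
  also have "\<dots> = (LINT x|lborel. (LINT u|lborel. \<psi> u * (g u x * \<rho> x)))"
    by (rule wavelet_Fubini[OF gm w' gw])
  finally show "2 * wavelet_cov \<psi> h 0 * (LINT x|lborel. (1 - cos x) * spectral_weight h x)
     = (LINT x|lborel. (cmod (ft x))\<^sup>2 * spectral_weight h x)"
    unfolding outer by (simp add: K_def \<rho>_def)
qed

text \<open>
  The Taylor expansion of \<open>ft\<close> at 0 has the moments of \<open>\<psi>\<close> as coefficients; its first nonzero term is the one
  of order \<open>N\<close>, and it dominates near 0.
\<close>

lemma ft_nonzero_near_0:
  assumes mom: "\<And>q. q < N \<Longrightarrow> (LINT t|lborel. t ^ q * \<psi> t) = 0"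
    and momN: "(LINT t|lborel. t ^ N * \<psi> t) \<noteq> 0"
  shows "\<exists>\<delta>>0. \<forall>x. 0 < x \<and> x < \<delta> \<longrightarrow> ft x \<noteq> 0"
proof -
  define m where "m = (LINT t|lborel. t ^ N * \<psi> t)"
  have m: "m \<noteq> 0" using momN by (simp add: m_def)
  define C where "C = mass * R ^ Suc N / fact (Suc N)"
  have C0: "0 \<le> C" using R mass_nonneg by (simp add: C_def)
  have est: "cmod (ft x - (\<i> * x) ^ N / fact N * m) \<le> C * \<bar>x\<bar> ^ Suc N" for x
  proof -
    let ?T = "\<lambda>t. \<Sum>k\<le>N. (\<i> * complex_of_real (x * t)) ^ k / fact k"
    have i1: "complex_integrable lborel (\<lambda>t. of_real (\<psi> t) * iexp (x * t))"
      by (rule Bochner_Integration.integrable_bound[OF int]) (auto simp: norm_mult)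
    have i2: "complex_integrable lborel (\<lambda>t. (\<i> * complex_of_real x) ^ k / fact k * of_real (t ^ k * \<psi> t))" for k
      by (intro integrable_mult_right integrable_of_real) (use integrable_mult_power[of k] in \<open>simp add: mult.commute\<close>)
    have Teq: "of_real (\<psi> t) * ?T t = (\<Sum>k\<le>N. (\<i> * complex_of_real x) ^ k / fact k * of_real (t ^ k * \<psi> t))" for t
      by (simp add: sum_distrib_left power_mult_distrib mult_ac)
    have "(LINT t|lborel. of_real (\<psi> t) * ?T t) = (\<Sum>k\<le>N. (LINT t|lborel. (\<i> * complex_of_real x) ^ k / fact k * of_real (t ^ k * \<psi> t)))"
      unfolding Teq by (rule Bochner_Integration.integral_sum) (rule i2)
    also have "\<dots> = (\<Sum>k\<le>N. (\<i> * complex_of_real x) ^ k / fact k * of_real (LINT t|lborel. t ^ k * \<psi> t))"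
      by (intro sum.cong refl, subst integral_mult_right_zero) (simp del: of_real_mult of_real_power)
    also have "\<dots> = (\<Sum>k\<le>N. if k = N then (\<i> * complex_of_real x) ^ N / fact N * of_real m else 0)"
      by (intro sum.cong refl) (auto simp: m_def mom)
    finally have T: "(LINT t|lborel. of_real (\<psi> t) * ?T t) = (\<i> * x) ^ N / fact N * m" by simp
    have iT: "complex_integrable lborel (\<lambda>t. of_real (\<psi> t) * ?T t)"
      unfolding Teq by (intro Bochner_Integration.integrable_sum i2)
    have "ft x - (\<i> * x) ^ N / fact N * m = (LINT t|lborel. of_real (\<psi> t) * (iexp (x * t) - ?T t))"
      unfolding T[symmetric] ft_def right_diff_distrib by (rule Bochner_Integration.integral_diff[OF i1 iT, symmetric])
    also have "cmod \<dots> \<le> (LINT t|lborel. \<bar>\<psi> t\<bar> * (\<bar>x\<bar> ^ Suc N * R ^ Suc N / fact (Suc N)))"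
    proof (rule order_trans[OF integral_norm_bound], rule integral_mono)
      show "integrable lborel (\<lambda>t. norm (of_real (\<psi> t) * (iexp (x * t) - ?T t)))"
        unfolding right_diff_distrib
        by (intro Bochner_Integration.integrable_norm Bochner_Integration.integrable_diff[OF i1 iT])
      show "integrable lborel (\<lambda>t. \<bar>\<psi> t\<bar> * (\<bar>x\<bar> ^ Suc N * R ^ Suc N / fact (Suc N)))" using int by simp
      fix t
      show "norm (of_real (\<psi> t) * (iexp (x * t) - ?T t)) \<le> \<bar>\<psi> t\<bar> * (\<bar>x\<bar> ^ Suc N * R ^ Suc N / fact (Suc N))"
      proof (cases "R < \<bar>t\<bar>")
        case False
        have "norm (iexp (x * t) - ?T t) \<le> \<bar>x * t\<bar> ^ Suc N / fact (Suc N)" by (rule iexp_approx1)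
        also have "\<dots> \<le> (\<bar>x\<bar> ^ Suc N * R ^ Suc N) / fact (Suc N)"
          unfolding abs_mult power_mult_distrib using False
          by (intro divide_right_mono mult_left_mono power_mono) auto
        finally show ?thesis unfolding norm_mult by (intro mult_mono) auto
      qed (simp add: supp)
    qed
    also have "\<dots> = C * \<bar>x\<bar> ^ Suc N" by (simp add: C_def mass_def)
    finally show ?thesis .
  qed
  define \<delta> where "\<delta> = \<bar>m\<bar> / fact N / (C + 1)"
  have \<delta>: "\<delta> > 0" using m C0 by (simp add: \<delta>_def)
  have "ft x \<noteq> 0" if x: "0 < x" "x < \<delta>" for x
  proof
    assume "ft x = 0"
    then have "x ^ N * (\<bar>m\<bar> / fact N) \<le> C * x ^ Suc N"
      using est[of x] x by (simp add: norm_mult norm_power norm_divide)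
    then have "x ^ N * (\<bar>m\<bar> / fact N) \<le> x ^ N * (C * x)" by (simp add: mult_ac)
    then have 1: "\<bar>m\<bar> / fact N \<le> C * x" using x by (subst (asm) mult_le_cancel_left_pos) auto
    have "(C + 1) * x < (C + 1) * \<delta>" using x C0 by (intro mult_strict_left_mono) auto
    also have "(C + 1) * \<delta> = \<bar>m\<bar> / fact N" using C0 by (simp add: \<delta>_def)
    finally show False using 1 x by (simp add: algebra_simps)
  qed
  then show ?thesis using \<delta> by blast
qed

text \<open>
  The spectral integral is positive since its integrand is positive on an interval. The constant
  \<open>\<integral>(1 - cos x) x\<^bsup>-1-2h\<^esup> dx\<close> need not be evaluated: it is nonnegative, and its product with the variance is
  positive.
\<close>

lemma wavelet_cov_0_pos:
  assumes mom: "\<And>q. q < N \<Longrightarrow> (LINT t|lborel. t ^ q * \<psi> t) = 0"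
    and momN: "(LINT t|lborel. t ^ N * \<psi> t) \<noteq> 0" and h: "0 < h" "h < 1"
  shows "0 < wavelet_cov \<psi> h 0"
proof -
  let ?I = "LINT x|lborel. (cmod (ft x))\<^sup>2 * spectral_weight h x"
  let ?K = "LINT x|lborel. (1 - cos x) * spectral_weight h x"
  have K: "0 \<le> ?K"
    by (intro integral_nonneg_AE AE_I2 mult_nonneg_nonneg spectral_weight_nonneg) simp
  have I0: "0 \<le> ?I"
    by (intro integral_nonneg_AE AE_I2 mult_nonneg_nonneg spectral_weight_nonneg) simp
  obtain \<delta> where \<delta>: "\<delta> > 0" "\<And>x. 0 < x \<Longrightarrow> x < \<delta> \<Longrightarrow> ft x \<noteq> 0"
    using ft_nonzero_near_0[OF mom momN] by blast
  have "?I \<noteq> 0"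
  proof
    assume "?I = 0"
    then have "AE x in lborel. (cmod (ft x))\<^sup>2 * spectral_weight h x = 0"
      using integral_nonneg_eq_0_iff_AE[OF wavelet_cov_spectral(1)[OF h]] spectral_weight_nonneg by simp
    then have "AE x in lborel. \<not> (0 < x \<and> x < \<delta>)"
      by eventually_elim (use \<delta> in \<open>auto simp: spectral_weight_def\<close>)
    then have "emeasure lborel {0<..<\<delta>} = 0"
      by (subst (asm) AE_iff_measurable[of "{0<..<\<delta>}"]) (auto simp: greaterThanLessThan_def)
    then show False using \<delta> by simp
  qed
  then have "0 < 2 * wavelet_cov \<psi> h 0 * ?K" using I0 wavelet_cov_spectral(2)[OF h] by simp
  then show ?thesis using K by (simp add: zero_less_mult_iff)
qed

end

section \<open>Fourth moments of Gaussian variables\<close>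

lemma distributed_normal_even_moment:
  assumes d: "distributed M lborel Z (normal_density 0 \<sigma>)" and \<sigma>: "\<sigma> > 0"
  shows "integrable M (\<lambda>\<omega>. Z \<omega> ^ (2 * k))"
    and "(LINT \<omega>|M. Z \<omega> ^ (2 * k)) = fact (2 * k) / ((2 / \<sigma>\<^sup>2) ^ k * fact k)"
proof -
  have m: "has_bochner_integral lborel (\<lambda>x. normal_density 0 \<sigma> x * x ^ (2 * k)) (fact (2 * k) / ((2 / \<sigma>\<^sup>2)^k * fact k))"
    using normal_moment_even[OF \<sigma>, of 0 k] by simp
  show "integrable M (\<lambda>\<omega>. Z \<omega> ^ (2 * k))"
    using distributed_integrable[OF d, of "\<lambda>x. x ^ (2 * k)"] m by (auto simp: has_bochner_integral_iff)
  show "(LINT \<omega>|M. Z \<omega> ^ (2 * k)) = fact (2 * k) / ((2 / \<sigma>\<^sup>2) ^ k * fact k)"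
    using distributed_integral[OF d, of "\<lambda>x. x ^ (2 * k)"] m by (auto simp: has_bochner_integral_iff)
qed

text \<open>
  Constants count as Gaussian, so a centred Gaussian variable is either almost surely zero or has a
  normal density of mean zero.
\<close>

lemma centered_gaussian_moments:
  assumes M: "prob_space M" and Z: "gaussian_rv M Z" and mean: "(LINT \<omega>|M. Z \<omega>) = 0"
  shows "integrable M (\<lambda>\<omega>. (Z \<omega>)\<^sup>2)" "integrable M (\<lambda>\<omega>. Z \<omega> ^ 4)"
    "(LINT \<omega>|M. Z \<omega> ^ 4) = 3 * (LINT \<omega>|M. (Z \<omega>)\<^sup>2)\<^sup>2"
proof -
  interpret prob_space M by fact
  have Zm [measurable]: "Z \<in> borel_measurable M" using Z by (simp add: gaussian_rv_def)
  obtain \<mu> where \<mu>: "(AE \<omega> in M. Z \<omega> = \<mu>) \<or> (\<exists>\<sigma>>0. distributed M lborel Z (normal_density \<mu> \<sigma>))"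
    using Z by (auto simp: gaussian_rv_def)
  have "integrable M (\<lambda>\<omega>. (Z \<omega>)\<^sup>2) \<and> integrable M (\<lambda>\<omega>. Z \<omega> ^ 4) \<and>
    (LINT \<omega>|M. Z \<omega> ^ 4) = 3 * (LINT \<omega>|M. (Z \<omega>)\<^sup>2)\<^sup>2"
  proof (cases "AE \<omega> in M. Z \<omega> = \<mu>")
    case True
    then have "(LINT \<omega>|M. Z \<omega>) = (LINT \<omega>|M. \<mu>)" by (intro integral_cong_AE) auto
    then have "\<mu> = 0" using mean by (simp add: prob_space)
    with True have z: "AE \<omega> in M. Z \<omega> = 0" by simp
    have 2: "AE \<omega> in M. (Z \<omega>)\<^sup>2 = 0" and 4: "AE \<omega> in M. Z \<omega> ^ 4 = 0" using z by auto
    have "integrable M (\<lambda>\<omega>. (Z \<omega>)\<^sup>2)" using 2 by (subst integrable_cong_AE[where g = "\<lambda>_. 0"]) auto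
    moreover have "integrable M (\<lambda>\<omega>. Z \<omega> ^ 4)" using 4 by (subst integrable_cong_AE[where g = "\<lambda>_. 0"]) auto
    moreover have "(LINT \<omega>|M. Z \<omega> ^ 4) = 0" using 4 by (subst integral_cong_AE[where g = "\<lambda>_. 0"]) auto
    moreover have "(LINT \<omega>|M. (Z \<omega>)\<^sup>2) = 0" using 2 by (subst integral_cong_AE[where g = "\<lambda>_. 0"]) auto
    ultimately show ?thesis by simp
  next
    case False
    then obtain \<sigma> where \<sigma>: "\<sigma> > 0" and d: "distributed M lborel Z (normal_density \<mu> \<sigma>)" using \<mu> by blast
    have "(LINT \<omega>|M. Z \<omega>) = (LINT x|lborel. normal_density \<mu> \<sigma> x * x)"
      using distributed_integral[OF d, of "\<lambda>x. x"] by simp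
    then have "\<mu> = 0" using mean integral_normal_moment_nz_1[OF \<sigma>, of \<mu>] by simp
    then have d: "distributed M lborel Z (normal_density 0 \<sigma>)" using d by simp
    note m2 = distributed_normal_even_moment[OF d \<sigma>, of 1, simplified]
    note m4 = distributed_normal_even_moment[OF d \<sigma>, of 2, simplified]
    show ?thesis using m2 m4 \<sigma> by (simp add: fact_numeral field_simps power2_eq_square)
  qed
  then show "integrable M (\<lambda>\<omega>. (Z \<omega>)\<^sup>2)" "integrable M (\<lambda>\<omega>. Z \<omega> ^ 4)"
    "(LINT \<omega>|M. Z \<omega> ^ 4) = 3 * (LINT \<omega>|M. (Z \<omega>)\<^sup>2)\<^sup>2" by auto
qed

text \<open>
  There are eight sign patterns, and in the expansion of each fourth power the product of the four
  variables has the coefficient 24.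
\<close>

lemma polarization_4:
  fixes x1 x2 x3 x4 :: real
  shows "192 * (x1 * x2 * x3 * x4) =
    (x1 + x2 + x3 + x4) ^ 4 - (x1 + x2 + x3 - x4) ^ 4 - (x1 + x2 - x3 + x4) ^ 4 + (x1 + x2 - x3 - x4) ^ 4
    - (x1 - x2 + x3 + x4) ^ 4 + (x1 - x2 + x3 - x4) ^ 4 + (x1 - x2 - x3 + x4) ^ 4 - (x1 - x2 - x3 - x4) ^ 4"
proof -
  have d: "(u + v) ^ 4 - (u - v) ^ 4 = 8 * v * u ^ 3 + 8 * v ^ 3 * u" for u v :: real
    by (simp add: power4_eq_xxxx power3_eq_cube algebra_simps)
  have "(x1 + x2 + x3) ^ 3 - (x1 + x2 - x3) ^ 3 - (x1 - x2 + x3) ^ 3 + (x1 - x2 - x3) ^ 3 = 24 * (x1 * x2 * x3)"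
    by (simp add: power3_eq_cube algebra_simps)
  then have "192 * (x1 * x2 * x3 * x4)
    = 8 * x4 * ((x1 + x2 + x3) ^ 3 - (x1 + x2 - x3) ^ 3 - (x1 - x2 + x3) ^ 3 + (x1 - x2 - x3) ^ 3)" by simp
  also have "\<dots> = ((x1 + x2 + x3 + x4) ^ 4 - (x1 + x2 + x3 - x4) ^ 4) - ((x1 + x2 - x3 + x4) ^ 4 - (x1 + x2 - x3 - x4) ^ 4)
    - ((x1 - x2 + x3 + x4) ^ 4 - (x1 - x2 + x3 - x4) ^ 4) + ((x1 - x2 - x3 + x4) ^ 4 - (x1 - x2 - x3 - x4) ^ 4)"
    unfolding d by (simp add: algebra_simps)
  finally show ?thesis by simp
qed

lemma integrable_product_of_squares:
  fixes f g :: "'a \<Rightarrow> real"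
  assumes [measurable]: "f \<in> borel_measurable M" "g \<in> borel_measurable M"
    and "integrable M (\<lambda>\<omega>. (f \<omega>)\<^sup>2)" "integrable M (\<lambda>\<omega>. (g \<omega>)\<^sup>2)"
  shows "integrable M (\<lambda>\<omega>. f \<omega> * g \<omega>)"
proof (rule Bochner_Integration.integrable_bound[OF Bochner_Integration.integrable_add[OF assms(3,4)]])
  have "\<bar>a * b\<bar> \<le> a\<^sup>2 + b\<^sup>2" for a b :: real
  proof -
    have "2 * (\<bar>a\<bar> * \<bar>b\<bar>) \<le> \<bar>a\<bar>\<^sup>2 + \<bar>b\<bar>\<^sup>2" using sum_squares_bound[of "\<bar>a\<bar>" "\<bar>b\<bar>"] by simp
    moreover have "0 \<le> \<bar>a\<bar> * \<bar>b\<bar>" by simp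
    ultimately show ?thesis unfolding abs_mult power2_abs by linarith
  qed
  then show "AE x in M. norm (f x * g x) \<le> norm ((f x)\<^sup>2 + (g x)\<^sup>2)"
    by (intro AE_I2) (use order_trans[OF _ abs_ge_self] in auto)
qed measurable

text \<open>
  The fourth moment of a centred Gaussian variable is three times the square of its variance. Applied to
  the eight combinations of signs in the polarization identity, this expresses the expected product by
  the covariances.
\<close>

lemma isserlis_4:
  fixes X1 X2 X3 X4 :: "'a \<Rightarrow> real"
  assumes M: "prob_space M"
    and gauss: "\<And>c1 c2 c3 c4. gaussian_rv M (\<lambda>\<omega>. c1 * X1 \<omega> + c2 * X2 \<omega> + c3 * X3 \<omega> + c4 * X4 \<omega>)"
    and mean: "\<And>c1 c2 c3 c4. (LINT \<omega>|M. c1 * X1 \<omega> + c2 * X2 \<omega> + c3 * X3 \<omega> + c4 * X4 \<omega>) = 0"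
  defines "E f g \<equiv> (LINT \<omega>|M. f \<omega> * g \<omega>)"
  shows "(LINT \<omega>|M. X1 \<omega> * X2 \<omega> * X3 \<omega> * X4 \<omega>) = E X1 X2 * E X3 X4 + E X1 X3 * E X2 X4 + E X1 X4 * E X2 X3"
proof -
  define S where "S c2 c3 c4 = (\<lambda>\<omega>. X1 \<omega> + c2 * X2 \<omega> + c3 * X3 \<omega> + c4 * X4 \<omega>)" for c2 c3 c4
  have g1: "gaussian_rv M X1" "(LINT \<omega>|M. X1 \<omega>) = 0" using gauss[of 1 0 0 0] mean[of 1 0 0 0] by simp_all
  have g2: "gaussian_rv M X2" "(LINT \<omega>|M. X2 \<omega>) = 0" using gauss[of 0 1 0 0] mean[of 0 1 0 0] by simp_all
  have g3: "gaussian_rv M X3" "(LINT \<omega>|M. X3 \<omega>) = 0" using gauss[of 0 0 1 0] mean[of 0 0 1 0] by simp_all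
  have g4: "gaussian_rv M X4" "(LINT \<omega>|M. X4 \<omega>) = 0" using gauss[of 0 0 0 1] mean[of 0 0 0 1] by simp_all
  note sq = centered_gaussian_moments(1)[OF M g1] centered_gaussian_moments(1)[OF M g2]
    centered_gaussian_moments(1)[OF M g3] centered_gaussian_moments(1)[OF M g4]
  have meas [measurable]: "X1 \<in> borel_measurable M" "X2 \<in> borel_measurable M" "X3 \<in> borel_measurable M" "X4 \<in> borel_measurable M"
    using g1 g2 g3 g4 by (auto simp: gaussian_rv_def)
  note pr = integrable_product_of_squares[OF meas(1,2) sq(1,2)] integrable_product_of_squares[OF meas(1,3) sq(1,3)]
     integrable_product_of_squares[OF meas(1,4) sq(1,4)] integrable_product_of_squares[OF meas(2,3) sq(2,3)]
     integrable_product_of_squares[OF meas(2,4) sq(2,4)] integrable_product_of_squares[OF meas(3,4) sq(3,4)]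
  have gS: "gaussian_rv M (S c2 c3 c4)" "(LINT \<omega>|M. S c2 c3 c4 \<omega>) = 0" for c2 c3 c4
    unfolding S_def using gauss[of 1 c2 c3 c4] mean[of 1 c2 c3 c4] by simp_all
  have i4: "integrable M (\<lambda>\<omega>. S c2 c3 c4 \<omega> ^ 4)" for c2 c3 c4
    by (rule centered_gaussian_moments(2)[OF M gS])
  have S2: "(LINT \<omega>|M. (S c2 c3 c4 \<omega>)\<^sup>2) = E X1 X1 + c2\<^sup>2 * E X2 X2 + c3\<^sup>2 * E X3 X3 + c4\<^sup>2 * E X4 X4
      + 2 * (c2 * E X1 X2 + c3 * E X1 X3 + c4 * E X1 X4 + c2 * c3 * E X2 X3 + c2 * c4 * E X2 X4 + c3 * c4 * E X3 X4)" for c2 c3 c4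
  proof -
    have "(\<lambda>\<omega>. (S c2 c3 c4 \<omega>)\<^sup>2) = (\<lambda>\<omega>. (X1 \<omega>)\<^sup>2 + c2\<^sup>2 * (X2 \<omega>)\<^sup>2 + c3\<^sup>2 * (X3 \<omega>)\<^sup>2 + c4\<^sup>2 * (X4 \<omega>)\<^sup>2
      + 2 * (c2 * (X1 \<omega> * X2 \<omega>) + c3 * (X1 \<omega> * X3 \<omega>) + c4 * (X1 \<omega> * X4 \<omega>) + c2 * c3 * (X2 \<omega> * X3 \<omega>)
        + c2 * c4 * (X2 \<omega> * X4 \<omega>) + c3 * c4 * (X3 \<omega> * X4 \<omega>)))"
      unfolding S_def by (rule ext) (simp add: power2_eq_square algebra_simps)
    then show ?thesis using sq pr by (simp add: E_def power2_eq_square[of "X1 _"] power2_eq_square[of "X2 _"]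
      power2_eq_square[of "X3 _"] power2_eq_square[of "X4 _"])
  qed
  have "192 * (LINT \<omega>|M. X1 \<omega> * X2 \<omega> * X3 \<omega> * X4 \<omega>) = (LINT \<omega>|M. 192 * (X1 \<omega> * X2 \<omega> * X3 \<omega> * X4 \<omega>))"
    by simp
  also have "(\<lambda>\<omega>. 192 * (X1 \<omega> * X2 \<omega> * X3 \<omega> * X4 \<omega>)) = (\<lambda>\<omega>. S 1 1 1 \<omega> ^ 4 - S 1 1 (-1) \<omega> ^ 4 - S 1 (-1) 1 \<omega> ^ 4
      + S 1 (-1) (-1) \<omega> ^ 4 - S (-1) 1 1 \<omega> ^ 4 + S (-1) 1 (-1) \<omega> ^ 4 + S (-1) (-1) 1 \<omega> ^ 4 - S (-1) (-1) (-1) \<omega> ^ 4)"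
    unfolding S_def polarization_4 by (intro ext) (simp only: mult_1 mult_minus1 add_uminus_conv_diff)
  also have "(LINT \<omega>|M. \<dots> \<omega>) = 192 * (E X1 X2 * E X3 X4 + E X1 X3 * E X2 X4 + E X1 X4 * E X2 X3)"
    using i4 by (simp add: centered_gaussian_moments(3)[OF M gS] S2) (simp add: power2_eq_square algebra_simps)
  finally show ?thesis by simp
qed

text \<open>
  Times may be repeated here; coefficients that belong to the same time are added up.
\<close>

lemma gaussian_process_combination:
  fixes c :: "'b \<Rightarrow> real"
  assumes B: "gaussian_process M B" and I: "finite I"
  shows "gaussian_rv M (\<lambda>\<omega>. \<Sum>i\<in>I. c i * B (t i) \<omega>)"
proof -
  have "(\<Sum>i\<in>I. c i * B (t i) \<omega>) = (\<Sum>\<tau>\<in>t ` I. (\<Sum>i | i \<in> I \<and> t i = \<tau>. c i) * B \<tau> \<omega>)" for \<omega>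
  proof -
    have "(\<Sum>i\<in>I. c i * B (t i) \<omega>) = (\<Sum>\<tau>\<in>t ` I. \<Sum>i | i \<in> I \<and> t i = \<tau>. c i * B (t i) \<omega>)"
      by (rule sum.image_gen[OF I])
    also have "\<dots> = (\<Sum>\<tau>\<in>t ` I. (\<Sum>i | i \<in> I \<and> t i = \<tau>. c i) * B \<tau> \<omega>)"
      unfolding sum_distrib_right by (intro sum.cong) auto
    finally show ?thesis .
  qed
  then show ?thesis using B I by (simp add: gaussian_process_def)
qed

definition fBm_cov :: "real \<Rightarrow> real \<Rightarrow> real \<Rightarrow> real" where
  "fBm_cov h s t = (\<bar>s\<bar> powr (2 * h) + \<bar>t\<bar> powr (2 * h) - \<bar>t - s\<bar> powr (2 * h)) / 2"

lemma standard_fBm_moments: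
  assumes M: "prob_space M" and B: "standard_fBm M h B"
  shows "B t \<in> borel_measurable M" "integrable M (\<lambda>\<omega>. (B t \<omega>)\<^sup>2)" "integrable M (\<lambda>\<omega>. B t \<omega> ^ 4)"
    "(LINT \<omega>|M. B t \<omega>) = 0" "integrable M (B t)"
    "(LINT \<omega>|M. B s \<omega> * B t \<omega>) = fBm_cov h s t"
    "(LINT \<omega>|M. B t \<omega> ^ 4) = 3 * (fBm_cov h t t)\<^sup>2"
    "(LINT \<omega>|M. B t1 \<omega> * B t2 \<omega> * B t3 \<omega> * B t4 \<omega>) =
      fBm_cov h t1 t2 * fBm_cov h t3 t4 + fBm_cov h t1 t3 * fBm_cov h t2 t4 + fBm_cov h t1 t4 * fBm_cov h t2 t3"
proof -
  interpret prob_space M by fact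
  have gp: "gaussian_process M B" and mean: "\<And>t. (LINT \<omega>|M. B t \<omega>) = 0"
    and cov: "\<And>s t. (LINT \<omega>|M. B s \<omega> * B t \<omega>) = fBm_cov h s t"
    using B by (auto simp: standard_fBm_def fBm_cov_def)
  have g: "gaussian_rv M (B t)" for t
    using gaussian_process_combination[OF gp, of "{()}" "\<lambda>_. 1" "\<lambda>_. t"] by simp
  have meas: "B t \<in> borel_measurable M" for t using g[of t] by (simp add: gaussian_rv_def)
  note mom = centered_gaussian_moments[OF M g mean]
  have int: "integrable M (B t)" for t by (rule square_integrable_imp_integrable[OF meas mom(1)])
  show "B t \<in> borel_measurable M" "integrable M (\<lambda>\<omega>. (B t \<omega>)\<^sup>2)" "integrable M (\<lambda>\<omega>. B t \<omega> ^ 4)"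
    "(LINT \<omega>|M. B t \<omega>) = 0" "integrable M (B t)"
    "(LINT \<omega>|M. B s \<omega> * B t \<omega>) = fBm_cov h s t"
    by (fact meas mom mean int cov)+
  show "(LINT \<omega>|M. B t \<omega> ^ 4) = 3 * (fBm_cov h t t)\<^sup>2"
    using mom(3)[of t] cov[of t t] by (simp add: power2_eq_square)
  show "(LINT \<omega>|M. B t1 \<omega> * B t2 \<omega> * B t3 \<omega> * B t4 \<omega>) =
      fBm_cov h t1 t2 * fBm_cov h t3 t4 + fBm_cov h t1 t3 * fBm_cov h t2 t4 + fBm_cov h t1 t4 * fBm_cov h t2 t3"
    unfolding cov[symmetric]
  proof (rule isserlis_4[OF M])
    fix c1 c2 c3 c4 :: real
    let ?t = "\<lambda>i::nat. if i = 0 then t1 else if i = 1 then t2 else if i = 2 then t3 else t4"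
    let ?c = "\<lambda>i::nat. if i = 0 then c1 else if i = 1 then c2 else if i = 2 then c3 else c4"
    have "(\<Sum>i<4. ?c i * B (?t i) \<omega>) = c1 * B t1 \<omega> + c2 * B t2 \<omega> + c3 * B t3 \<omega> + c4 * B t4 \<omega>" for \<omega>
      by (simp add: eval_nat_numeral)
    then show "gaussian_rv M (\<lambda>\<omega>. c1 * B t1 \<omega> + c2 * B t2 \<omega> + c3 * B t3 \<omega> + c4 * B t4 \<omega>)"
      using gaussian_process_combination[OF gp, of "{..<4::nat}" ?c ?t] by simp
    show "(LINT \<omega>|M. c1 * B t1 \<omega> + c2 * B t2 \<omega> + c3 * B t3 \<omega> + c4 * B t4 \<omega>) = 0"
      using int by (simp add: mean)
  qed
qed

section \<open>Wavelet integrals of processes with bounded fourth moments\<close>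

text \<open>
  Fourth moments are used as a common currency: by the inequality of the means, the product of any four
  functions with fourth moment at most \<open>C\<close> is integrable, with the same bound.
\<close>

definition L4_bounded :: "'a measure \<Rightarrow> real \<Rightarrow> ('a \<Rightarrow> real) \<Rightarrow> bool" where
  "L4_bounded M C f \<longleftrightarrow> f \<in> borel_measurable M \<and> integrable M (\<lambda>\<omega>. f \<omega> ^ 4) \<and> (LINT \<omega>|M. f \<omega> ^ 4) \<le> C"

lemma L4_bounded_nonneg: "L4_bounded M C f \<Longrightarrow> 0 \<le> C"
proof -
  assume "L4_bounded M C f"
  moreover have "0 \<le> (LINT \<omega>|M. f \<omega> ^ 4)" by (intro integral_nonneg_AE AE_I2) simp
  ultimately show "0 \<le> C" unfolding L4_bounded_def by linarith
qed

lemma L4_bounded_mono: "L4_bounded M C f \<Longrightarrow> C \<le> D \<Longrightarrow> L4_bounded M D f"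
  by (auto simp: L4_bounded_def)

lemma product_4_le_mean:
  fixes a b c d :: real
  shows "\<bar>a * b * c * d\<bar> \<le> (a ^ 4 + b ^ 4 + c ^ 4 + d ^ 4) / 4"
proof -
  have "2 * \<bar>x * y\<bar> \<le> x\<^sup>2 + y\<^sup>2" for x y :: real
    using sum_squares_bound[of "\<bar>x\<bar>" "\<bar>y\<bar>"] by (simp add: abs_mult)
  from this[of a b] this[of c d] this[of "a * b" "c * d"] this[of "a\<^sup>2" "b\<^sup>2"] this[of "c\<^sup>2" "d\<^sup>2"]
  show ?thesis by (simp add: power_mult_distrib abs_mult mult_ac flip: power_mult)
qed

lemma
  assumes f: "L4_bounded M C f1" "L4_bounded M C f2" "L4_bounded M C f3" "L4_bounded M C f4"
  shows L4_product_integrable: "integrable M (\<lambda>\<omega>. f1 \<omega> * f2 \<omega> * f3 \<omega> * f4 \<omega>)"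
    and L4_product_bound: "(LINT \<omega>|M. \<bar>f1 \<omega> * f2 \<omega> * f3 \<omega> * f4 \<omega>\<bar>) \<le> C"
proof -
  have [measurable]: "f1 \<in> borel_measurable M" "f2 \<in> borel_measurable M" "f3 \<in> borel_measurable M" "f4 \<in> borel_measurable M"
    and i: "integrable M (\<lambda>\<omega>. f1 \<omega> ^ 4)" "integrable M (\<lambda>\<omega>. f2 \<omega> ^ 4)" "integrable M (\<lambda>\<omega>. f3 \<omega> ^ 4)" "integrable M (\<lambda>\<omega>. f4 \<omega> ^ 4)"
    and le: "(LINT \<omega>|M. f1 \<omega> ^ 4) \<le> C" "(LINT \<omega>|M. f2 \<omega> ^ 4) \<le> C" "(LINT \<omega>|M. f3 \<omega> ^ 4) \<le> C" "(LINT \<omega>|M. f4 \<omega> ^ 4) \<le> C"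
    using f by (auto simp: L4_bounded_def)
  let ?S = "\<lambda>\<omega>. (f1 \<omega> ^ 4 + f2 \<omega> ^ 4 + f3 \<omega> ^ 4 + f4 \<omega> ^ 4) / 4"
  have S: "integrable M ?S" using i by auto
  show p: "integrable M (\<lambda>\<omega>. f1 \<omega> * f2 \<omega> * f3 \<omega> * f4 \<omega>)"
    by (rule Bochner_Integration.integrable_bound[OF S])
      (use order_trans[OF product_4_le_mean abs_ge_self] in \<open>auto intro!: AE_I2\<close>)
  have "(LINT \<omega>|M. \<bar>f1 \<omega> * f2 \<omega> * f3 \<omega> * f4 \<omega>\<bar>) \<le> (LINT \<omega>|M. ?S \<omega>)"
    using S p product_4_le_mean by (intro integral_mono) auto
  also have "\<dots> = ((LINT \<omega>|M. f1 \<omega> ^ 4) + (LINT \<omega>|M. f2 \<omega> ^ 4) + (LINT \<omega>|M. f3 \<omega> ^ 4) + (LINT \<omega>|M. f4 \<omega> ^ 4)) / 4"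
    using i by simp
  also have "\<dots> \<le> C" using le by simp
  finally show "(LINT \<omega>|M. \<bar>f1 \<omega> * f2 \<omega> * f3 \<omega> * f4 \<omega>\<bar>) \<le> C" .
qed

locale wavelet_process = compact_wavelet \<psi> R + prob_space M
  for \<psi> :: "real \<Rightarrow> real" and R :: real and M :: "'a measure"
begin

text \<open>
  Only times in \<open>[-R, R]\<close> matter, because \<open>\<psi>\<close> vanishes elsewhere.
\<close>

definition L4_process :: "real \<Rightarrow> (real \<Rightarrow> 'a \<Rightarrow> real) \<Rightarrow> bool" where
  "L4_process C V \<longleftrightarrow> (\<lambda>(u, \<omega>). V u \<omega>) \<in> borel_measurable (borel \<Otimes>\<^sub>M M)
     \<and> (\<forall>u. \<bar>u\<bar> \<le> R \<longrightarrow> L4_bounded M C (V u))"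

text \<open>
  The wavelet integral of the process along its paths. It is 0, the default value of the integral, on
  paths for which the integrand is not integrable; these form a null event.
\<close>

definition wint :: "(real \<Rightarrow> 'a \<Rightarrow> real) \<Rightarrow> 'a \<Rightarrow> real" where
  "wint V \<omega> = (LINT u|lborel. \<psi> u * V u \<omega>)"

lemma wint_measurable:
  assumes [measurable]: "(\<lambda>(u, \<omega>). V u \<omega>) \<in> borel_measurable (borel \<Otimes>\<^sub>M M)"
  shows "wint V \<in> borel_measurable M"
  unfolding wint_def by measurable

lemma pair: "pair_sigma_finite lborel M" ..

lemma L4_process_mono: "L4_process C V \<Longrightarrow> C \<le> D \<Longrightarrow> L4_process D V"
  by (auto simp: L4_process_def intro: L4_bounded_mono)

lemma L4_process_nonneg: "L4_process C V \<Longrightarrow> 0 \<le> C"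
  using R L4_bounded_nonneg[of M C "V 0"] by (auto simp: L4_process_def)

text \<open>
  Jensen's inequality for the fourth power and the measure \<open>|\<psi>(u)| du\<close>, which need not have mass one. The
  tangent inequality \<open>4 c\<^sup>3 |x| \<le> x\<^sup>4 + 3 c\<^sup>4\<close> is integrated, with \<open>c\<close> the mean of \<open>|f|\<close>.
\<close>

lemma power_mean_4:
  assumes [measurable]: "f \<in> borel_measurable borel" and i: "integrable lborel (\<lambda>u. \<bar>\<psi> u\<bar> * f u ^ 4)"
  shows "integrable lborel (\<lambda>u. \<psi> u * f u)"
    and "(LINT u|lborel. \<psi> u * f u) ^ 4 \<le> (mass + 1) ^ 3 * (LINT u|lborel. \<bar>\<psi> u\<bar> * f u ^ 4)"
proof -
  have tangent: "4 * c ^ 3 * \<bar>x\<bar> \<le> x ^ 4 + 3 * c ^ 4" for c x :: real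
  proof -
    have "\<bar>x\<bar> ^ 4 + 3 * c ^ 4 - 4 * c ^ 3 * \<bar>x\<bar> = (\<bar>x\<bar> - c)\<^sup>2 * ((\<bar>x\<bar> + c)\<^sup>2 + 2 * c\<^sup>2)"
      by (simp add: power2_eq_square power4_eq_xxxx power3_eq_cube algebra_simps)
    also have "\<dots> \<ge> 0" by simp
    finally show ?thesis by simp
  qed
  show i1: "integrable lborel (\<lambda>u. \<psi> u * f u)"
  proof (rule Bochner_Integration.integrable_bound)
    show "integrable lborel (\<lambda>u. \<bar>\<psi> u\<bar> * f u ^ 4 + 3 * \<bar>\<psi> u\<bar>)" using i int by auto
    have "\<bar>f u\<bar> \<le> f u ^ 4 + 3" for u using tangent[of 1 "f u"] by simp
    then have "\<bar>\<psi> u\<bar> * \<bar>f u\<bar> \<le> \<bar>\<psi> u\<bar> * (f u ^ 4 + 3)" for u by (rule mult_left_mono) simp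
    then have "\<bar>\<psi> u * f u\<bar> \<le> \<bar>\<psi> u\<bar> * f u ^ 4 + 3 * \<bar>\<psi> u\<bar>" for u by (simp add: abs_mult algebra_simps)
    then show "AE u in lborel. norm (\<psi> u * f u) \<le> norm (\<bar>\<psi> u\<bar> * f u ^ 4 + 3 * \<bar>\<psi> u\<bar>)"
      by (intro AE_I2) (use order_trans[OF _ abs_ge_self] in auto)
  qed measurable
  define A where "A = (LINT u|lborel. \<bar>\<psi> u * f u\<bar>)"
  define J where "J = (LINT u|lborel. \<bar>\<psi> u\<bar> * f u ^ 4)"
  \<comment> \<open>adding 1 to the mass avoids the division by zero for \<open>\<psi> = 0\<close>\<close>
  define m where "m = mass + 1"
  have A0: "0 \<le> A" by (simp add: A_def)
  have m: "0 < m" "mass \<le> m" using mass_nonneg by (auto simp: m_def)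
  define c where "c = A / m"
  have "4 * c ^ 3 * A = (LINT u|lborel. 4 * c ^ 3 * \<bar>\<psi> u * f u\<bar>)" by (simp add: A_def)
  also have "\<dots> \<le> (LINT u|lborel. \<bar>\<psi> u\<bar> * f u ^ 4 + 3 * c ^ 4 * \<bar>\<psi> u\<bar>)"
  proof (rule integral_mono)
    show "integrable lborel (\<lambda>u. 4 * c ^ 3 * \<bar>\<psi> u * f u\<bar>)" using i1 by auto
    show "integrable lborel (\<lambda>u. \<bar>\<psi> u\<bar> * f u ^ 4 + 3 * c ^ 4 * \<bar>\<psi> u\<bar>)" using i int by auto
    fix u show "4 * c ^ 3 * \<bar>\<psi> u * f u\<bar> \<le> \<bar>\<psi> u\<bar> * f u ^ 4 + 3 * c ^ 4 * \<bar>\<psi> u\<bar>"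
      using mult_left_mono[OF tangent[of c "f u"], of "\<bar>\<psi> u\<bar>"] by (simp add: abs_mult algebra_simps)
  qed
  also have "\<dots> = J + 3 * c ^ 4 * mass" using i int by (simp add: J_def mass_def)
  also have "\<dots> \<le> J + 3 * c ^ 4 * m" using m by (intro add_mono mult_left_mono) auto
  finally have le: "4 * c ^ 3 * A \<le> J + 3 * c ^ 4 * m" .
  have "c * m = A" using m by (simp add: c_def)
  then have "c ^ 4 * m = c ^ 3 * A" by (simp add: eval_nat_numeral flip: \<open>c * m = A\<close>)
  then have "c ^ 3 * A \<le> J" using le by linarith
  then have "m ^ 3 * (c ^ 3 * A) \<le> m ^ 3 * J" using m by (intro mult_left_mono) auto
  also have "m ^ 3 * (c ^ 3 * A) = (c * m) ^ 3 * A" by (simp add: power_mult_distrib)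
  also have "\<dots> = A ^ 4" unfolding \<open>c * m = A\<close> by (simp add: eval_nat_numeral)
  finally have "A ^ 4 \<le> m ^ 3 * J" .
  moreover have "(LINT u|lborel. \<psi> u * f u) ^ 4 \<le> A ^ 4"
  proof -
    have "\<bar>LINT u|lborel. \<psi> u * f u\<bar> \<le> A" unfolding A_def using integral_abs_bound by blast
    then have "\<bar>LINT u|lborel. \<psi> u * f u\<bar> ^ 4 \<le> A ^ 4" by (rule power_mono) simp
    then show ?thesis by simp
  qed
  ultimately show "(LINT u|lborel. \<psi> u * f u) ^ 4 \<le> (mass + 1) ^ 3 * (LINT u|lborel. \<bar>\<psi> u\<bar> * f u ^ 4)"
    by (simp add: m_def J_def)
qed

text \<open>
  The bound of the fourth power of the integral is integrated over \<open>M\<close>, and Tonelli's theorem moves the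
  expectation inside.
\<close>

lemma
  assumes V: "L4_process C V"
  shows wint_path_integrable: "AE \<omega> in M. integrable lborel (\<lambda>u. \<psi> u * V u \<omega>)"
    and wint_L4: "L4_bounded M ((mass + 1) ^ 4 * C) (wint V)"
proof -
  interpret P: pair_sigma_finite lborel M by (rule pair)
  have Vm [measurable]: "(\<lambda>(u, \<omega>). V u \<omega>) \<in> borel_measurable (borel \<Otimes>\<^sub>M M)"
    and V4: "\<And>u. \<bar>u\<bar> \<le> R \<Longrightarrow> integrable M (\<lambda>\<omega>. V u \<omega> ^ 4)" "\<And>u. \<bar>u\<bar> \<le> R \<Longrightarrow> (LINT \<omega>|M. V u \<omega> ^ 4) \<le> C"
    using V by (auto simp: L4_process_def L4_bounded_def)
  have C0: "0 \<le> C" using V by (rule L4_process_nonneg)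
  let ?E = "\<lambda>u. LINT \<omega>|M. V u \<omega> ^ 4"
  have E: "\<bar>?E u\<bar> \<le> C" if "\<bar>u\<bar> \<le> R" for u using V4(2)[OF that] by simp
  have iE: "integrable lborel (\<lambda>u. \<bar>\<psi> u * ?E u\<bar>)"
    by (intro integrable_abs integrable_mult_bounded[OF _ E]) measurable
  have i: "integrable (lborel \<Otimes>\<^sub>M M) (\<lambda>(u, \<omega>). \<bar>\<psi> u\<bar> * V u \<omega> ^ 4)"
  proof (rule P.Fubini_integrable)
    show "integrable lborel (\<lambda>u. LINT \<omega>|M. norm (case (u, \<omega>) of (u, \<omega>) \<Rightarrow> \<bar>\<psi> u\<bar> * V u \<omega> ^ 4))"
      using iE by (simp add: abs_mult)
    show "AE u in lborel. integrable M (\<lambda>\<omega>. case (u, \<omega>) of (u, \<omega>) \<Rightarrow> \<bar>\<psi> u\<bar> * V u \<omega> ^ 4)"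
    proof (rule AE_I2)
      fix u show "integrable M (\<lambda>\<omega>. case (u, \<omega>) of (u, \<omega>) \<Rightarrow> \<bar>\<psi> u\<bar> * V u \<omega> ^ 4)"
        using V4(1)[of u] supp[of u] by (cases "R < \<bar>u\<bar>") auto
    qed
  qed measurable
  have AE: "AE \<omega> in M. integrable lborel (\<lambda>u. \<bar>\<psi> u\<bar> * V u \<omega> ^ 4)"
    using P.AE_integrable_snd[OF i] by simp
  have path [measurable]: "(\<lambda>u. V u \<omega>) \<in> borel_measurable borel" if "\<omega> \<in> space M" for \<omega>
    using that by measurable
  show "AE \<omega> in M. integrable lborel (\<lambda>u. \<psi> u * V u \<omega>)"
    using AE AE_space by eventually_elim (rule power_mean_4(1)[OF path])
  let ?J = "\<lambda>\<omega>. LINT u|lborel. \<bar>\<psi> u\<bar> * V u \<omega> ^ 4"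
  have le: "AE \<omega> in M. wint V \<omega> ^ 4 \<le> (mass + 1) ^ 3 * ?J \<omega>"
    using AE AE_space by eventually_elim (unfold wint_def, rule power_mean_4(2)[OF path])
  have iJ: "integrable M (\<lambda>\<omega>. (mass + 1) ^ 3 * ?J \<omega>)"
    using P.integrable_snd[OF i] by simp
  note [measurable] = wint_measurable[OF Vm]
  have i4: "integrable M (\<lambda>\<omega>. wint V \<omega> ^ 4)"
    by (rule Bochner_Integration.integrable_bound[OF iJ], measurable)
      (use le in eventually_elim, use order_trans[OF _ abs_ge_self] in auto)
  have "(LINT \<omega>|M. wint V \<omega> ^ 4) \<le> (LINT \<omega>|M. (mass + 1) ^ 3 * ?J \<omega>)"
    by (rule integral_mono_AE[OF i4 iJ le])
  also have "\<dots> = (mass + 1) ^ 3 * (LINT u|lborel. \<bar>\<psi> u\<bar> * ?E u)"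
    using P.Fubini_integral[OF i] by simp
  also have "\<dots> \<le> (mass + 1) ^ 3 * (mass * C)"
  proof (intro mult_left_mono)
    have "(LINT u|lborel. \<bar>\<psi> u\<bar> * ?E u) = (LINT u|lborel. \<bar>\<psi> u * ?E u\<bar>)" by (simp add: abs_mult)
    also have "\<dots> \<le> (LINT u|lborel. \<bar>\<psi> u\<bar> * C)"
    proof (rule integral_mono[OF iE])
      show "integrable lborel (\<lambda>u. \<bar>\<psi> u\<bar> * C)" using int by auto
      fix u show "\<bar>\<psi> u * ?E u\<bar> \<le> \<bar>\<psi> u\<bar> * C"
        unfolding abs_mult using E[of u] supp[of u] by (cases "R < \<bar>u\<bar>") (auto intro: mult_left_mono)
    qed
    also have "\<dots> = mass * C" by (simp add: mass_def)
    finally show "(LINT u|lborel. \<bar>\<psi> u\<bar> * ?E u) \<le> mass * C" .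
  qed (use mass_nonneg in auto)
  also have "\<dots> \<le> (mass + 1) ^ 3 * ((mass + 1) * C)"
    using mass_nonneg C0 by (intro mult_left_mono mult_right_mono) auto
  also have "\<dots> = (mass + 1) ^ 4 * C" by (simp add: eval_nat_numeral)
  finally show "L4_bounded M ((mass + 1) ^ 4 * C) (wint V)"
    using i4 by (simp add: L4_bounded_def)
qed

text \<open>
  Fubini's theorem, one wavelet integral at a time. Applied repeatedly it turns the moments of wavelet
  integrals into iterated integrals of the moments of the process, which is all that is needed here: the
  wavelet integrals themselves never have to be identified as Gaussian.
\<close>

lemma expectation_mult_wint:
  assumes [measurable]: "(\<lambda>(u, \<omega>). V u \<omega>) \<in> borel_measurable (borel \<Otimes>\<^sub>M M)" "Q \<in> borel_measurable M"
    and i: "\<And>u. \<bar>u\<bar> \<le> R \<Longrightarrow> integrable M (\<lambda>\<omega>. Q \<omega> * V u \<omega>)"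
    and b: "\<And>u. \<bar>u\<bar> \<le> R \<Longrightarrow> (LINT \<omega>|M. \<bar>Q \<omega> * V u \<omega>\<bar>) \<le> C"
  shows "(LINT \<omega>|M. Q \<omega> * wint V \<omega>) = (LINT u|lborel. \<psi> u * (LINT \<omega>|M. Q \<omega> * V u \<omega>))"
proof -
  interpret P: pair_sigma_finite lborel M by (rule pair)
  have b': "\<bar>LINT \<omega>|M. \<bar>Q \<omega> * V u \<omega>\<bar>\<bar> \<le> C" if "\<bar>u\<bar> \<le> R" for u using b[OF that] by simp
  have iE: "integrable lborel (\<lambda>u. \<bar>\<psi> u * (LINT \<omega>|M. \<bar>Q \<omega> * V u \<omega>\<bar>)\<bar>)"
    by (intro integrable_abs integrable_mult_bounded[OF _ b']) measurable
  have int2: "integrable (lborel \<Otimes>\<^sub>M M) (\<lambda>(u, \<omega>). \<psi> u * (Q \<omega> * V u \<omega>))"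
  proof (rule P.Fubini_integrable)
    show "integrable lborel (\<lambda>u. LINT \<omega>|M. norm (case (u, \<omega>) of (u, \<omega>) \<Rightarrow> \<psi> u * (Q \<omega> * V u \<omega>)))"
      using iE by (simp add: abs_mult)
    show "AE u in lborel. integrable M (\<lambda>\<omega>. case (u, \<omega>) of (u, \<omega>) \<Rightarrow> \<psi> u * (Q \<omega> * V u \<omega>))"
    proof (rule AE_I2)
      fix u show "integrable M (\<lambda>\<omega>. case (u, \<omega>) of (u, \<omega>) \<Rightarrow> \<psi> u * (Q \<omega> * V u \<omega>))"
        using i[of u] supp[of u] by (cases "R < \<bar>u\<bar>") auto
    qed
  qed measurable
  have "(LINT \<omega>|M. Q \<omega> * wint V \<omega>) = (LINT \<omega>|M. (LINT u|lborel. \<psi> u * (Q \<omega> * V u \<omega>)))"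
    unfolding wint_def by (subst integral_mult_right_zero[symmetric]) (simp add: mult_ac)
  also have "\<dots> = (LINT u|lborel. (LINT \<omega>|M. \<psi> u * (Q \<omega> * V u \<omega>)))"
    by (rule P.Fubini_integral[OF int2])
  finally show ?thesis by simp
qed

end

section \<open>Wavelet averages and Wick's formula\<close>

context compact_wavelet begin

text \<open>
  The wavelet average of a function. The tame functions and kernels form a class on which it is additive.
\<close>

definition avg :: "(real \<Rightarrow> real) \<Rightarrow> real" where
  "avg f = (LINT u|lborel. \<psi> u * f u)"

definition tame :: "(real \<Rightarrow> real) \<Rightarrow> bool" where
  "tame f \<longleftrightarrow> f \<in> borel_measurable borel \<and> (\<exists>B. \<forall>u. \<bar>u\<bar> \<le> R \<longrightarrow> \<bar>f u\<bar> \<le> B)"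

definition tame_kernel :: "(real \<Rightarrow> real \<Rightarrow> real) \<Rightarrow> bool" where
  "tame_kernel K \<longleftrightarrow> (\<lambda>(u, v). K u v) \<in> borel_measurable (borel \<Otimes>\<^sub>M borel)
     \<and> (\<exists>B. \<forall>u v. \<bar>u\<bar> \<le> R \<and> \<bar>v\<bar> \<le> R \<longrightarrow> \<bar>K u v\<bar> \<le> B)"

lemma tame_integrable: "tame f \<Longrightarrow> integrable lborel (\<lambda>u. \<psi> u * f u)"
  unfolding tame_def using integrable_mult_bounded by blast

lemma avg_cong: "(\<And>u. \<bar>u\<bar> \<le> R \<Longrightarrow> f u = g u) \<Longrightarrow> avg f = avg g"
  unfolding avg_def
proof (intro Bochner_Integration.integral_cong refl)
  fix u assume "\<And>u. \<bar>u\<bar> \<le> R \<Longrightarrow> f u = g u"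
  then show "\<psi> u * f u = \<psi> u * g u" using supp[of u] by (cases "R < \<bar>u\<bar>") auto
qed

lemma avg_add: "tame f \<Longrightarrow> tame g \<Longrightarrow> avg (\<lambda>u. f u + g u) = avg f + avg g"
  unfolding avg_def by (simp add: distrib_left tame_integrable)

lemma avg_cmult: "avg (\<lambda>u. c * f u) = c * avg f"
  unfolding avg_def by (subst integral_mult_right_zero[symmetric]) (simp add: mult_ac)

lemma avg_multc: "avg (\<lambda>u. f u * c) = avg f * c"
  using avg_cmult[of c f] by (simp add: mult.commute)

lemma avg_const: "avg (\<lambda>u. c) = 0"
  unfolding avg_def by (simp add: moment0)

lemma tame_cmult: "tame f \<Longrightarrow> tame (\<lambda>u. c * f u)"
proof -
  assume f: "tame f"
  then obtain B where "\<And>u. \<bar>u\<bar> \<le> R \<Longrightarrow> \<bar>f u\<bar> \<le> B" unfolding tame_def by blast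
  then have "\<bar>c * f u\<bar> \<le> \<bar>c\<bar> * B" if "\<bar>u\<bar> \<le> R" for u using that by (simp add: abs_mult mult_left_mono)
  moreover have "(\<lambda>u. c * f u) \<in> borel_measurable borel" using f unfolding tame_def by auto
  ultimately show "tame (\<lambda>u. c * f u)" unfolding tame_def by blast
qed

lemma tame_multc: "tame f \<Longrightarrow> tame (\<lambda>u. f u * c)"
  using tame_cmult[of f c] by (simp add: mult.commute)

lemma tame_const: "tame (\<lambda>u. c)"
  unfolding tame_def by auto

lemma tame_add:
  assumes f: "tame f" and g: "tame g"
  shows "tame (\<lambda>u. f u + g u)"
proof -
  obtain B C where B: "\<And>u. \<bar>u\<bar> \<le> R \<Longrightarrow> \<bar>f u\<bar> \<le> B" and C: "\<And>u. \<bar>u\<bar> \<le> R \<Longrightarrow> \<bar>g u\<bar> \<le> C"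
    using f g unfolding tame_def by blast
  have "\<bar>f u + g u\<bar> \<le> B + C" if "\<bar>u\<bar> \<le> R" for u using B[OF that] C[OF that] by linarith
  moreover have "(\<lambda>u. f u + g u) \<in> borel_measurable borel" using f g unfolding tame_def by auto
  ultimately show ?thesis unfolding tame_def by blast
qed

lemma tame_kernel_section: "tame_kernel K \<Longrightarrow> \<bar>u\<bar> \<le> R \<Longrightarrow> tame (K u)"
  unfolding tame_kernel_def tame_def by (auto intro: measurable_compose[OF measurable_Pair1'])

lemma tame_kernel_avg:
  assumes K: "tame_kernel K"
  shows "tame (\<lambda>u. avg (K u))"
proof -
  have [measurable]: "(\<lambda>(u, v). K u v) \<in> borel_measurable (borel \<Otimes>\<^sub>M borel)" using K by (simp add: tame_kernel_def)
  obtain B where B: "\<And>u v. \<bar>u\<bar> \<le> R \<Longrightarrow> \<bar>v\<bar> \<le> R \<Longrightarrow> \<bar>K u v\<bar> \<le> B" using K unfolding tame_kernel_def by blast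
  have "\<bar>avg (K u)\<bar> \<le> mass * B" if "\<bar>u\<bar> \<le> R" for u
    unfolding avg_def by (rule integral_mult_bounded) (use B[OF that] in measurable)
  moreover have "(\<lambda>u. avg (K u)) \<in> borel_measurable borel" unfolding avg_def by measurable
  ultimately show ?thesis unfolding tame_def by blast
qed

text \<open>
  Each of the three pairings of the four variables separates into a product of two double averages.
\<close>

lemma avg_wick:
  assumes K: "tame_kernel K12" "tame_kernel K34" "tame_kernel K13" "tame_kernel K24" "tame_kernel K14" "tame_kernel K23"
  shows "avg (\<lambda>u1. avg (\<lambda>u2. avg (\<lambda>u3. avg (\<lambda>u4. K12 u1 u2 * K34 u3 u4 + K13 u1 u3 * K24 u2 u4 + K14 u1 u4 * K23 u2 u3))))
    = avg (\<lambda>u. avg (K12 u)) * avg (\<lambda>u. avg (K34 u)) + avg (\<lambda>u. avg (K13 u)) * avg (\<lambda>u. avg (K24 u))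
      + avg (\<lambda>u. avg (K14 u)) * avg (\<lambda>u. avg (K23 u))"
proof -
  note sec = K[THEN tame_kernel_section] note av = K[THEN tame_kernel_avg]
  have 4: "avg (\<lambda>u4. K12 u1 u2 * K34 u3 u4 + K13 u1 u3 * K24 u2 u4 + K14 u1 u4 * K23 u2 u3)
    = K12 u1 u2 * avg (K34 u3) + K13 u1 u3 * avg (K24 u2) + avg (K14 u1) * K23 u2 u3"
    if "\<bar>u1\<bar> \<le> R" "\<bar>u2\<bar> \<le> R" "\<bar>u3\<bar> \<le> R" for u1 u2 u3
    using sec that by (simp add: avg_add avg_cmult avg_multc tame_add tame_cmult tame_multc)
  have 3: "avg (\<lambda>u3. K12 u1 u2 * avg (K34 u3) + K13 u1 u3 * avg (K24 u2) + avg (K14 u1) * K23 u2 u3)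
    = K12 u1 u2 * avg (\<lambda>u. avg (K34 u)) + avg (K13 u1) * avg (K24 u2) + avg (K14 u1) * avg (K23 u2)"
    if "\<bar>u1\<bar> \<le> R" "\<bar>u2\<bar> \<le> R" for u1 u2
    using sec av that by (simp add: avg_add avg_cmult avg_multc tame_add tame_cmult tame_multc)
  have 2: "avg (\<lambda>u2. K12 u1 u2 * avg (\<lambda>u. avg (K34 u)) + avg (K13 u1) * avg (K24 u2) + avg (K14 u1) * avg (K23 u2))
    = avg (K12 u1) * avg (\<lambda>u. avg (K34 u)) + avg (K13 u1) * avg (\<lambda>u. avg (K24 u)) + avg (K14 u1) * avg (\<lambda>u. avg (K23 u))"
    if "\<bar>u1\<bar> \<le> R" for u1
    using sec av that by (simp add: avg_add avg_cmult avg_multc tame_add tame_cmult tame_multc)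
  have 1: "avg (\<lambda>u1. avg (K12 u1) * avg (\<lambda>u. avg (K34 u)) + avg (K13 u1) * avg (\<lambda>u. avg (K24 u)) + avg (K14 u1) * avg (\<lambda>u. avg (K23 u)))
    = avg (\<lambda>u. avg (K12 u)) * avg (\<lambda>u. avg (K34 u)) + avg (\<lambda>u. avg (K13 u)) * avg (\<lambda>u. avg (K24 u))
      + avg (\<lambda>u. avg (K14 u)) * avg (\<lambda>u. avg (K23 u))"
    using av by (simp add: avg_add avg_cmult avg_multc tame_add tame_cmult tame_multc)
  show ?thesis
    unfolding 1[symmetric]
    by (intro avg_cong, subst 2[symmetric], assumption, intro avg_cong, subst 3[symmetric], assumption, assumption,
        intro avg_cong, rule 4)
qed

end

context wavelet_process begin

lemma wint_second_moment:
  assumes V: "L4_process C V1" "L4_process C V2"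
  shows "(LINT \<omega>|M. wint V1 \<omega> * wint V2 \<omega>) = avg (\<lambda>u1. avg (\<lambda>u2. (LINT \<omega>|M. V1 u1 \<omega> * V2 u2 \<omega>)))"
    and "integrable M (\<lambda>\<omega>. wint V1 \<omega> * wint V2 \<omega>)"
proof -
  define D where "D = max 1 (max C ((mass + 1) ^ 4 * C))"
  \<comment> \<open>since \<open>D \<ge> 1\<close>, second moments are fourth moments with two factors equal to 1\<close>
  have one: "L4_bounded M D (\<lambda>_. 1)" by (simp add: L4_bounded_def D_def prob_space)
  have VD: "L4_process D V1" "L4_process D V2" using V by (auto intro: L4_process_mono simp: D_def)
  have W: "L4_bounded M D (wint V1)" "L4_bounded M D (wint V2)"
    using V by (auto intro: L4_bounded_mono[OF wint_L4] simp: D_def)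
  have S: "L4_bounded M D (V1 u)" "L4_bounded M D (V2 u)" if "\<bar>u\<bar> \<le> R" for u
    using VD that by (auto simp: L4_process_def)
  have Vm: "(\<lambda>(u, \<omega>). V1 u \<omega>) \<in> borel_measurable (borel \<Otimes>\<^sub>M M)" "(\<lambda>(u, \<omega>). V2 u \<omega>) \<in> borel_measurable (borel \<Otimes>\<^sub>M M)"
    using V by (auto simp: L4_process_def)
  have meas: "L4_bounded M D f \<Longrightarrow> f \<in> borel_measurable M" for f by (simp add: L4_bounded_def)
  show "integrable M (\<lambda>\<omega>. wint V1 \<omega> * wint V2 \<omega>)"
    using L4_product_integrable[OF W one one] by simp
  have "(LINT \<omega>|M. wint V1 \<omega> * wint V2 \<omega>) = (LINT \<omega>|M. wint V2 \<omega> * wint V1 \<omega>)" by (simp add: mult.commute)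
  also have "\<dots> = avg (\<lambda>u1. (LINT \<omega>|M. wint V2 \<omega> * V1 u1 \<omega>))"
    unfolding avg_def
    using L4_product_integrable[OF W(2) S(1) one one] L4_product_bound[OF W(2) S(1) one one]
    by (intro expectation_mult_wint[where C = D] Vm meas[OF W(2)]) auto
  also have "\<dots> = avg (\<lambda>u1. (LINT \<omega>|M. V1 u1 \<omega> * wint V2 \<omega>))" by (simp add: mult.commute)
  also have "\<dots> = avg (\<lambda>u1. avg (\<lambda>u2. (LINT \<omega>|M. V1 u1 \<omega> * V2 u2 \<omega>)))"
  proof (rule avg_cong)
    fix u1 assume u1: "\<bar>u1\<bar> \<le> R"
    show "(LINT \<omega>|M. V1 u1 \<omega> * wint V2 \<omega>) = avg (\<lambda>u2. (LINT \<omega>|M. V1 u1 \<omega> * V2 u2 \<omega>))"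
      unfolding avg_def
      using L4_product_integrable[OF S(1)[OF u1] S(2) one one] L4_product_bound[OF S(1)[OF u1] S(2) one one]
      by (intro expectation_mult_wint[where C = D] Vm meas[OF S(1)[OF u1]]) auto
  qed
  finally show "(LINT \<omega>|M. wint V1 \<omega> * wint V2 \<omega>) = avg (\<lambda>u1. avg (\<lambda>u2. (LINT \<omega>|M. V1 u1 \<omega> * V2 u2 \<omega>)))" .
qed

lemma wint_fourth_moment:
  assumes V: "L4_process C V1" "L4_process C V2" "L4_process C V3" "L4_process C V4"
  shows "(LINT \<omega>|M. wint V1 \<omega> * wint V2 \<omega> * wint V3 \<omega> * wint V4 \<omega>) =
      avg (\<lambda>u1. avg (\<lambda>u2. avg (\<lambda>u3. avg (\<lambda>u4. (LINT \<omega>|M. V1 u1 \<omega> * V2 u2 \<omega> * V3 u3 \<omega> * V4 u4 \<omega>)))))"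
    and "integrable M (\<lambda>\<omega>. wint V1 \<omega> * wint V2 \<omega> * wint V3 \<omega> * wint V4 \<omega>)"
proof -
  define D where "D = max C ((mass + 1) ^ 4 * C)"
  have VD: "L4_process D V1" "L4_process D V2" "L4_process D V3" "L4_process D V4"
    using V by (auto intro: L4_process_mono simp: D_def)
  have W: "L4_bounded M D (wint V1)" "L4_bounded M D (wint V2)" "L4_bounded M D (wint V3)" "L4_bounded M D (wint V4)"
    using V by (auto intro: L4_bounded_mono[OF wint_L4] simp: D_def)
  have S: "L4_bounded M D (V1 u)" "L4_bounded M D (V2 u)" "L4_bounded M D (V3 u)" "L4_bounded M D (V4 u)" if "\<bar>u\<bar> \<le> R" for u
    using VD that by (auto simp: L4_process_def)
  have Vm: "(\<lambda>(u, \<omega>). V1 u \<omega>) \<in> borel_measurable (borel \<Otimes>\<^sub>M M)" "(\<lambda>(u, \<omega>). V2 u \<omega>) \<in> borel_measurable (borel \<Otimes>\<^sub>M M)"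
     "(\<lambda>(u, \<omega>). V3 u \<omega>) \<in> borel_measurable (borel \<Otimes>\<^sub>M M)" "(\<lambda>(u, \<omega>). V4 u \<omega>) \<in> borel_measurable (borel \<Otimes>\<^sub>M M)"
    using V by (auto simp: L4_process_def)
  have meas: "L4_bounded M D f \<Longrightarrow> f \<in> borel_measurable M" for f by (simp add: L4_bounded_def)
  have step: "(LINT \<omega>|M. f1 \<omega> * f2 \<omega> * f3 \<omega> * wint V \<omega>) = avg (\<lambda>u. (LINT \<omega>|M. f1 \<omega> * f2 \<omega> * f3 \<omega> * V u \<omega>))"
    if f: "L4_bounded M D f1" "L4_bounded M D f2" "L4_bounded M D f3"
      and V: "(\<lambda>(u, \<omega>). V u \<omega>) \<in> borel_measurable (borel \<Otimes>\<^sub>M M)" "\<And>u. \<bar>u\<bar> \<le> R \<Longrightarrow> L4_bounded M D (V u)"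
    for f1 f2 f3 V
    unfolding avg_def
    by (rule expectation_mult_wint[where C = D and Q = "\<lambda>\<omega>. f1 \<omega> * f2 \<omega> * f3 \<omega>", OF V(1)])
      (use meas[OF f(1)] meas[OF f(2)] meas[OF f(3)] L4_product_integrable[OF f V(2)] L4_product_bound[OF f V(2)] in auto)
  show "integrable M (\<lambda>\<omega>. wint V1 \<omega> * wint V2 \<omega> * wint V3 \<omega> * wint V4 \<omega>)"
    by (rule L4_product_integrable[OF W])
  have "(LINT \<omega>|M. wint V1 \<omega> * wint V2 \<omega> * wint V3 \<omega> * wint V4 \<omega>)
    = (LINT \<omega>|M. wint V2 \<omega> * wint V3 \<omega> * wint V4 \<omega> * wint V1 \<omega>)" by (simp add: mult_ac)
  also have "\<dots> = avg (\<lambda>u1. (LINT \<omega>|M. wint V2 \<omega> * wint V3 \<omega> * wint V4 \<omega> * V1 u1 \<omega>))"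
    by (rule step[OF W(2,3,4) Vm(1) S(1)])
  also have "\<dots> = avg (\<lambda>u1. avg (\<lambda>u2. avg (\<lambda>u3. avg (\<lambda>u4. (LINT \<omega>|M. V1 u1 \<omega> * V2 u2 \<omega> * V3 u3 \<omega> * V4 u4 \<omega>)))))"
  proof (rule avg_cong)
    fix u1 assume u1: "\<bar>u1\<bar> \<le> R"
    have "(LINT \<omega>|M. wint V2 \<omega> * wint V3 \<omega> * wint V4 \<omega> * V1 u1 \<omega>)
      = (LINT \<omega>|M. V1 u1 \<omega> * wint V3 \<omega> * wint V4 \<omega> * wint V2 \<omega>)" by (simp add: mult_ac)
    also have "\<dots> = avg (\<lambda>u2. (LINT \<omega>|M. V1 u1 \<omega> * wint V3 \<omega> * wint V4 \<omega> * V2 u2 \<omega>))"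
      by (rule step[OF S(1)[OF u1] W(3,4) Vm(2) S(2)])
    also have "\<dots> = avg (\<lambda>u2. avg (\<lambda>u3. avg (\<lambda>u4. (LINT \<omega>|M. V1 u1 \<omega> * V2 u2 \<omega> * V3 u3 \<omega> * V4 u4 \<omega>))))"
    proof (rule avg_cong)
      fix u2 assume u2: "\<bar>u2\<bar> \<le> R"
      have "(LINT \<omega>|M. V1 u1 \<omega> * wint V3 \<omega> * wint V4 \<omega> * V2 u2 \<omega>)
        = (LINT \<omega>|M. V1 u1 \<omega> * V2 u2 \<omega> * wint V4 \<omega> * wint V3 \<omega>)" by (simp add: mult_ac)
      also have "\<dots> = avg (\<lambda>u3. (LINT \<omega>|M. V1 u1 \<omega> * V2 u2 \<omega> * wint V4 \<omega> * V3 u3 \<omega>))"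
        by (rule step[OF S(1)[OF u1] S(2)[OF u2] W(4) Vm(3) S(3)])
      also have "\<dots> = avg (\<lambda>u3. avg (\<lambda>u4. (LINT \<omega>|M. V1 u1 \<omega> * V2 u2 \<omega> * V3 u3 \<omega> * V4 u4 \<omega>)))"
      proof (rule avg_cong)
        fix u3 assume u3: "\<bar>u3\<bar> \<le> R"
        have "(LINT \<omega>|M. V1 u1 \<omega> * V2 u2 \<omega> * wint V4 \<omega> * V3 u3 \<omega>)
          = (LINT \<omega>|M. V1 u1 \<omega> * V2 u2 \<omega> * V3 u3 \<omega> * wint V4 \<omega>)" by (simp add: mult_ac)
        also have "\<dots> = avg (\<lambda>u4. (LINT \<omega>|M. V1 u1 \<omega> * V2 u2 \<omega> * V3 u3 \<omega> * V4 u4 \<omega>))"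
          by (rule step[OF S(1)[OF u1] S(2)[OF u2] S(3)[OF u3] Vm(4) S(4)])
        finally show "(LINT \<omega>|M. V1 u1 \<omega> * V2 u2 \<omega> * wint V4 \<omega> * V3 u3 \<omega>)
          = avg (\<lambda>u4. (LINT \<omega>|M. V1 u1 \<omega> * V2 u2 \<omega> * V3 u3 \<omega> * V4 u4 \<omega>))" .
      qed
      finally show "(LINT \<omega>|M. V1 u1 \<omega> * wint V3 \<omega> * wint V4 \<omega> * V2 u2 \<omega>)
        = avg (\<lambda>u3. avg (\<lambda>u4. (LINT \<omega>|M. V1 u1 \<omega> * V2 u2 \<omega> * V3 u3 \<omega> * V4 u4 \<omega>)))" .
    qed
    finally show "(LINT \<omega>|M. wint V2 \<omega> * wint V3 \<omega> * wint V4 \<omega> * V1 u1 \<omega>)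
      = avg (\<lambda>u2. avg (\<lambda>u3. avg (\<lambda>u4. (LINT \<omega>|M. V1 u1 \<omega> * V2 u2 \<omega> * V3 u3 \<omega> * V4 u4 \<omega>))))" .
  qed
  finally show "(LINT \<omega>|M. wint V1 \<omega> * wint V2 \<omega> * wint V3 \<omega> * wint V4 \<omega>) =
      avg (\<lambda>u1. avg (\<lambda>u2. avg (\<lambda>u3. avg (\<lambda>u4. (LINT \<omega>|M. V1 u1 \<omega> * V2 u2 \<omega> * V3 u3 \<omega> * V4 u4 \<omega>)))))" .
qed

text \<open>
  Wick's formula is inherited by the wavelet integrals.
\<close>

lemma wint_wick:
  assumes V: "L4_process C V1" "L4_process C V2" "L4_process C V3" "L4_process C V4"
    and K: "tame_kernel K12" "tame_kernel K34" "tame_kernel K13" "tame_kernel K24" "tame_kernel K14" "tame_kernel K23"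
    and wick: "\<And>u1 u2 u3 u4. (LINT \<omega>|M. V1 u1 \<omega> * V2 u2 \<omega> * V3 u3 \<omega> * V4 u4 \<omega>) =
      K12 u1 u2 * K34 u3 u4 + K13 u1 u3 * K24 u2 u4 + K14 u1 u4 * K23 u2 u3"
  shows "(LINT \<omega>|M. wint V1 \<omega> * wint V2 \<omega> * wint V3 \<omega> * wint V4 \<omega>) =
     avg (\<lambda>u. avg (K12 u)) * avg (\<lambda>u. avg (K34 u)) + avg (\<lambda>u. avg (K13 u)) * avg (\<lambda>u. avg (K24 u))
      + avg (\<lambda>u. avg (K14 u)) * avg (\<lambda>u. avg (K23 u))"
  unfolding wint_fourth_moment(1)[OF V] wick by (rule avg_wick[OF K])

end

section \<open>Wavelet coefficients of fractional Brownian motion\<close>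

text \<open>
  By self-similarity this normalization removes the scale \<open>s\<close> from all covariances. The wavelet coefficient
  of \<open>X\<close> at the scale \<open>s\<close> and the position \<open>k\<close> is \<open>s\<^bsup>h + 1/2\<^esup>\<close> times the wavelet integral of the rescaled process.
\<close>

definition rescaled :: "real \<Rightarrow> real \<Rightarrow> (real \<Rightarrow> 'a \<Rightarrow> real) \<Rightarrow> nat \<Rightarrow> real \<Rightarrow> 'a \<Rightarrow> real" where
  "rescaled s h X k u \<omega> = s powr (- h) * X (s * (real k + u)) \<omega>"

lemma fBm_cov_scale:
  assumes "0 < s"
  shows "fBm_cov h (s * a) (s * b) = s powr (2 * h) * fBm_cov h a b"
proof -
  have "\<bar>s * x\<bar> powr (2 * h) = s powr (2 * h) * \<bar>x\<bar> powr (2 * h)" for x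
    using assms by (simp add: abs_mult powr_mult)
  from this[of a] this[of b] this[of "b - a"] show ?thesis
    by (simp add: fBm_cov_def right_diff_distrib)  (simp add: algebra_simps)
qed

text \<open>
  Telescoping, as \<open>1 / (n + 2)\<^sup>2 \<le> 1 / (n + 1) - 1 / (n + 2)\<close>.
\<close>

lemma sum_inverse_square_le: "(\<Sum>i\<le>n. 1 / (1 + real i)\<^sup>2) \<le> 2 - 1 / (1 + real n)"
proof (induction n)
  case (Suc n)
  have "1 / (1 + real (Suc n))\<^sup>2 \<le> 1 / (1 + real n) - 1 / (1 + real (Suc n))"
  proof -
    have "1 / (1 + real n) - 1 / (1 + real (Suc n)) = 1 / ((1 + real n) * (1 + real (Suc n)))"
      by (simp add: field_simps)
    moreover have "1 / (1 + real (Suc n))\<^sup>2 \<le> 1 / ((1 + real n) * (1 + real (Suc n)))"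
      unfolding power2_eq_square by (intro divide_left_mono mult_right_mono) auto
    ultimately show ?thesis by simp
  qed
  then show ?case using Suc by simp
qed simp

lemma sum_inverse_square_dist_le: "(\<Sum>k'=1..N. 1 / (1 + \<bar>real k - real k'\<bar>)\<^sup>2) \<le> 4"
proof -
  let ?f = "\<lambda>i::nat. 1 / (1 + real i)\<^sup>2"
  have bound: "(\<Sum>i\<le>n. ?f i) \<le> 2" for n by (rule order_trans[OF sum_inverse_square_le]) simp
  have "(\<Sum>k'=1..N. 1 / (1 + \<bar>real k - real k'\<bar>)\<^sup>2)
    = (\<Sum>k'\<in>{1..N} \<inter> {..k}. 1 / (1 + \<bar>real k - real k'\<bar>)\<^sup>2) + (\<Sum>k'\<in>{1..N} - {..k}. 1 / (1 + \<bar>real k - real k'\<bar>)\<^sup>2)"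
    by (rule sum.Int_Diff) simp
  also have "(\<Sum>k'\<in>{1..N} \<inter> {..k}. 1 / (1 + \<bar>real k - real k'\<bar>)\<^sup>2) = (\<Sum>i\<in>(\<lambda>k'. k - k') ` ({1..N} \<inter> {..k}). ?f i)"
    by (subst sum.reindex) (auto simp: inj_on_def of_nat_diff intro!: sum.cong)
  also have "\<dots> \<le> (\<Sum>i\<le>k. ?f i)" by (intro sum_mono2) auto
  also have "(\<Sum>k'\<in>{1..N} - {..k}. 1 / (1 + \<bar>real k - real k'\<bar>)\<^sup>2) = (\<Sum>i\<in>(\<lambda>k'. k' - k) ` ({1..N} - {..k}). ?f i)"
    by (subst sum.reindex) (auto simp: inj_on_def of_nat_diff intro!: sum.cong)
  also have "\<dots> \<le> (\<Sum>i\<le>N. ?f i)" by (intro sum_mono2) auto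
  finally show ?thesis using bound[of k] bound[of N] by linarith
qed

context compact_wavelet begin

lemma tame_kernel_fBm_cov:
  assumes h: "0 < h"
  shows "tame_kernel (\<lambda>u v. fBm_cov h (real k + u) (real k' + v))"
proof -
  let ?B = "(real k + real k' + 2 * R) powr (2 * h)"
  have p: "\<bar>x\<bar> powr (2 * h) \<le> ?B" if "\<bar>x\<bar> \<le> real k + real k' + 2 * R" for x
    using that h by (intro powr_mono2) auto
  have half: "\<bar>(a + b - c) / 2\<bar> \<le> 2 * B" if "a \<le> B" "b \<le> B" "c \<le> B" "0 \<le> a" "0 \<le> b" "0 \<le> c" for a b c B :: real
    using that by (simp add: abs_le_iff)
  have "\<bar>fBm_cov h (real k + u) (real k' + v)\<bar> \<le> 2 * ?B" if "\<bar>u\<bar> \<le> R" "\<bar>v\<bar> \<le> R" for u v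
  proof -
    have "\<bar>real k + u\<bar> powr (2 * h) \<le> ?B" "\<bar>real k' + v\<bar> powr (2 * h) \<le> ?B"
      "\<bar>real k' + v - (real k + u)\<bar> powr (2 * h) \<le> ?B"
      by (rule p; use that R in linarith)+
    moreover have "0 \<le> \<bar>real k + u\<bar> powr (2 * h)" "0 \<le> \<bar>real k' + v\<bar> powr (2 * h)"
      "0 \<le> \<bar>real k' + v - (real k + u)\<bar> powr (2 * h)" by auto
    ultimately show ?thesis unfolding fBm_cov_def by (rule half)
  qed
  moreover have "(\<lambda>(u, v). fBm_cov h (real k + u) (real k' + v)) \<in> borel_measurable (borel \<Otimes>\<^sub>M borel)"
    unfolding fBm_cov_def by measurable
  ultimately show ?thesis unfolding tame_kernel_def by blast
qed

lemma avg_fBm_cov: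
  assumes h: "0 < h"
  shows "avg (\<lambda>u. avg (\<lambda>v. fBm_cov h (real k + u) (real k' + v))) = wavelet_cov \<psi> h (real k - real k')"
proof -
  define x where "x = real k - real k'"
  have bd: "\<bar>\<bar>y\<bar> powr (2 * h)\<bar> \<le> (real k + real k' + 2 * R) powr (2 * h)" if "\<bar>y\<bar> \<le> real k + real k' + 2 * R" for y
    using that h by (auto intro: powr_mono2)
  have t1: "tame (\<lambda>v. \<bar>real k' + v\<bar> powr (2 * h))"
  proof -
    have "\<bar>\<bar>real k' + v\<bar> powr (2 * h)\<bar> \<le> (real k + real k' + 2 * R) powr (2 * h)" if "\<bar>v\<bar> \<le> R" for v
      by (rule bd) (use that R in linarith)
    then show ?thesis unfolding tame_def by (intro conjI exI[of _ "(real k + real k' + 2 * R) powr (2 * h)"]) auto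
  qed
  have t2: "tame (\<lambda>v. \<bar>u - v + x\<bar> powr (2 * h))" if u: "\<bar>u\<bar> \<le> R" for u
  proof -
    have "\<bar>\<bar>u - v + x\<bar> powr (2 * h)\<bar> \<le> (real k + real k' + 2 * R) powr (2 * h)" if "\<bar>v\<bar> \<le> R" for v
      by (rule bd) (use that u in \<open>unfold x_def, linarith\<close>)
    then show ?thesis unfolding tame_def by (intro conjI exI[of _ "(real k + real k' + 2 * R) powr (2 * h)"]) auto
  qed
  have kern: "tame_kernel (\<lambda>u v. \<bar>u - v + x\<bar> powr (2 * h))"
  proof -
    have "\<bar>\<bar>u - v + x\<bar> powr (2 * h)\<bar> \<le> (real k + real k' + 2 * R) powr (2 * h)" if "\<bar>u\<bar> \<le> R" "\<bar>v\<bar> \<le> R" for u v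
      by (rule bd) (use that in \<open>unfold x_def, linarith\<close>)
    then show ?thesis unfolding tame_kernel_def by (intro conjI exI[of _ "(real k + real k' + 2 * R) powr (2 * h)"]) auto
  qed
  define c where "c = avg (\<lambda>v. \<bar>real k' + v\<bar> powr (2 * h))"
  have inner: "avg (\<lambda>v. fBm_cov h (real k + u) (real k' + v)) = c / 2 + (- 1 / 2) * avg (\<lambda>v. \<bar>u - v + x\<bar> powr (2 * h))"
    if u: "\<bar>u\<bar> \<le> R" for u
  proof -
    have "(\<lambda>v. fBm_cov h (real k + u) (real k' + v)) = (\<lambda>v. \<bar>real k + u\<bar> powr (2 * h) / 2
        + ((1 / 2) * \<bar>real k' + v\<bar> powr (2 * h) + (- 1 / 2) * \<bar>u - v + x\<bar> powr (2 * h)))"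
    proof
      fix v
      have "\<bar>real k' + v - (real k + u)\<bar> = \<bar>u - v + x\<bar>" unfolding x_def by linarith
      then show "fBm_cov h (real k + u) (real k' + v) = \<bar>real k + u\<bar> powr (2 * h) / 2
        + ((1 / 2) * \<bar>real k' + v\<bar> powr (2 * h) + (- 1 / 2) * \<bar>u - v + x\<bar> powr (2 * h))"
        unfolding fBm_cov_def by (simp add: field_simps)
    qed
    then show ?thesis
      using t1 t2[OF u] by (simp only: avg_add avg_cmult tame_add tame_cmult tame_const avg_const) (simp add: c_def)
  qed
  have "avg (\<lambda>u. avg (\<lambda>v. fBm_cov h (real k + u) (real k' + v)))
    = avg (\<lambda>u. c / 2 + (- 1 / 2) * avg (\<lambda>v. \<bar>u - v + x\<bar> powr (2 * h)))"
    by (rule avg_cong) (rule inner)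
  also have "\<dots> = (- 1 / 2) * avg (\<lambda>u. avg (\<lambda>v. \<bar>u - v + x\<bar> powr (2 * h)))"
    using tame_kernel_avg[OF kern] by (simp only: avg_add avg_cmult tame_cmult tame_const avg_const)
  also have "\<dots> = wavelet_cov \<psi> h x" by (simp add: wavelet_cov_def avg_def)
  finally show ?thesis by (simp add: x_def)
qed

definition cov_bound :: real where "cov_bound = 90 * R ^ 3 * mass\<^sup>2"

lemma wavelet_cov_le: "0 < h \<Longrightarrow> h < 1 \<Longrightarrow> \<bar>wavelet_cov \<psi> h x\<bar> \<le> cov_bound / (1 + \<bar>x\<bar>)"
  using wavelet_cov_decay unfolding cov_bound_def by blast

lemma cov_bound_nonneg: "0 \<le> cov_bound"
  using R by (simp add: cov_bound_def)

text \<open>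
  Weak dependence along the wavelet positions: the double sum grows linearly and not quadratically in \<open>N\<close>.
\<close>

lemma sum_wavelet_cov_product_le:
  assumes "0 < h" "h < 1" "0 < h'" "h' < 1"
  shows "(\<Sum>k=1..N. \<Sum>k'=1..N. wavelet_cov \<psi> h (real k - real k') * wavelet_cov \<psi> h' (real k - real k'))
    \<le> 4 * cov_bound\<^sup>2 * real N"
proof -
  have "wavelet_cov \<psi> h x * wavelet_cov \<psi> h' x \<le> cov_bound\<^sup>2 * (1 / (1 + \<bar>x\<bar>)\<^sup>2)" for x
  proof -
    have "wavelet_cov \<psi> h x * wavelet_cov \<psi> h' x \<le> \<bar>wavelet_cov \<psi> h x\<bar> * \<bar>wavelet_cov \<psi> h' x\<bar>"
      by (metis abs_ge_self abs_mult)
    also have "\<dots> \<le> (cov_bound / (1 + \<bar>x\<bar>)) * (cov_bound / (1 + \<bar>x\<bar>))"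
      using cov_bound_nonneg assms by (intro mult_mono wavelet_cov_le) auto
    finally show ?thesis by (simp add: power2_eq_square)
  qed
  then have "(\<Sum>k=1..N. \<Sum>k'=1..N. wavelet_cov \<psi> h (real k - real k') * wavelet_cov \<psi> h' (real k - real k'))
    \<le> (\<Sum>k=1..N. \<Sum>k'=1..N. cov_bound\<^sup>2 * (1 / (1 + \<bar>real k - real k'\<bar>)\<^sup>2))"
    by (intro sum_mono)
  also have "\<dots> = (\<Sum>k=1..N. cov_bound\<^sup>2 * (\<Sum>k'=1..N. 1 / (1 + \<bar>real k - real k'\<bar>)\<^sup>2))"
    by (simp add: sum_distrib_left)
  also have "\<dots> \<le> (\<Sum>k=1..N. cov_bound\<^sup>2 * 4)"
    by (intro sum_mono mult_left_mono sum_inverse_square_dist_le) auto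
  finally show ?thesis by (simp add: mult_ac)
qed

end

context wavelet_process begin

lemma rescaled_fBm:
  assumes X: "standard_fBm M h X" and h: "0 < h" and s: "0 < s"
    and Xm: "(\<lambda>(t, \<omega>). X t \<omega>) \<in> borel_measurable (lborel \<Otimes>\<^sub>M M)"
  shows "(LINT \<omega>|M. rescaled s h X k u \<omega> * rescaled s h X k' v \<omega>) = fBm_cov h (real k + u) (real k' + v)"
    and "k \<le> N \<Longrightarrow> L4_process (3 * ((real N + R) powr (2 * h))\<^sup>2) (rescaled s h X k)"
    and "(LINT \<omega>|M. rescaled s h X k1 u1 \<omega> * rescaled s h X k2 u2 \<omega> * rescaled s h X k3 u3 \<omega> * rescaled s h X k4 u4 \<omega>) =
      fBm_cov h (real k1 + u1) (real k2 + u2) * fBm_cov h (real k3 + u3) (real k4 + u4)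
      + fBm_cov h (real k1 + u1) (real k3 + u3) * fBm_cov h (real k2 + u2) (real k4 + u4)
      + fBm_cov h (real k1 + u1) (real k4 + u4) * fBm_cov h (real k2 + u2) (real k3 + u3)"
proof -
  note mom = standard_fBm_moments[OF prob_space_axioms X]
  let ?c = "s powr (- h)"
  have c2: "?c * ?c * s powr (2 * h) = 1"
    using s by (simp flip: powr_add)
  show "(LINT \<omega>|M. rescaled s h X k u \<omega> * rescaled s h X k' v \<omega>) = fBm_cov h (real k + u) (real k' + v)" for k k' u v
  proof -
    have "(LINT \<omega>|M. rescaled s h X k u \<omega> * rescaled s h X k' v \<omega>)
      = (LINT \<omega>|M. ?c * ?c * (X (s * (real k + u)) \<omega> * X (s * (real k' + v)) \<omega>))"
      by (simp add: rescaled_def mult_ac)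
    also have "\<dots> = (?c * ?c * s powr (2 * h)) * fBm_cov h (real k + u) (real k' + v)"
      by (simp only: integral_mult_right_zero mom(6) fBm_cov_scale[OF s] mult.assoc)
    finally show ?thesis unfolding c2 by simp
  qed
  have "?c ^ 4 * (s powr (2 * h))\<^sup>2 = (?c * ?c * s powr (2 * h))\<^sup>2"
    by (simp add: power2_eq_square power4_eq_xxxx mult_ac)
  then have c4: "?c ^ 4 * (s powr (2 * h))\<^sup>2 = 1" unfolding c2 by simp
  have "(LINT \<omega>|M. rescaled s h X k1 u1 \<omega> * rescaled s h X k2 u2 \<omega> * rescaled s h X k3 u3 \<omega> * rescaled s h X k4 u4 \<omega>)
    = (LINT \<omega>|M. ?c ^ 4 * (X (s * (real k1 + u1)) \<omega> * X (s * (real k2 + u2)) \<omega> * X (s * (real k3 + u3)) \<omega> * X (s * (real k4 + u4)) \<omega>))"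
    by (simp add: rescaled_def mult_ac power4_eq_xxxx)
  also have "\<dots> = (?c ^ 4 * (s powr (2 * h))\<^sup>2) *
     (fBm_cov h (real k1 + u1) (real k2 + u2) * fBm_cov h (real k3 + u3) (real k4 + u4)
      + fBm_cov h (real k1 + u1) (real k3 + u3) * fBm_cov h (real k2 + u2) (real k4 + u4)
      + fBm_cov h (real k1 + u1) (real k4 + u4) * fBm_cov h (real k2 + u2) (real k3 + u3))"
    by (simp only: integral_mult_right_zero mom(8) fBm_cov_scale[OF s]) (simp add: power2_eq_square algebra_simps)
  finally show "(LINT \<omega>|M. rescaled s h X k1 u1 \<omega> * rescaled s h X k2 u2 \<omega> * rescaled s h X k3 u3 \<omega> * rescaled s h X k4 u4 \<omega>) =
      fBm_cov h (real k1 + u1) (real k2 + u2) * fBm_cov h (real k3 + u3) (real k4 + u4)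
      + fBm_cov h (real k1 + u1) (real k3 + u3) * fBm_cov h (real k2 + u2) (real k4 + u4)
      + fBm_cov h (real k1 + u1) (real k4 + u4) * fBm_cov h (real k2 + u2) (real k3 + u3)"
    unfolding c4 by simp
  show "L4_process (3 * ((real N + R) powr (2 * h))\<^sup>2) (rescaled s h X k)" if k: "k \<le> N"
    unfolding L4_process_def
  proof (intro conjI allI impI)
    have "(\<lambda>z. X (s * (real k + fst z)) (snd z)) \<in> borel_measurable (borel \<Otimes>\<^sub>M M)"
      using measurable_compose[of "\<lambda>z. (s * (real k + fst z), snd z)" "borel \<Otimes>\<^sub>M M" "lborel \<Otimes>\<^sub>M M", OF _ Xm]
      by (simp add: split_beta')
    then show "(\<lambda>(u, \<omega>). rescaled s h X k u \<omega>) \<in> borel_measurable (borel \<Otimes>\<^sub>M M)"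
      unfolding rescaled_def split_beta' by (intro borel_measurable_times) auto
    fix u assume u: "\<bar>u\<bar> \<le> R"
    let ?t = "s * (real k + u)"
    have eq: "(\<lambda>\<omega>. rescaled s h X k u \<omega> ^ 4) = (\<lambda>\<omega>. ?c ^ 4 * X ?t \<omega> ^ 4)"
      by (auto simp: rescaled_def power_mult_distrib)
    have "(LINT \<omega>|M. rescaled s h X k u \<omega> ^ 4) = (?c ^ 4 * (s powr (2 * h))\<^sup>2) * (3 * (fBm_cov h (real k + u) (real k + u))\<^sup>2)"
      unfolding eq by (simp only: integral_mult_right_zero mom(7) fBm_cov_scale[OF s]) (simp add: power_mult_distrib)
    also have "\<dots> = 3 * (\<bar>real k + u\<bar> powr (2 * h))\<^sup>2" unfolding c4 by (simp add: fBm_cov_def)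
    also have "\<dots> \<le> 3 * ((real N + R) powr (2 * h))\<^sup>2"
      using u k h by (intro mult_left_mono power_mono powr_mono2) auto
    finally have le: "(LINT \<omega>|M. rescaled s h X k u \<omega> ^ 4) \<le> 3 * ((real N + R) powr (2 * h))\<^sup>2" .
    have "integrable M (\<lambda>\<omega>. rescaled s h X k u \<omega> ^ 4)" unfolding eq using mom(3)[of ?t] by simp
    moreover have "rescaled s h X k u \<in> borel_measurable M"
      using mom(1)[of ?t] unfolding rescaled_def[abs_def] by simp
    ultimately show "L4_bounded M (3 * ((real N + R) powr (2 * h))\<^sup>2) (rescaled s h X k u)"
      using le by (simp add: L4_bounded_def)
  qed
qed

end

section \<open>Concentration of the Gram matrix\<close>

lemma second_moment_of_average:
  fixes z :: "nat \<Rightarrow> 'a \<Rightarrow> real"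
  assumes i: "\<And>k k'. k \<in> {1..N} \<Longrightarrow> k' \<in> {1..N} \<Longrightarrow> integrable M (\<lambda>\<omega>. z k \<omega> * z k' \<omega>)"
  shows "integrable M (\<lambda>\<omega>. ((\<Sum>k=1..N. z k \<omega>) / real N)\<^sup>2)"
    and "(LINT \<omega>|M. ((\<Sum>k=1..N. z k \<omega>) / real N)\<^sup>2) = (\<Sum>k=1..N. \<Sum>k'=1..N. (LINT \<omega>|M. z k \<omega> * z k' \<omega>)) / (real N)\<^sup>2"
proof -
  have eq: "((\<Sum>k=1..N. z k \<omega>) / real N)\<^sup>2 = (\<Sum>k=1..N. \<Sum>k'=1..N. z k \<omega> * z k' \<omega>) / (real N)\<^sup>2" for \<omega>
    by (simp add: power_divide power2_eq_square[of "sum _ _"] sum_product)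
  show "integrable M (\<lambda>\<omega>. ((\<Sum>k=1..N. z k \<omega>) / real N)\<^sup>2)"
    unfolding eq using i by (intro integrable_divide Bochner_Integration.integrable_sum) auto
  have "(LINT \<omega>|M. (\<Sum>k=1..N. \<Sum>k'=1..N. z k \<omega> * z k' \<omega>)) = (\<Sum>k=1..N. (LINT \<omega>|M. (\<Sum>k'=1..N. z k \<omega> * z k' \<omega>)))"
    using i by (intro Bochner_Integration.integral_sum Bochner_Integration.integrable_sum) auto
  also have "\<dots> = (\<Sum>k=1..N. \<Sum>k'=1..N. (LINT \<omega>|M. z k \<omega> * z k' \<omega>))"
    using i by (intro sum.cong refl Bochner_Integration.integral_sum) auto
  finally show "(LINT \<omega>|M. ((\<Sum>k=1..N. z k \<omega>) / real N)\<^sup>2) = (\<Sum>k=1..N. \<Sum>k'=1..N. (LINT \<omega>|M. z k \<omega> * z k' \<omega>)) / (real N)\<^sup>2"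
    unfolding eq by simp
qed

context wavelet_process begin

text \<open>
  Wick's formula with the pairs \<open>(k, k)\<close>, \<open>(k', k')\<close> once and \<open>(k, k')\<close> twice; the first pairing is the square of the
  variance.
\<close>

lemma
  assumes X: "standard_fBm M h X" and h: "0 < h" "h < 1" and s: "0 < s"
    and Xm: "(\<lambda>(t, \<omega>). X t \<omega>) \<in> borel_measurable (lborel \<Otimes>\<^sub>M M)"
  defines "w \<equiv> \<lambda>k. wint (rescaled s h X k)"
  shows wint_fBm_cov: "(LINT \<omega>|M. w k \<omega> * w k' \<omega>) = wavelet_cov \<psi> h (real k - real k')"
    and wint_fBm_cov_integrable: "integrable M (\<lambda>\<omega>. w k \<omega> * w k' \<omega>)"
    and wint_fBm_fourth: "(LINT \<omega>|M. w k \<omega> * w k \<omega> * w k' \<omega> * w k' \<omega>)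
      = (wavelet_cov \<psi> h 0)\<^sup>2 + 2 * (wavelet_cov \<psi> h (real k - real k'))\<^sup>2"
    and wint_fBm_fourth_integrable: "integrable M (\<lambda>\<omega>. w k \<omega> * w k \<omega> * w k' \<omega> * w k' \<omega>)"
proof -
  let ?V = "rescaled s h X"
  let ?C = "3 * ((real (max k k') + R) powr (2 * h))\<^sup>2"
  note fb = rescaled_fBm[OF X h(1) s Xm]
  have V: "L4_process ?C (?V k)" "L4_process ?C (?V k')" by (intro fb(2); simp)+
  note tk = tame_kernel_fBm_cov[OF h(1)]
  show "(LINT \<omega>|M. w k \<omega> * w k' \<omega>) = wavelet_cov \<psi> h (real k - real k')"
    unfolding w_def wint_second_moment(1)[OF V] fb(1) by (rule avg_fBm_cov[OF h(1)])
  show "integrable M (\<lambda>\<omega>. w k \<omega> * w k' \<omega>)"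
    unfolding w_def by (rule wint_second_moment(2)[OF V])
  show "integrable M (\<lambda>\<omega>. w k \<omega> * w k \<omega> * w k' \<omega> * w k' \<omega>)"
    unfolding w_def by (rule wint_fourth_moment(2)[OF V(1) V(1) V(2) V(2)])
  have "(LINT \<omega>|M. w k \<omega> * w k \<omega> * w k' \<omega> * w k' \<omega>) =
     avg (\<lambda>u. avg (\<lambda>v. fBm_cov h (real k + u) (real k + v))) * avg (\<lambda>u. avg (\<lambda>v. fBm_cov h (real k' + u) (real k' + v)))
    + avg (\<lambda>u. avg (\<lambda>v. fBm_cov h (real k + u) (real k' + v))) * avg (\<lambda>u. avg (\<lambda>v. fBm_cov h (real k + u) (real k' + v)))
    + avg (\<lambda>u. avg (\<lambda>v. fBm_cov h (real k + u) (real k' + v))) * avg (\<lambda>u. avg (\<lambda>v. fBm_cov h (real k + u) (real k' + v)))"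
    unfolding w_def by (rule wint_wick[OF V(1) V(1) V(2) V(2) tk tk tk tk tk tk fb(3)])
  then show "(LINT \<omega>|M. w k \<omega> * w k \<omega> * w k' \<omega> * w k' \<omega>)
      = (wavelet_cov \<psi> h 0)\<^sup>2 + 2 * (wavelet_cov \<psi> h (real k - real k'))\<^sup>2"
    unfolding avg_fBm_cov[OF h(1)] by (simp add: power2_eq_square)
qed

text \<open>
  For two independent processes the only surviving pairing is the one that does not mix them. The
  formula is again an instance of Wick's, with zero kernels for the mixed covariances.
\<close>

lemma
  fixes X :: "nat \<Rightarrow> real \<Rightarrow> 'a \<Rightarrow> real"
  assumes X: "\<And>i. i < p \<Longrightarrow> standard_fBm M (h i) (X i)" and h: "\<And>i. i < p \<Longrightarrow> 0 < h i" and s: "0 < s"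
    and Xm: "\<And>i. i < p \<Longrightarrow> (\<lambda>(t, \<omega>). X i t \<omega>) \<in> borel_measurable (lborel \<Otimes>\<^sub>M M)"
    and indep: "indep_vars (\<lambda>_. Pi\<^sub>M UNIV (\<lambda>_. borel)) (\<lambda>i \<omega> t. X i t \<omega>) {..<p}"
    and lm: "l < p" "m < p" "l \<noteq> m"
  defines "w \<equiv> \<lambda>i k. wint (rescaled s (h i) (X i) k)"
  shows wint_indep_fourth: "(LINT \<omega>|M. w l k \<omega> * w m k \<omega> * w l k' \<omega> * w m k' \<omega>)
      = wavelet_cov \<psi> (h l) (real k - real k') * wavelet_cov \<psi> (h m) (real k - real k')"
    and wint_indep_fourth_integrable: "integrable M (\<lambda>\<omega>. w l k \<omega> * w m k \<omega> * w l k' \<omega> * w m k' \<omega>)"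
proof -
  let ?V = "\<lambda>i. rescaled s (h i) (X i)"
  define C where "C = max (3 * ((real (max k k') + R) powr (2 * h l))\<^sup>2) (3 * ((real (max k k') + R) powr (2 * h m))\<^sup>2)"
  note fl = rescaled_fBm[OF X[OF lm(1)] h[OF lm(1)] s Xm[OF lm(1)]]
  note fm = rescaled_fBm[OF X[OF lm(2)] h[OF lm(2)] s Xm[OF lm(2)]]
  have V: "L4_process C (?V l k)" "L4_process C (?V m k)" "L4_process C (?V l k')" "L4_process C (?V m k')"
    unfolding C_def
    by (rule L4_process_mono[OF fl(2)[of _ "max k k'"]] L4_process_mono[OF fm(2)[of _ "max k k'"]]; simp)+
  note momX = standard_fBm_moments[OF prob_space_axioms X]
  have split: "(LINT \<omega>|M. ?V l k u1 \<omega> * ?V m k u2 \<omega> * ?V l k' u3 \<omega> * ?V m k' u4 \<omega>)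
      = (LINT \<omega>|M. ?V l k u1 \<omega> * ?V l k' u3 \<omega>) * (LINT \<omega>|M. ?V m k u2 \<omega> * ?V m k' u4 \<omega>)" for u1 u2 u3 u4
  proof -
    define a where "a i = (if i = l then s * (real k + u1) else s * (real k + u2))" for i
    define b where "b i = (if i = l then s * (real k' + u3) else s * (real k' + u4))" for i
    define Z where "Z i \<omega> = (s powr (- h i) * X i (a i) \<omega>) * (s powr (- h i) * X i (b i) \<omega>)" for i \<omega>
    have "indep_vars (\<lambda>_. borel) (\<lambda>i \<omega>. (\<lambda>x. (s powr (- h i) * x (a i)) * (s powr (- h i) * x (b i))) (\<lambda>t. X i t \<omega>)) {..<p}"
      by (rule indep_vars_compose2[OF indep]) measurable
    then have "indep_vars (\<lambda>_. borel) Z {..<p}" unfolding Z_def by simp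
    then have ind: "indep_vars (\<lambda>_. borel) Z {l, m}" by (rule indep_vars_subset) (use lm in auto)
    have iZ: "integrable M (Z i)" if "i \<in> {l, m}" for i
    proof -
      have "i < p" using that lm by auto
      then have "integrable M (\<lambda>\<omega>. X i (a i) \<omega> * X i (b i) \<omega>)"
        by (intro integrable_product_of_squares momX)
      then have "integrable M (\<lambda>\<omega>. s powr (- h i) * s powr (- h i) * (X i (a i) \<omega> * X i (b i) \<omega>))" by simp
      then show ?thesis unfolding Z_def[abs_def] by (simp add: mult_ac)
    qed
    have "(LINT \<omega>|M. (\<Prod>i\<in>{l, m}. Z i \<omega>)) = (\<Prod>i\<in>{l, m}. (LINT \<omega>|M. Z i \<omega>))"
      by (rule indep_vars_lebesgue_integral[OF _ ind iZ]) auto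
    then have "(LINT \<omega>|M. Z l \<omega> * Z m \<omega>) = (LINT \<omega>|M. Z l \<omega>) * (LINT \<omega>|M. Z m \<omega>)"
      using lm(3) by simp
    moreover have "Z l \<omega> = ?V l k u1 \<omega> * ?V l k' u3 \<omega>" "Z m \<omega> = ?V m k u2 \<omega> * ?V m k' u4 \<omega>" for \<omega>
      using lm(3) by (simp_all add: Z_def a_def b_def rescaled_def)
    ultimately show ?thesis by (simp add: mult_ac)
  qed
  have t0: "tame_kernel (\<lambda>u v. 0)" unfolding tame_kernel_def by auto
  note tl = tame_kernel_fBm_cov[OF h[OF lm(1)]] and tm = tame_kernel_fBm_cov[OF h[OF lm(2)]]
  show "integrable M (\<lambda>\<omega>. w l k \<omega> * w m k \<omega> * w l k' \<omega> * w m k' \<omega>)"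
    unfolding w_def by (rule wint_fourth_moment(2)[OF V])
  have "(LINT \<omega>|M. w l k \<omega> * w m k \<omega> * w l k' \<omega> * w m k' \<omega>) =
     avg (\<lambda>u. avg (\<lambda>v. 0)) * avg (\<lambda>u. avg (\<lambda>v. 0))
    + avg (\<lambda>u. avg (\<lambda>v. fBm_cov (h l) (real k + u) (real k' + v))) * avg (\<lambda>u. avg (\<lambda>v. fBm_cov (h m) (real k + u) (real k' + v)))
    + avg (\<lambda>u. avg (\<lambda>v. 0)) * avg (\<lambda>u. avg (\<lambda>v. 0))"
    unfolding w_def
    by (rule wint_wick[OF V t0 t0 tl tm t0 t0]) (simp add: split fl(1) fm(1))
  then show "(LINT \<omega>|M. w l k \<omega> * w m k \<omega> * w l k' \<omega> * w m k' \<omega>)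
      = wavelet_cov \<psi> (h l) (real k - real k') * wavelet_cov \<psi> (h m) (real k - real k')"
    unfolding avg_fBm_cov[OF h[OF lm(1)]] avg_fBm_cov[OF h[OF lm(2)]] by (simp add: avg_def)
qed

text \<open>
  Every entry of the Gram matrix of the normalized coefficients has variance \<open>O(1/N)\<close>, so the expected
  squared Frobenius distance to its mean, the diagonal matrix of the variances, is \<open>O(p\<^sup>2/N)\<close>. Markov's
  inequality concludes.
\<close>

lemma gram_concentration:
  fixes X :: "nat \<Rightarrow> real \<Rightarrow> 'a \<Rightarrow> real"
  assumes X: "\<And>i. i < p \<Longrightarrow> standard_fBm M (h i) (X i)"
    and h: "\<And>i. i < p \<Longrightarrow> 0 < h i" "\<And>i. i < p \<Longrightarrow> h i < 1" and s: "0 < s"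
    and Xm: "\<And>i. i < p \<Longrightarrow> (\<lambda>(t, \<omega>). X i t \<omega>) \<in> borel_measurable (lborel \<Otimes>\<^sub>M M)"
    and indep: "indep_vars (\<lambda>_. Pi\<^sub>M UNIV (\<lambda>_. borel)) (\<lambda>i \<omega> t. X i t \<omega>) {..<p}"
    and N: "1 \<le> N" and \<kappa>: "0 < \<kappa>"
  defines "w \<equiv> \<lambda>i k. wint (rescaled s (h i) (X i) k)"
  defines "D \<equiv> \<lambda>l m \<omega>. (\<Sum>k=1..N. w l k \<omega> * w m k \<omega>) / real N - (if l = m then wavelet_cov \<psi> (h l) 0 else 0)"
  shows "measure M {\<omega> \<in> space M. \<kappa> \<le> (\<Sum>l<p. \<Sum>m<p. (D l m \<omega>)\<^sup>2)} \<le> (real p)\<^sup>2 * (8 * cov_bound\<^sup>2 / real N) / \<kappa>"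
    and "{\<omega> \<in> space M. \<kappa> \<le> (\<Sum>l<p. \<Sum>m<p. (D l m \<omega>)\<^sup>2)} \<in> sets M"
proof -
  have var: "integrable M (\<lambda>\<omega>. (D l m \<omega>)\<^sup>2)" "(LINT \<omega>|M. (D l m \<omega>)\<^sup>2) \<le> 8 * cov_bound\<^sup>2 / real N"
    if lm: "l < p" "m < p" for l m
  proof -
    define c where "c = (if l = m then wavelet_cov \<psi> (h l) 0 else 0)"
    \<comment> \<open>centring the summands turns the diagonal entries into averages of variables of mean zero\<close>
    define z where "z k \<omega> = w l k \<omega> * w m k \<omega> - c" for k \<omega>
    have D: "D l m \<omega> = (\<Sum>k=1..N. z k \<omega>) / real N" for \<omega>
      using N by (simp add: D_def c_def[symmetric] z_def sum_subtractf diff_divide_distrib)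
    have zz: "integrable M (\<lambda>\<omega>. z k \<omega> * z k' \<omega>) \<and> (LINT \<omega>|M. z k \<omega> * z k' \<omega>)
       = (if l = m then 2 else 1) * (wavelet_cov \<psi> (h l) (real k - real k') * wavelet_cov \<psi> (h m) (real k - real k'))" for k k'
    proof (cases "l = m")
      case True
      note mom = wint_fBm_cov[OF X h s Xm, OF lm(1) lm(1) lm(1) lm(1), folded w_def]
        wint_fBm_cov_integrable[OF X h s Xm, OF lm(1) lm(1) lm(1) lm(1), folded w_def]
        wint_fBm_fourth[OF X h s Xm, OF lm(1) lm(1) lm(1) lm(1), folded w_def]
        wint_fBm_fourth_integrable[OF X h s Xm, OF lm(1) lm(1) lm(1) lm(1), folded w_def]
      have eq: "(\<lambda>\<omega>. z k \<omega> * z k' \<omega>) = (\<lambda>\<omega>. w l k \<omega> * w l k \<omega> * w l k' \<omega> * w l k' \<omega>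
          - c * (w l k \<omega> * w l k \<omega>) - c * (w l k' \<omega> * w l k' \<omega>) + c\<^sup>2)"
        using True by (auto simp: z_def power2_eq_square algebra_simps)
      show ?thesis unfolding eq using mom True
        by (simp add: w_def c_def prob_space) (simp add: power2_eq_square)
    next
      case False
      then have eq: "(\<lambda>\<omega>. z k \<omega> * z k' \<omega>) = (\<lambda>\<omega>. w l k \<omega> * w m k \<omega> * w l k' \<omega> * w m k' \<omega>)"
        by (simp add: z_def c_def mult_ac)
      show ?thesis unfolding eq w_def
        using wint_indep_fourth[OF X h(1) s Xm indep lm False] wint_indep_fourth_integrable[OF X h(1) s Xm indep lm False] False
        by simp
    qed
    show "integrable M (\<lambda>\<omega>. (D l m \<omega>)\<^sup>2)" unfolding D by (rule second_moment_of_average) (use zz in blast)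
    have "(LINT \<omega>|M. (D l m \<omega>)\<^sup>2) = (\<Sum>k=1..N. \<Sum>k'=1..N. (LINT \<omega>|M. z k \<omega> * z k' \<omega>)) / (real N)\<^sup>2"
      unfolding D by (rule second_moment_of_average) (use zz in blast)
    also have "\<dots> = (if l = m then 2 else 1) * (\<Sum>k=1..N. \<Sum>k'=1..N. wavelet_cov \<psi> (h l) (real k - real k') * wavelet_cov \<psi> (h m) (real k - real k')) / (real N)\<^sup>2"
      by (simp only: zz sum_distrib_left)
    also have "\<dots> \<le> 2 * (4 * cov_bound\<^sup>2 * real N) / (real N)\<^sup>2"
    proof (intro divide_right_mono)
      let ?S = "\<Sum>k=1..N. \<Sum>k'=1..N. wavelet_cov \<psi> (h l) (real k - real k') * wavelet_cov \<psi> (h m) (real k - real k')"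
      have "?S \<le> 4 * cov_bound\<^sup>2 * real N"
        using lm by (intro sum_wavelet_cov_product_le h)
      moreover have "0 \<le> 4 * cov_bound\<^sup>2 * real N" by simp
      moreover have "(if l = m then 2 else 1) * x \<le> 2 * y" if "x \<le> y" "0 \<le> y" for x y :: real
        using that by auto
      ultimately show "(if l = m then 2 else 1) * ?S \<le> 2 * (4 * cov_bound\<^sup>2 * real N)" by blast
    qed simp
    also have "\<dots> = 8 * cov_bound\<^sup>2 / real N" using N by (simp add: power2_eq_square)
    finally show "(LINT \<omega>|M. (D l m \<omega>)\<^sup>2) \<le> 8 * cov_bound\<^sup>2 / real N" .
  qed
  let ?F = "\<lambda>\<omega>. \<Sum>l<p. \<Sum>m<p. (D l m \<omega>)\<^sup>2"
  have iF: "integrable M ?F" using var(1) by (intro Bochner_Integration.integrable_sum) auto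
  have EF: "(LINT \<omega>|M. ?F \<omega>) \<le> (real p)\<^sup>2 * (8 * cov_bound\<^sup>2 / real N)"
  proof -
    have "(LINT \<omega>|M. ?F \<omega>) = (\<Sum>l<p. (LINT \<omega>|M. (\<Sum>m<p. (D l m \<omega>)\<^sup>2)))"
      using var(1) by (intro Bochner_Integration.integral_sum Bochner_Integration.integrable_sum) auto
    also have "\<dots> = (\<Sum>l<p. \<Sum>m<p. (LINT \<omega>|M. (D l m \<omega>)\<^sup>2))"
      using var(1) by (intro sum.cong refl Bochner_Integration.integral_sum) auto
    also have "\<dots> \<le> (\<Sum>l<p. \<Sum>m<p. 8 * cov_bound\<^sup>2 / real N)" using var(2) by (intro sum_mono) auto
    finally show ?thesis by (simp add: power2_eq_square mult_ac)
  qed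
  have "measure M {\<omega> \<in> space M. \<kappa> \<le> ?F \<omega>} \<le> (LINT \<omega>|M. ?F \<omega>) / \<kappa>"
    by (rule integral_Markov_inequality_measure[OF iF, of "space M"]) (use \<kappa> in \<open>auto intro!: AE_I2 sum_nonneg\<close>)
  also have "\<dots> \<le> (real p)\<^sup>2 * (8 * cov_bound\<^sup>2 / real N) / \<kappa>"
    using EF \<kappa> by (intro divide_right_mono) auto
  finally show "measure M {\<omega> \<in> space M. \<kappa> \<le> ?F \<omega>} \<le> (real p)\<^sup>2 * (8 * cov_bound\<^sup>2 / real N) / \<kappa>" .
  have [measurable]: "?F \<in> borel_measurable M" using iF by auto
  show "{\<omega> \<in> space M. \<kappa> \<le> ?F \<omega>} \<in> sets M" by measurable
qed

end

section \<open>From the Gram matrix to the log-eigenvalues\<close>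

text \<open>
  The operator norm is at most the Frobenius norm.
\<close>

lemma quadratic_form_perturbation:
  fixes z :: "nat \<Rightarrow> real"
  assumes E: "(\<Sum>l<p. \<Sum>m<p. (E l m)\<^sup>2) \<le> \<kappa>\<^sup>2" and \<kappa>: "0 \<le> \<kappa>"
  shows "\<bar>\<Sum>l<p. \<Sum>m<p. z l * z m * E l m\<bar> \<le> \<kappa> * (\<Sum>l<p. (z l)\<^sup>2)"
proof -
  let ?I = "{..<p} \<times> {..<p}"
  have "(\<Sum>(l,m)\<in>?I. (z l * z m) * E l m)\<^sup>2 \<le> (\<Sum>(l,m)\<in>?I. (z l * z m)\<^sup>2) * (\<Sum>(l,m)\<in>?I. (E l m)\<^sup>2)"
    using Cauchy_Schwarz_ineq_sum[of "\<lambda>(l,m). z l * z m" "\<lambda>(l,m). E l m" ?I] by (simp add: split_beta')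
  also have "(\<Sum>(l,m)\<in>?I. (z l * z m)\<^sup>2) = (\<Sum>l<p. (z l)\<^sup>2)\<^sup>2"
    unfolding sum.cartesian_product[symmetric] power2_eq_square[of "sum _ _"] sum_product by (simp add: power_mult_distrib)
  also have "(\<Sum>(l,m)\<in>?I. (E l m)\<^sup>2) = (\<Sum>l<p. \<Sum>m<p. (E l m)\<^sup>2)" by (simp add: sum.cartesian_product)
  also have "(\<Sum>l<p. (z l)\<^sup>2)\<^sup>2 * \<dots> \<le> (\<Sum>l<p. (z l)\<^sup>2)\<^sup>2 * \<kappa>\<^sup>2" by (intro mult_left_mono E) simp
  also have "\<dots> = (\<kappa> * (\<Sum>l<p. (z l)\<^sup>2))\<^sup>2" by (simp add: power_mult_distrib mult.commute)
  finally have "\<bar>\<Sum>(l,m)\<in>?I. (z l * z m) * E l m\<bar> \<le> \<bar>\<kappa> * (\<Sum>l<p. (z l)\<^sup>2)\<bar>" by (simp only: abs_le_square_iff)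
  then show ?thesis using \<kappa> by (simp add: sum.cartesian_product sum_nonneg)
qed

text \<open>
  With \<open>y = P\<^sup>T x\<close> and \<open>z\<^sub>l = s\<^bsup>h l + 1/2\<^esup> y\<^sub>l\<close>, the quadratic form of \<open>W\<close> at \<open>x\<close> is the one of the Gram matrix of \<open>w\<close> at \<open>z\<close>.
  The latter is within \<open>(r0 / 2) |z|\<^sup>2\<close> of a diagonal form with entries between \<open>r0\<close> and \<open>r1\<close>, and \<open>|z|\<^sup>2\<close> is the
  diagonal form \<open>\<Sum>l. s\<^bsup>2 h l + 1\<^esup> y\<^sub>l\<^sup>2\<close>; so the comparison of eigenvalues applies. The bijection \<open>f\<close> sorts \<open>h\<close>.
\<close>

lemma wavelet_eigenvalue_bounds:
  fixes P :: "real Matrix.mat" and w c :: "nat \<Rightarrow> nat \<Rightarrow> real" and h r :: "nat \<Rightarrow> real"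
  assumes p: "1 \<le> p" and P: "P \<in> carrier_mat p p" "invertible_mat P" and s: "1 \<le> s" and N: "1 \<le> N"
    and c: "\<And>i k. i < p \<Longrightarrow> c i k = (\<Sum>l<p. P $$ (i,l) * (s powr (h l + 1 / 2) * w l k))"
    and W: "W = Matrix.mat p p (\<lambda>(i, i'). (\<Sum>k=1..N. c i k * c i' k) / real N)"
    and r: "0 < r0" "\<And>l. l < p \<Longrightarrow> r0 \<le> r l" "\<And>l. l < p \<Longrightarrow> r l \<le> r1"
    and gram: "(\<Sum>l<p. \<Sum>m<p. ((\<Sum>k=1..N. w l k * w m k) / real N - (if l = m then r l else 0))\<^sup>2) \<le> (r0 / 2)\<^sup>2"
  obtains f where "bij_betw f {..<p} {..<p}"
    "\<And>i. i < p \<Longrightarrow> r0 / 2 * (ordered_singular_value 1 P)\<^sup>2 * s powr (2 * h (f i) + 1) \<le> ordered_eigenvalue (Suc i) W"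
    "\<And>i. i < p \<Longrightarrow> ordered_eigenvalue (Suc i) W \<le> 2 * r1 * (ordered_singular_value p P)\<^sup>2 * s powr (2 * h (f i) + 1)"
proof -
  obtain f where "f permutes {..<p}" and sorted: "\<And>i. i < p \<Longrightarrow> sort (map h [0..<p]) ! i = h (f i)"
    using sorting_permutation by metis
  then have f: "bij_betw f {..<p} {..<p}" by (simp add: permutes_imp_bij)
  have hf: "h (f i) \<le> h (f j)" if "i \<le> j" "j < p" for i j
  proof -
    have "sort (map h [0..<p]) ! i \<le> sort (map h [0..<p]) ! j"
      using that by (intro sorted_nth_mono) auto
    then show ?thesis using sorted that by simp
  qed
  define d where "d l = s powr (2 * h l + 1)" for l
  have d0: "0 \<le> d l" for l by (simp add: d_def)
  have df: "d (f i) \<le> d (f j)" if "i \<le> j" "j < p" for i j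
    unfolding d_def using hf[OF that] s by (intro powr_mono) auto
  let ?Q = "transpose_mat P"
  have Q: "?Q \<in> carrier_mat p p" using P by simp
  have Wc: "W \<in> carrier_mat p p" by (simp add: W)
  have symW: "transpose_mat W = W" by (rule eq_matI) (auto simp: W mult.commute)
  have r01: "r0 \<le> r1" using r(2)[of 0] r(3)[of 0] p by simp
  define G where "G l m = (\<Sum>k=1..N. w l k * w m k) / real N" for l m
  have form: "r0 / 2 * (\<Sum>l<p. d l * (vec_index (?Q *\<^sub>v x) l)\<^sup>2) \<le> x \<bullet> (W *\<^sub>v x) \<and>
      x \<bullet> (W *\<^sub>v x) \<le> 2 * r1 * (\<Sum>l<p. d l * (vec_index (?Q *\<^sub>v x) l)\<^sup>2)" if x: "x \<in> carrier_vec p" for x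
  proof -
    define y where "y l = vec_index (?Q *\<^sub>v x) l" for l
    define z where "z l = y l * s powr (h l + 1 / 2)" for l
    have y: "y l = (\<Sum>i<p. P $$ (i,l) * vec_index x i)" if "l < p" for l
      using that P x by (simp add: y_def scalar_prod_def lessThan_atLeast0)
    have z2: "(z l)\<^sup>2 = d l * (y l)\<^sup>2" for l
    proof -
      have "(s powr (h l + 1 / 2))\<^sup>2 = s powr (2 * h l + 1)"
        using s by (simp add: power2_eq_square flip: powr_add)
      then show ?thesis by (simp add: z_def d_def power_mult_distrib)
    qed
    have proj: "(\<Sum>i<p. vec_index x i * c i k) = (\<Sum>l<p. z l * w l k)" for k
    proof -
      have "(\<Sum>i<p. vec_index x i * c i k) = (\<Sum>i<p. \<Sum>l<p. vec_index x i * (P $$ (i,l) * (s powr (h l + 1 / 2) * w l k)))"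
        by (simp add: c sum_distrib_left)
      also have "\<dots> = (\<Sum>l<p. \<Sum>i<p. vec_index x i * (P $$ (i,l) * (s powr (h l + 1 / 2) * w l k)))"
        by (rule sum.swap)
      also have "\<dots> = (\<Sum>l<p. z l * w l k)"
        by (intro sum.cong refl) (simp add: z_def y sum_distrib_left sum_distrib_right mult_ac)
      finally show ?thesis .
    qed
    have "x \<bullet> (W *\<^sub>v x) = (\<Sum>i<p. vec_index x i * (\<Sum>i'<p. (\<Sum>k=1..N. c i k * c i' k) / real N * vec_index x i'))"
      using x by (simp add: W scalar_prod_def lessThan_atLeast0)
    also have "\<dots> = (\<Sum>i<p. \<Sum>i'<p. \<Sum>k=1..N. (vec_index x i * c i k) * (vec_index x i' * c i' k)) / real N"
      by (simp add: sum_distrib_left sum_distrib_right sum_divide_distrib mult_ac)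
    also have "\<dots> = (\<Sum>k=1..N. (\<Sum>i<p. vec_index x i * c i k) * (\<Sum>i'<p. vec_index x i' * c i' k)) / real N"
      by (simp only: sum_product sum.swap[of _ "{..<p}" "{1..N}"])
    also have "\<dots> = (\<Sum>k=1..N. \<Sum>l<p. \<Sum>m<p. (z l * w l k) * (z m * w m k)) / real N"
      unfolding proj by (simp only: sum_product)
    also have "(\<Sum>k=1..N. \<Sum>l<p. \<Sum>m<p. (z l * w l k) * (z m * w m k)) = (\<Sum>l<p. \<Sum>k=1..N. \<Sum>m<p. (z l * w l k) * (z m * w m k))"
      by (rule sum.swap)
    also have "\<dots> = (\<Sum>l<p. \<Sum>m<p. \<Sum>k=1..N. (z l * w l k) * (z m * w m k))"
      by (intro sum.cong refl sum.swap)
    also have "\<dots> / real N = (\<Sum>l<p. \<Sum>m<p. z l * z m * G l m)"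
      by (simp add: G_def sum_distrib_left sum_divide_distrib mult_ac)
    also have "\<dots> = (\<Sum>l<p. \<Sum>m<p. z l * z m * (G l m - (if l = m then r l else 0)) + (if m = l then r l * (z l)\<^sup>2 else 0))"
      by (intro sum.cong refl) (auto simp: power2_eq_square algebra_simps)
    also have "\<dots> = (\<Sum>l<p. \<Sum>m<p. z l * z m * (G l m - (if l = m then r l else 0))) + (\<Sum>l<p. r l * (z l)\<^sup>2)"
      by (simp add: sum.distrib)
    finally have eq: "x \<bullet> (W *\<^sub>v x) = \<dots>" .
    have pert: "\<bar>\<Sum>l<p. \<Sum>m<p. z l * z m * (G l m - (if l = m then r l else 0))\<bar> \<le> r0 / 2 * (\<Sum>l<p. (z l)\<^sup>2)"
      by (rule quadratic_form_perturbation) (use gram r(1) in \<open>auto simp: G_def\<close>)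
    have lo: "r0 * (\<Sum>l<p. (z l)\<^sup>2) \<le> (\<Sum>l<p. r l * (z l)\<^sup>2)"
      unfolding sum_distrib_left by (intro sum_mono mult_right_mono) (use r in auto)
    have hi: "(\<Sum>l<p. r l * (z l)\<^sup>2) \<le> r1 * (\<Sum>l<p. (z l)\<^sup>2)"
      unfolding sum_distrib_left by (intro sum_mono mult_right_mono) (use r in auto)
    have "r0 * (\<Sum>l<p. (z l)\<^sup>2) \<le> r1 * (\<Sum>l<p. (z l)\<^sup>2)"
      using r01 by (intro mult_right_mono sum_nonneg) auto
    then show ?thesis using pert lo hi r(1) unfolding eq y_def[symmetric] z2[symmetric]
      by (auto simp: abs_le_iff)
  qed
  have up: "\<And>x. x \<in> carrier_vec p \<Longrightarrow> (?Q *\<^sub>v x) \<bullet> (?Q *\<^sub>v x) \<le> (ordered_singular_value p P)\<^sup>2 * (x \<bullet> x)"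
    and low: "\<And>x. x \<in> carrier_vec p \<Longrightarrow> (ordered_singular_value 1 P)\<^sup>2 * (x \<bullet> x) \<le> (?Q *\<^sub>v x) \<bullet> (?Q *\<^sub>v x)"
    using singular_value_upper[OF P p] singular_value_lower[OF P p] by auto
  have r1: "0 \<le> 2 * r1" "0 \<le> r0 / 2" using r(1) r01 by auto
  note cmp = eigenvalue_comparison[OF Wc symW Q f df d0 zero_le_power2 low up r1(2) conjunct1[OF form] r1(1) conjunct2[OF form]]
  show ?thesis
    by (rule that[OF f]) (use cmp in \<open>simp_all add: d_def\<close>)
qed

text \<open>
  Constant factors, and factors that are powers of \<open>a\<close> with exponents close to zero, disappear on the
  logarithmic scale.
\<close>

lemma log_ratio_bound:
  fixes a s ev \<sigma>1 \<sigma>2 c1 c2 h \<delta> :: real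
  assumes a: "1 < a" and s: "s = a * 2 ^ j" and \<sigma>: "0 < \<sigma>1" "0 < \<sigma>2" and c: "0 < c1" "0 < c2"
    and h: "0 < h" "h < 1"
    and lo: "c1 * \<sigma>1\<^sup>2 * s powr (2 * h + 1) \<le> ev" and hi: "ev \<le> c2 * \<sigma>2\<^sup>2 * s powr (2 * h + 1)"
    and \<delta>: "\<bar>ln \<sigma>1 / ln a\<bar> \<le> \<delta>" "\<bar>ln \<sigma>2 / ln a\<bar> \<le> \<delta>" "(\<bar>ln c1\<bar> + \<bar>ln c2\<bar> + 3 * real j * ln 2) / ln a \<le> \<delta>"
  shows "\<bar>ln ev / ln a - (2 * h + 1)\<bar> \<le> 3 * \<delta>"
proof -
  have la: "0 < ln a" using a by simp
  have s0: "0 < s" using a s by simp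
  have ls: "ln s = ln a + real j * ln 2" using a by (simp add: s ln_mult ln_realpow)
  have e: "ln (c * \<sigma>\<^sup>2 * s powr (2 * h + 1)) = ln c + 2 * ln \<sigma> + (2 * h + 1) * (ln a + real j * ln 2)"
    if "0 < c" "0 < \<sigma>" for c \<sigma>
    using that s0 by (simp add: ln_mult ln_realpow ln_powr ls)
  have j: "0 \<le> (2 * h + 1) * (real j * ln 2)" "(2 * h + 1) * (real j * ln 2) \<le> 3 * (real j * ln 2)"
    using h by (auto intro!: mult_right_mono)
  have "0 < c1 * \<sigma>1\<^sup>2 * s powr (2 * h + 1)" using c \<sigma> s0 by simp
  then have 1: "ln c1 + 2 * ln \<sigma>1 + (2 * h + 1) * (ln a + real j * ln 2) \<le> ln ev"
    using lo unfolding e[OF c(1) \<sigma>(1), symmetric] by (subst ln_le_cancel_iff) auto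
  have 2: "ln ev \<le> ln c2 + 2 * ln \<sigma>2 + (2 * h + 1) * (ln a + real j * ln 2)"
    using hi lo \<open>0 < c1 * \<sigma>1\<^sup>2 * s powr (2 * h + 1)\<close> unfolding e[OF c(2) \<sigma>(2), symmetric] by (subst ln_le_cancel_iff) auto
  have \<delta>': "\<bar>ln \<sigma>1\<bar> \<le> \<delta> * ln a" "\<bar>ln \<sigma>2\<bar> \<le> \<delta> * ln a" "\<bar>ln c1\<bar> + \<bar>ln c2\<bar> + 3 * (real j * ln 2) \<le> \<delta> * ln a"
    using \<delta> la by (simp_all add: field_simps)
  define J where "J = real j * ln 2"
  define K where "K = (2 * h + 1) * ln a"
  define T where "T = \<delta> * ln a"
  have J: "0 \<le> (2 * h + 1) * J" "(2 * h + 1) * J \<le> 3 * J" using j by (auto simp: J_def)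
  have J0: "0 \<le> J" by (simp add: J_def)
  have b1: "- T \<le> ln \<sigma>1" "ln \<sigma>2 \<le> T" using abs_le_D2[OF \<delta>'(1)] abs_le_D1[OF \<delta>'(2)] unfolding T_def by linarith+
  have c3: "\<bar>ln c1\<bar> + \<bar>ln c2\<bar> + 3 * J \<le> T" using \<delta>'(3) by (simp only: T_def J_def)
  have b3: "- ln c1 \<le> T" using c3 J0 by linarith
  have b4: "ln c2 + 3 * J \<le> T" using c3 by linarith
  have "ln c1 + 2 * ln \<sigma>1 + (K + (2 * h + 1) * J) \<le> ln ev" "ln ev \<le> ln c2 + 2 * ln \<sigma>2 + (K + (2 * h + 1) * J)"
    using 1 2 unfolding J_def K_def by (simp_all only: distrib_left)
  then have "\<bar>ln ev - K\<bar> \<le> 3 * T" using b1 b3 b4 J by (intro abs_leI) linarith+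
  then have "\<bar>ln ev - (2 * h + 1) * ln a\<bar> \<le> 3 * (\<delta> * ln a)" by (simp only: K_def T_def)
  then have "\<bar>ln ev - (2 * h + 1) * ln a\<bar> / ln a \<le> 3 * \<delta>" using la by (simp add: field_simps)
  also have "\<bar>ln ev - (2 * h + 1) * ln a\<bar> / ln a = \<bar>(ln ev - (2 * h + 1) * ln a) / ln a\<bar>"
    unfolding abs_divide using la by (simp only: abs_of_pos)
  also have "(ln ev - (2 * h + 1) * ln a) / ln a = ln ev / ln a - (2 * h + 1)"
    unfolding diff_divide_distrib using la by simp
  finally show ?thesis .
qed

lemma log_esd_integral:
  fixes g :: "real \<Rightarrow> real"
  assumes "W \<in> carrier_mat p p" "1 \<le> p" "g \<in> borel_measurable borel"
  shows "(LINT \<upsilon>|log_esd a W. g \<upsilon>) = (\<Sum>i<p. g (ln (ordered_eigenvalue (Suc i) W) / ln a)) / real p"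
proof -
  have "(LINT \<upsilon>|log_esd a W. g \<upsilon>) = (LINT l|uniform_count_measure {1..p}. g (ln (ordered_eigenvalue l W) / ln a))"
    unfolding log_esd_def using assms
    by (subst integral_distr) (auto simp: measurable_def space_uniform_count_measure sets_uniform_count_measure)
  also have "\<dots> = (\<Sum>l\<in>{1..p}. g (ln (ordered_eigenvalue l W) / ln a)) / real p"
    by (subst integral_uniform_count_measure) auto
  also have "(\<Sum>l\<in>{1..p}. g (ln (ordered_eigenvalue l W) / ln a)) = (\<Sum>i<p. g (ln (ordered_eigenvalue (Suc i) W) / ln a))"
    by (simp add: lessThan_atLeast0 sum.atLeast_Suc_atMost_Suc_shift sum.atLeast1_atMost_eq)
  finally show ?thesis .
qed

text \<open>
  The substitution \<open>t = s (k + u)\<close>, done along each path.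
\<close>

lemma wavelet_coeff_rescaled:
  fixes \<psi> :: "real \<Rightarrow> real" and X :: "nat \<Rightarrow> real \<Rightarrow> 'a \<Rightarrow> real"
  assumes s: "0 < s" and i: "i < p" and P: "P \<in> carrier_mat p p"
    and int: "\<And>l. l < p \<Longrightarrow> integrable lborel (\<lambda>u. \<psi> u * rescaled s (h l) (X l) k u \<omega>)"
  shows "vec_index (wavelet_coeff \<psi> s p (\<lambda>t. P *\<^sub>v Matrix.vec p (\<lambda>l. X l t \<omega>)) (int k)) i
    = (\<Sum>l<p. P $$ (i,l) * (s powr (h l + 1 / 2) * (LINT u|lborel. \<psi> u * rescaled s (h l) (X l) k u \<omega>)))"
proof -
  have subst: "\<psi> ((s * real k + s * u) / s - real k) * X l (s * real k + s * u) \<omega> = s powr h l * (\<psi> u * rescaled s (h l) (X l) k u \<omega>)" for l u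
  proof -
    have "(s * real k + s * u) / s - real k = u" using s by (simp add: field_simps)
    moreover have "s * (real k + u) = s * real k + s * u" by (simp add: distrib_left)
    moreover have "s powr h l * s powr (- h l) = 1" using s by (simp flip: powr_add)
    then have "s powr h l * (\<psi> u * (s powr (- h l) * y)) = \<psi> u * y" for y by (simp add: mult.left_commute mult.assoc[symmetric])
    ultimately show ?thesis unfolding rescaled_def by simp
  qed
  have i1: "integrable lborel (\<lambda>t. \<psi> (t / s - real k) * X l t \<omega>)" if "l < p" for l
  proof -
    have "integrable lborel (\<lambda>u. \<psi> ((s * real k + s * u) / s - real k) * X l (s * real k + s * u) \<omega>)"
      unfolding subst using int[OF that] by simp
    then show ?thesis
      using lborel_integrable_real_affine_iff[of s "\<lambda>t. \<psi> (t / s - real k) * X l t \<omega>" "s * real k"] s by simp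
  qed
  have I: "(LINT t|lborel. \<psi> (t / s - real k) * X l t \<omega>) = s * s powr h l * (LINT u|lborel. \<psi> u * rescaled s (h l) (X l) k u \<omega>)" for l
    using lborel_integral_real_affine[of s "\<lambda>t. \<psi> (t / s - real k) * X l t \<omega>" "s * real k"] s
    unfolding subst by simp
  have pw: "s powr (- 1 / 2) * (s * s powr h) = s powr (h + 1 / 2)" for h
  proof -
    have "s powr (- 1 / 2) * (s powr 1 * s powr h) = s powr (- 1 / 2 + (1 + h))" by (simp only: powr_add)
    then show ?thesis using s by (simp add: add.commute)
  qed
  have "(LINT t|lborel. \<psi> (t / s - real k) * vec_index (P *\<^sub>v Matrix.vec p (\<lambda>l. X l t \<omega>)) i)
    = (LINT t|lborel. (\<Sum>l<p. P $$ (i,l) * (\<psi> (t / s - real k) * X l t \<omega>)))"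
    using i P by (simp add: scalar_prod_def lessThan_atLeast0 sum_distrib_left mult_ac)
  also have "\<dots> = (\<Sum>l<p. P $$ (i,l) * (LINT t|lborel. \<psi> (t / s - real k) * X l t \<omega>))"
    using i1 by (subst Bochner_Integration.integral_sum) auto
  finally have "vec_index (wavelet_coeff \<psi> s p (\<lambda>t. P *\<^sub>v Matrix.vec p (\<lambda>l. X l t \<omega>)) (int k)) i
    = s powr (- 1 / 2) * (\<Sum>l<p. P $$ (i,l) * (LINT t|lborel. \<psi> (t / s - real k) * X l t \<omega>))"
    using i by (simp add: wavelet_coeff_def)
  also have "\<dots> = (\<Sum>l<p. P $$ (i,l) * (s powr (- 1 / 2) * (s * s powr h l) * (LINT u|lborel. \<psi> u * rescaled s (h l) (X l) k u \<omega>)))"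
    unfolding I by (simp add: sum_distrib_left mult_ac)
  finally show ?thesis unfolding pw by simp
qed

section \<open>Conditioning on the Hurst exponents\<close>

text \<open>
  The exponents have finitely many values, so that the sample space is, up to a null event, a finite
  disjoint union of the events \<open>E h\<close> on which they take the values \<open>h\<close>. On each of positive probability the
  concentration inequality holds conditionally, with a bound that does not depend on \<open>h\<close>; the exceptional
  events are put together.
\<close>

lemma (in compact_wavelet) conditional_gram_concentration:
  fixes M :: "'a measure" and H :: "nat \<Rightarrow> 'a \<Rightarrow> real" and X :: "nat \<Rightarrow> real \<Rightarrow> 'a \<Rightarrow> real"
  assumes M: "prob_space M" and Hs: "finite Hs" "Hs \<subseteq> {0<..<1}"
    and Hm [measurable]: "\<And>l. l < p \<Longrightarrow> H l \<in> borel_measurable M"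
    and HHs: "\<And>l. l < p \<Longrightarrow> AE \<omega> in M. H l \<omega> \<in> Hs"
    and paths: "rH_fBm_paths M p H X"
    and Xm: "\<And>l. l < p \<Longrightarrow> (\<lambda>(t, \<omega>). X l t \<omega>) \<in> borel_measurable (lborel \<Otimes>\<^sub>M M)"
    and s: "0 < s" and N: "1 \<le> N" and \<kappa>: "0 < \<kappa>"
  defines "w \<equiv> \<lambda>h l k \<omega>. LINT u|lborel. \<psi> u * rescaled s (h l) (X l) k u \<omega>"
  defines "dev \<equiv> \<lambda>h \<omega>. \<Sum>l<p. \<Sum>m<p. ((\<Sum>k=1..N. w h l k \<omega> * w h m k \<omega>) / real N
      - (if l = m then wavelet_cov \<psi> (h l) 0 else 0))\<^sup>2"
  obtains B where "B \<in> sets M" "measure M B \<le> (real p)\<^sup>2 * (8 * cov_bound\<^sup>2 / real N) / \<kappa>"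
    "\<And>\<omega>. \<omega> \<in> space M - B \<Longrightarrow> (\<forall>l<p. H l \<omega> \<in> Hs)
       \<and> (\<forall>l<p. \<forall>k\<in>{1..N}. integrable lborel (\<lambda>u. \<psi> u * rescaled s (H l \<omega>) (X l) k u \<omega>))
       \<and> dev (\<lambda>l. H l \<omega>) \<omega> < \<kappa>"
proof -
  interpret prob_space M by fact
  define q where "q = (real p)\<^sup>2 * (8 * cov_bound\<^sup>2 / real N) / \<kappa>"
  define good where "good h \<omega> \<longleftrightarrow> (\<forall>l<p. \<forall>k\<in>{1..N}. integrable lborel (\<lambda>u. \<psi> u * rescaled s (h l) (X l) k u \<omega>))
      \<and> dev h \<omega> < \<kappa>" for h \<omega>
  define E where "E h = {\<omega> \<in> space M. \<forall>l<p. H l \<omega> = h l}" for h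
  define Hf where "Hf = PiE {..<p} (\<lambda>_. Hs)"
  have finHf: "finite Hf" unfolding Hf_def by (intro finite_PiE) (use Hs in auto)
  have q0: "0 \<le> q" using \<kappa> by (simp add: q_def)
  have E: "E h \<in> sets M" for h
  proof -
    have "E h = {\<omega> \<in> space M. \<forall>l\<in>{..<p}. H l \<omega> = h l}" by (auto simp: E_def)
    also have "\<dots> \<in> sets M" by measurable
    finally show ?thesis .
  qed
  have "\<exists>B. B \<in> sets M \<and> measure M (E h \<inter> B) \<le> measure M (E h) * q \<and> (\<forall>\<omega>\<in>E h - B. good h \<omega>)" if h: "h \<in> Hf" for h
  proof (cases "measure M (E h) = 0")
    case True
    then show ?thesis using E[of h] by (intro exI[of _ "E h"]) auto
  next
    case False
    then have pos: "0 < measure M (E h)" by (simp add: zero_less_measure_iff)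
    \<comment> \<open>the conditional probability given \<open>E h\<close>\<close>
    define U where "U = uniform_measure M (E h)"
    have e0: "emeasure M (E h) \<noteq> 0" using pos by (simp add: emeasure_eq_measure)
    have U: "prob_space U" unfolding U_def using e0 by (intro prob_space_uniform_measure) auto
    have setsU: "sets U = sets M" by (simp add: U_def)
    have spaceU: "space U = space M" by (simp add: U_def)
    interpret U: wavelet_process \<psi> R U by (intro wavelet_process.intro U compact_wavelet_axioms)
    have hb: "0 < h l" "h l < 1" if "l < p" for l using h that Hs unfolding Hf_def by (auto dest!: PiE_mem)
    have cond: "(\<forall>l<p. standard_fBm U (h l) (X l)) \<and>
        U.indep_vars (\<lambda>_. Pi\<^sub>M UNIV (\<lambda>_. borel)) (\<lambda>l \<omega> t. X l t \<omega>) {..<p}"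
      unfolding U_def by (rule paths[unfolded rH_fBm_paths_def, rule_format]) (use pos in \<open>simp add: E_def\<close>)
    then have XU: "standard_fBm U (h l) (X l)" if "l < p" for l using that by blast
    have indU: "U.indep_vars (\<lambda>_. Pi\<^sub>M UNIV (\<lambda>_. borel)) (\<lambda>l \<omega> t. X l t \<omega>) {..<p}"
      using cond by (rule conjunct2)
    have "borel_measurable (lborel \<Otimes>\<^sub>M U) = (borel_measurable (lborel \<Otimes>\<^sub>M M) :: (real \<times> 'a \<Rightarrow> real) set)"
      by (rule measurable_cong_sets[OF sets_pair_measure_cong[OF refl setsU] refl])
    then have XmU: "(\<lambda>(t, \<omega>). X l t \<omega>) \<in> borel_measurable (lborel \<Otimes>\<^sub>M U)" if "l < p" for l
      using Xm[OF that] by (simp only:)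
    define Bad where "Bad = {\<omega> \<in> space U. \<kappa> \<le> dev h \<omega>}"
    have Bad: "measure U Bad \<le> q" "Bad \<in> sets U"
      unfolding Bad_def dev_def w_def q_def U.wint_def[symmetric]
      by (rule U.gram_concentration[OF XU hb s XmU indU N \<kappa>], assumption+)+
    have "AE \<omega> in U. \<forall>l\<in>{..<p}. \<forall>k\<in>{1..N}. integrable lborel (\<lambda>u. \<psi> u * rescaled s (h l) (X l) k u \<omega>)"
    proof (intro AE_finite_allI)
      fix l k assume "l \<in> {..<p}"
      then have l: "l < p" by simp
      show "AE \<omega> in U. integrable lborel (\<lambda>u. \<psi> u * rescaled s (h l) (X l) k u \<omega>)"
        by (rule U.wint_path_integrable[OF U.rescaled_fBm(2)[OF XU[OF l] hb(1)[OF l] s XmU[OF l] order_refl]])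
    qed auto
    then obtain Nn where Nn: "{\<omega> \<in> space U. \<not> (\<forall>l\<in>{..<p}. \<forall>k\<in>{1..N}. integrable lborel (\<lambda>u. \<psi> u * rescaled s (h l) (X l) k u \<omega>))} \<subseteq> Nn"
      "emeasure U Nn = 0" "Nn \<in> sets U"
      by (rule AE_E)
    have "measure U (Bad \<union> Nn) \<le> measure U Bad + measure U Nn"
      using Bad Nn by (intro measure_Un_le) auto
    also have "measure U Nn = 0" using Nn(2) by (simp add: measure_def)
    finally have BN: "measure U (Bad \<union> Nn) \<le> q" using Bad(1) by simp
    have BNs: "Bad \<union> Nn \<in> sets M" using Bad(2) Nn(3) setsU by auto
    have "measure U (Bad \<union> Nn) = measure M (E h \<inter> (Bad \<union> Nn)) / measure M (E h)"
      unfolding U_def by (rule measure_uniform_measure) (use e0 BNs in auto)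
    then have "measure M (E h \<inter> (Bad \<union> Nn)) = measure M (E h) * measure U (Bad \<union> Nn)" using pos by simp
    also have "\<dots> \<le> measure M (E h) * q" using BN by (intro mult_left_mono) auto
    finally have 1: "measure M (E h \<inter> (Bad \<union> Nn)) \<le> measure M (E h) * q" .
    have "good h \<omega>" if "\<omega> \<in> E h - (Bad \<union> Nn)" for \<omega>
    proof -
      have "\<omega> \<in> space U" using that by (simp add: E_def spaceU)
      then show ?thesis using that Nn(1) unfolding good_def Bad_def by auto
    qed
    then show ?thesis using 1 BNs by blast
  qed
  then obtain B where B: "\<And>h. h \<in> Hf \<Longrightarrow> B h \<in> sets M" "\<And>h. h \<in> Hf \<Longrightarrow> measure M (E h \<inter> B h) \<le> measure M (E h) * q"
    "\<And>h \<omega>. h \<in> Hf \<Longrightarrow> \<omega> \<in> E h - B h \<Longrightarrow> good h \<omega>" by metis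
  have "AE \<omega> in M. \<forall>l\<in>{..<p}. H l \<omega> \<in> Hs" by (intro AE_finite_allI) (use HHs in auto)
  then obtain N0 where N0: "{\<omega> \<in> space M. \<not> (\<forall>l\<in>{..<p}. H l \<omega> \<in> Hs)} \<subseteq> N0" "emeasure M N0 = 0" "N0 \<in> sets M"
    by (rule AE_E)
  define BB where "BB = N0 \<union> (\<Union>h\<in>Hf. E h \<inter> B h)"
  have sU: "(\<Union>h\<in>Hf. E h \<inter> B h) \<in> sets M" using finHf B(1) E by (intro sets.finite_UN) auto
  have BB: "BB \<in> sets M" unfolding BB_def using sU N0(3) by auto
  have disj: "disjoint_family_on E Hf"
    unfolding disjoint_family_on_def
  proof (intro ballI impI)
    fix h h' assume "h \<in> Hf" "h' \<in> Hf" "h \<noteq> h'"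
    then have "\<exists>l<p. h l \<noteq> h' l" unfolding Hf_def by (metis PiE_ext lessThan_iff)
    then show "E h \<inter> E h' = {}" by (auto simp: E_def)
  qed
  have "measure M BB \<le> measure M N0 + measure M (\<Union>h\<in>Hf. E h \<inter> B h)"
    unfolding BB_def using sU N0 by (intro measure_Un_le) auto
  also have "measure M N0 = 0" using N0(2) by (simp add: measure_def)
  also have "measure M (\<Union>h\<in>Hf. E h \<inter> B h) \<le> (\<Sum>h\<in>Hf. measure M (E h \<inter> B h))"
    using finHf B(1) E by (intro measure_UNION_le) auto
  also have "\<dots> \<le> (\<Sum>h\<in>Hf. measure M (E h) * q)" by (intro sum_mono B(2))
  also have "\<dots> = measure M (\<Union>h\<in>Hf. E h) * q"
    unfolding sum_distrib_right[symmetric]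
    by (subst finite_measure_finite_Union[OF finHf _ disj]) (use E in auto)
  also have "\<dots> \<le> 1 * q" using q0 by (intro mult_right_mono) auto
  finally have mBB: "measure M BB \<le> q" by simp
  show ?thesis
  proof (rule that[OF BB mBB[unfolded q_def]])
    fix \<omega> assume w: "\<omega> \<in> space M - BB"
    then have HHs': "\<forall>l<p. H l \<omega> \<in> Hs" using N0(1) by (auto simp: BB_def)
    define h where "h = restrict (\<lambda>l. H l \<omega>) {..<p}"
    have h: "h \<in> Hf" using HHs' by (auto simp: h_def Hf_def)
    have "\<omega> \<in> E h" using w by (simp add: E_def h_def)
    then have "\<omega> \<in> E h - B h" using w h by (auto simp: BB_def)
    then have g: "good h \<omega>" using B(3)[OF h] by blast
    have hl: "h l = H l \<omega>" if "l < p" for l using that by (simp add: h_def)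
    have "dev h \<omega> = dev (\<lambda>l. H l \<omega>) \<omega>"
      unfolding dev_def w_def by (intro sum.cong refl) (simp add: hl)
    then show "(\<forall>l<p. H l \<omega> \<in> Hs)
       \<and> (\<forall>l<p. \<forall>k\<in>{1..N}. integrable lborel (\<lambda>u. \<psi> u * rescaled s (H l \<omega>) (X l) k u \<omega>))
       \<and> dev (\<lambda>l. H l \<omega>) \<omega> < \<kappa>"
      using g HHs' hl unfolding good_def by simp
  qed
qed

text \<open>
  The complement of the support is a union of open null sets, countably many of which suffice by
  Lindeloef's theorem.
\<close>

lemma AE_measure_supp:
  fixes \<pi> :: "real measure"
  assumes sets: "sets \<pi> = sets borel"
  shows "AE x in \<pi>. x \<in> measure_supp \<pi>"
proof -
  define \<U> where "\<U> = {U. open U \<and> emeasure \<pi> U = 0}"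
  obtain \<V> where V: "\<V> \<subseteq> \<U>" "countable \<V>" "\<Union>\<V> = \<Union>\<U>"
    using Lindelof[of \<U>] unfolding \<U>_def by auto
  have "\<Union>\<V> \<in> null_sets \<pi>"
  proof (rule null_sets_UN'[OF V(2), of "\<lambda>U. U", simplified])
    fix U assume "U \<in> \<V>"
    then show "U \<in> null_sets \<pi>" using V(1) unfolding \<U>_def by (auto simp: null_sets_def sets)
  qed
  then have "AE x in \<pi>. x \<notin> \<Union>\<V>" by (rule AE_not_in)
  then show ?thesis
  proof (rule eventually_mono)
    fix x assume "x \<notin> \<Union>\<V>"
    then have "\<forall>U. open U \<and> x \<in> U \<longrightarrow> emeasure \<pi> U \<noteq> 0" unfolding V(3) \<U>_def by auto
    then show "x \<in> measure_supp \<pi>" unfolding measure_supp_def by (auto simp: zero_less_iff_neq_zero)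
  qed
qed

text \<open>
  The law of large numbers for a bounded function of the exponents, from Hoeffding's inequality.
\<close>

lemma empirical_mean_deviation:
  fixes H :: "nat \<Rightarrow> 'a \<Rightarrow> real" and f :: "real \<Rightarrow> real"
  assumes M: "prob_space M" and ind: "prob_space.indep_vars M (\<lambda>_. borel) H {..<p}"
    and distr: "\<And>l. l < p \<Longrightarrow> distr M borel (H l) = \<pi>"
    and f [measurable]: "f \<in> borel_measurable borel" and bound: "\<And>x. \<bar>f x\<bar> \<le> G"
    and G: "0 < G" and p: "1 \<le> p" and e: "0 < e"
  shows "measure M {\<omega> \<in> space M. e \<le> \<bar>(\<Sum>l<p. f (H l \<omega>)) / real p - (LINT x|\<pi>. f x)\<bar>} \<le> 2 * exp (- (real p * e\<^sup>2 / (2 * G\<^sup>2)))"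
    and "{\<omega> \<in> space M. e \<le> \<bar>(\<Sum>l<p. f (H l \<omega>)) / real p - (LINT x|\<pi>. f x)\<bar>} \<in> sets M"
proof -
  interpret prob_space M by fact
  have Hm [measurable]: "H l \<in> borel_measurable M" if "l < p" for l
    using ind that unfolding indep_vars_def by auto
  have mean: "expectation (\<lambda>\<omega>. f (H l \<omega>)) = (LINT x|\<pi>. f x)" if "l < p" for l
    unfolding distr[OF that, symmetric] using Hm[OF that] by (subst integral_distr) auto
  have ind': "indep_vars (\<lambda>_. borel) (\<lambda>l \<omega>. f (H l \<omega>)) {..<p}"
    by (rule indep_vars_compose2[OF ind]) simp
  interpret Hf: Hoeffding_ineq M "{..<p}" "\<lambda>l \<omega>. f (H l \<omega>)" "\<lambda>_. - G" "\<lambda>_. G" "\<Sum>l<p. expectation (\<lambda>\<omega>. f (H l \<omega>))"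
  proof unfold_locales
    show "AE x in M. f (H i x) \<in> {- G..G}" if "i \<in> {..<p}" for i
      using bound by (intro AE_I2) (auto simp: abs_le_iff intro: minus_le_iff[THEN iffD1])
  qed (use ind' in auto)
  have \<mu>: "(\<Sum>l<p. expectation (\<lambda>\<omega>. f (H l \<omega>))) = real p * (LINT x|\<pi>. f x)" by (simp add: mean)
  have p0: "0 < real p" using p by simp
  have iff: "e \<le> \<bar>S / real p - m\<bar> \<longleftrightarrow> real p * e \<le> \<bar>S - real p * m\<bar>" for S m
  proof -
    have "S / real p - m = (S - real p * m) / real p" using p0 by (simp add: diff_divide_distrib)
    then have "\<bar>S / real p - m\<bar> = \<bar>S - real p * m\<bar> / real p" by (simp add: abs_divide)
    then show ?thesis using p0 by (simp add: field_simps)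
  qed
  have "(\<Sum>l<p. (G - - G)\<^sup>2) = real p * (4 * G\<^sup>2)" by (simp add: power2_eq_square algebra_simps)
  then have S: "(\<Sum>l<p. (G - - G)\<^sup>2) > 0" "- 2 * (real p * e)\<^sup>2 / (\<Sum>l<p. (G - - G)\<^sup>2) = - (real p * e\<^sup>2 / (2 * G\<^sup>2))"
    using p0 G by (auto simp: power2_eq_square field_simps)
  have "0 \<le> real p * e" using p0 e by simp
  from Hf.Hoeffding_ineq_abs_ge[OF this S(1)]
  show "measure M {\<omega> \<in> space M. e \<le> \<bar>(\<Sum>l<p. f (H l \<omega>)) / real p - (LINT x|\<pi>. f x)\<bar>} \<le> 2 * exp (- (real p * e\<^sup>2 / (2 * G\<^sup>2)))"
    unfolding S(2) \<mu> iff by simp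
  show "{\<omega> \<in> space M. e \<le> \<bar>(\<Sum>l<p. f (H l \<omega>)) / real p - (LINT x|\<pi>. f x)\<bar>} \<in> sets M"
    by measurable
qed

section \<open>The empirical spectral distribution\<close>

text \<open>
  The deviation of the empirical spectral distribution at one sample size. Outside of four exceptional
  events (of the Gram matrix, of the two extreme singular values and of the empirical mean of the
  exponents), every rescaled log-eigenvalue is within \<open>3 \<delta>\<close> of the number \<open>2 H + 1\<close> of the same rank, and the average of
  \<open>g(2 H + 1)\<close> over the sample is close to its expectation.
\<close>

lemma (in compact_wavelet) esd_deviation:
  fixes M :: "'a measure" and \<pi> :: "real measure" and H :: "nat \<Rightarrow> 'a \<Rightarrow> real"
    and X :: "nat \<Rightarrow> real \<Rightarrow> 'a \<Rightarrow> real" and P :: "'a \<Rightarrow> real Matrix.mat"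
    and Y :: "real \<Rightarrow> 'a \<Rightarrow> real Matrix.vec" and g :: "real \<Rightarrow> real" and a s :: real
  assumes M: "prob_space M" and Hs: "finite Hs" "Hs \<subseteq> {0<..<1}"
    and r: "0 < r0" "\<And>h. h \<in> Hs \<Longrightarrow> r0 \<le> wavelet_cov \<psi> h 0" "\<And>h. h \<in> Hs \<Longrightarrow> wavelet_cov \<psi> h 0 \<le> r1" "r0 \<le> r1"
    and p: "1 \<le> p" and N: "1 \<le> N" and a: "1 < a" and s: "s = a * 2 ^ j"
    and ind: "prob_space.indep_vars M (\<lambda>_. borel) H {..<p}"
    and distr: "\<And>l. l < p \<Longrightarrow> distr M borel (H l) = \<pi>"
    and \<pi>: "sets \<pi> = sets borel" "AE x in \<pi>. x \<in> Hs"
    and paths: "rH_fBm_paths M p H X"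
    and Xm: "\<And>l. l < p \<Longrightarrow> (\<lambda>(t, \<omega>). X l t \<omega>) \<in> borel_measurable (lborel \<Otimes>\<^sub>M M)"
    and Y: "\<And>t \<omega>. \<omega> \<in> space M \<Longrightarrow> Y t \<omega> = P \<omega> *\<^sub>v Matrix.vec p (\<lambda>l. X l t \<omega>)"
    and P: "\<And>\<omega>. \<omega> \<in> space M \<Longrightarrow> P \<omega> \<in> carrier_mat p p" "\<And>\<omega>. \<omega> \<in> space M \<Longrightarrow> invertible_mat (P \<omega>)"
    and Pm: "\<And>i j. i < p \<Longrightarrow> j < p \<Longrightarrow> (\<lambda>\<omega>. P \<omega> $$ (i,j)) \<in> borel_measurable M"
    and g: "g \<in> borel_measurable borel" "\<And>x. \<bar>g x\<bar> \<le> G" "0 < G"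
    and \<epsilon>: "0 < \<epsilon>"
    and \<delta>: "(\<bar>ln (r0 / 2)\<bar> + \<bar>ln (2 * r1)\<bar> + 3 * real j * ln 2) / ln a \<le> \<delta>"
    and uc: "\<And>h x. h \<in> Hs \<Longrightarrow> \<bar>x - (2 * h + 1)\<bar> \<le> 3 * \<delta> \<Longrightarrow> \<bar>g x - g (2 * h + 1)\<bar> \<le> \<epsilon> / 2"
  shows "measure M {\<omega> \<in> space M.
       \<bar>(LINT \<upsilon>|log_esd a (wavelet_matrix \<psi> s N p (\<lambda>t. Y t \<omega>)). g \<upsilon>)
        - (LINT \<upsilon>|distr \<pi> borel (\<lambda>h. 2 * h + 1). g \<upsilon>)\<bar> > \<epsilon>}
    \<le> (real p)\<^sup>2 * (8 * cov_bound\<^sup>2 / real N) / (r0 / 2)\<^sup>2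
      + measure M {\<omega> \<in> space M. \<bar>ln (ordered_singular_value 1 (P \<omega>)) / ln a - 0\<bar> > \<delta>}
      + measure M {\<omega> \<in> space M. \<bar>ln (ordered_singular_value p (P \<omega>)) / ln a - 0\<bar> > \<delta>}
      + 2 * exp (- (real p * (\<epsilon> / 2)\<^sup>2 / (2 * G\<^sup>2)))"
    (is "measure M ?Bad \<le> ?q + measure M ?S1 + measure M ?S2 + ?L")
proof -
  interpret prob_space M by fact
  have s1: "1 \<le> s"
    using a one_le_power[of "2::real" j] mult_mono[of 1 a 1 "2 ^ j"] unfolding s by simp
  have s0: "0 < s" using s1 by simp
  have Hm: "H l \<in> borel_measurable M" if "l < p" for l
    using ind that unfolding indep_vars_def by auto
  have HHs: "AE \<omega> in M. H l \<omega> \<in> Hs" if "l < p" for l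
    using \<pi>(2) unfolding distr[OF that, symmetric] by (rule AE_distrD[OF Hm[OF that]])
  have \<kappa>: "0 < (r0 / 2)\<^sup>2" using r(1) by simp
  obtain B where B: "B \<in> sets M" "measure M B \<le> ?q"
    and good: "\<And>\<omega>. \<omega> \<in> space M - B \<Longrightarrow> (\<forall>l<p. H l \<omega> \<in> Hs)
       \<and> (\<forall>l<p. \<forall>k\<in>{1..N}. integrable lborel (\<lambda>u. \<psi> u * rescaled s (H l \<omega>) (X l) k u \<omega>))
       \<and> (\<Sum>l<p. \<Sum>m<p. ((\<Sum>k=1..N. (LINT u|lborel. \<psi> u * rescaled s (H l \<omega>) (X l) k u \<omega>)
             * (LINT u|lborel. \<psi> u * rescaled s (H m \<omega>) (X m) k u \<omega>)) / real N
          - (if l = m then wavelet_cov \<psi> (H l \<omega>) 0 else 0))\<^sup>2) < (r0 / 2)\<^sup>2"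
    by (rule conditional_gram_concentration[OF M Hs Hm HHs paths Xm s0 N \<kappa>]) (assumption | rule that)+
  note sv = measurable_extreme_singular_values[OF p P(1) Pm]
  have S: "?S1 \<in> sets M" "?S2 \<in> sets M"
  proof -
    note [measurable] = sv
    show "?S1 \<in> sets M" by measurable
    show "?S2 \<in> sets M" by measurable
  qed
  have g2m: "(\<lambda>h. g (2 * h + 1)) \<in> borel_measurable borel" using g(1) by simp
  let ?D = "{\<omega> \<in> space M. \<epsilon> / 2 \<le> \<bar>(\<Sum>l<p. g (2 * H l \<omega> + 1)) / real p - (LINT h|\<pi>. g (2 * h + 1))\<bar>}"
  have \<epsilon>2: "0 < \<epsilon> / 2" using \<epsilon> by simp
  note emp = empirical_mean_deviation[OF M ind distr g2m g(2) g(3) p \<epsilon>2]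
  have D: "measure M ?D \<le> ?L" "?D \<in> sets M" using emp by auto
  have lim: "(LINT \<upsilon>|distr \<pi> borel (\<lambda>h. 2 * h + 1). g \<upsilon>) = (LINT h|\<pi>. g (2 * h + 1))"
    by (rule integral_distr) (use g(1) \<pi>(1) in \<open>auto cong: measurable_cong_sets\<close>)
  have incl: "?Bad \<subseteq> B \<union> ?S1 \<union> ?S2 \<union> ?D"
  proof (rule subsetI, rule ccontr)
    fix \<omega> assume bad: "\<omega> \<in> ?Bad" and "\<omega> \<notin> B \<union> ?S1 \<union> ?S2 \<union> ?D"
    then have w: "\<omega> \<in> space M" "\<omega> \<in> space M - B"
      and sig: "\<bar>ln (ordered_singular_value 1 (P \<omega>)) / ln a\<bar> \<le> \<delta>" "\<bar>ln (ordered_singular_value p (P \<omega>)) / ln a\<bar> \<le> \<delta>"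
      and emp: "\<bar>(\<Sum>l<p. g (2 * H l \<omega> + 1)) / real p - (LINT h|\<pi>. g (2 * h + 1))\<bar> < \<epsilon> / 2"
      by auto
    note Pw = P(1)[OF w(1)] P(2)[OF w(1)]
    define h where "h l = H l \<omega>" for l
    define v where "v l k = (LINT u|lborel. \<psi> u * rescaled s (h l) (X l) k u \<omega>)" for l k
    have hHs: "h l \<in> Hs" if "l < p" for l using good[OF w(2)] that by (simp add: h_def)
    have int: "integrable lborel (\<lambda>u. \<psi> u * rescaled s (h l) (X l) k u \<omega>)" if "l < p" "k \<in> {1..N}" for l k
      using good[OF w(2)] that by (simp add: h_def)
    have gram: "(\<Sum>l<p. \<Sum>m<p. ((\<Sum>k=1..N. v l k * v m k) / real N - (if l = m then wavelet_cov \<psi> (h l) 0 else 0))\<^sup>2) \<le> (r0 / 2)\<^sup>2"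
      using good[OF w(2)] unfolding v_def h_def by (intro less_imp_le) blast
    define W where "W = wavelet_matrix \<psi> s N p (\<lambda>t. Y t \<omega>)"
    define c where "c i k = (\<Sum>l<p. P \<omega> $$ (i,l) * (s powr (h l + 1 / 2) * v l k))" for i k
    have coeff: "vec_index (wavelet_coeff \<psi> s p (\<lambda>t. Y t \<omega>) (int k)) i = c i k" if "i < p" "k \<in> {1..N}" for i k
      unfolding Y[OF w(1)] c_def v_def by (rule wavelet_coeff_rescaled[OF s0 that(1) Pw(1) int[OF _ that(2)]])
    have W: "W = Matrix.mat p p (\<lambda>(i, i'). (\<Sum>k=1..N. c i k * c i' k) / real N)"
      unfolding W_def wavelet_matrix_def
      by (rule eq_matI) (auto intro!: sum.cong arg_cong2[where f = "(/)"] simp: coeff)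
    obtain f where f: "bij_betw f {..<p} {..<p}"
      and lo: "\<And>i. i < p \<Longrightarrow> r0 / 2 * (ordered_singular_value 1 (P \<omega>))\<^sup>2 * s powr (2 * h (f i) + 1) \<le> ordered_eigenvalue (Suc i) W"
      and hi: "\<And>i. i < p \<Longrightarrow> ordered_eigenvalue (Suc i) W \<le> 2 * r1 * (ordered_singular_value p (P \<omega>))\<^sup>2 * s powr (2 * h (f i) + 1)"
      by (rule wavelet_eigenvalue_bounds[OF p Pw s1 N c_def W r(1) r(2)[OF hHs] r(3)[OF hHs] gram]) (assumption | rule that)+
    note sp = singular_value_pos[OF Pw p]
    have close: "\<bar>g (ln (ordered_eigenvalue (Suc i) W) / ln a) - g (2 * h (f i) + 1)\<bar> \<le> \<epsilon> / 2" if i: "i < p" for i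
    proof -
      have fi: "f i < p" using bij_betwE[OF f] i by auto
      have h01: "0 < h (f i)" "h (f i) < 1" using hHs[OF fi] Hs(2) by auto
      have "\<bar>ln (ordered_eigenvalue (Suc i) W) / ln a - (2 * h (f i) + 1)\<bar> \<le> 3 * \<delta>"
        by (rule log_ratio_bound[OF a s sp _ _ h01 lo[OF i] hi[OF i] sig \<delta>]) (use r in auto)
      then show ?thesis by (rule uc[OF hHs[OF fi]])
    qed
    have esd: "(LINT \<upsilon>|log_esd a W. g \<upsilon>) = (\<Sum>i<p. g (ln (ordered_eigenvalue (Suc i) W) / ln a)) / real p"
      by (rule log_esd_integral[OF _ p g(1)]) (simp add: W)
    have re: "(\<Sum>l<p. g (2 * h l + 1)) = (\<Sum>i<p. g (2 * h (f i) + 1))"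
      using sum.reindex_bij_betw[OF f, of "\<lambda>l. g (2 * h l + 1)"] by simp
    have "\<bar>(LINT \<upsilon>|log_esd a W. g \<upsilon>) - (\<Sum>l<p. g (2 * h l + 1)) / real p\<bar>
        = \<bar>\<Sum>i<p. g (ln (ordered_eigenvalue (Suc i) W) / ln a) - g (2 * h (f i) + 1)\<bar> / real p"
      unfolding esd re diff_divide_distrib[symmetric] sum_subtractf[symmetric] by (simp add: abs_divide)
    also have "\<dots> \<le> (\<Sum>i<p. \<epsilon> / 2) / real p"
      by (intro divide_right_mono order_trans[OF sum_abs] sum_mono close) auto
    also have "\<dots> = \<epsilon> / 2" using p by simp
    finally have "\<bar>(LINT \<upsilon>|log_esd a W. g \<upsilon>) - (LINT h|\<pi>. g (2 * h + 1))\<bar> < \<epsilon>"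
      using emp unfolding h_def by linarith
    then show False using bad unfolding lim W_def by simp
  qed
  have U: "B \<union> ?S1 \<in> sets M" "B \<union> ?S1 \<union> ?S2 \<in> sets M" using B(1) S by auto
  have "measure M ?Bad \<le> measure M (B \<union> ?S1 \<union> ?S2 \<union> ?D)"
    by (rule finite_measure_mono[OF incl]) (use U D in auto)
  also have "\<dots> \<le> measure M (B \<union> ?S1 \<union> ?S2) + measure M ?D" by (rule measure_Un_le[OF U(2) D(2)])
  also have "\<dots> \<le> measure M (B \<union> ?S1) + measure M ?S2 + measure M ?D"
    by (intro add_right_mono measure_Un_le[OF U(1) S(2)])
  also have "\<dots> \<le> measure M B + measure M ?S1 + measure M ?S2 + measure M ?D"
    by (intro add_right_mono measure_Un_le[OF B(1) S(1)])
  also have "\<dots> \<le> ?q + measure M ?S1 + measure M ?S2 + ?L"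
    by (intro add_mono B(2) D(1) order_refl)
  finally show ?thesis .
qed

lemma bounded_support:
  fixes \<psi> :: "real \<Rightarrow> real"
  assumes "compact (closure {t. \<psi> t \<noteq> 0})"
  obtains R where "1 \<le> R" "\<And>t. R < \<bar>t\<bar> \<Longrightarrow> \<psi> t = 0"
proof -
  have "bounded {t. \<psi> t \<noteq> 0}" using compact_imp_bounded[OF assms] bounded_subset closure_subset by blast
  then obtain b where b: "\<And>t. \<psi> t \<noteq> 0 \<Longrightarrow> \<bar>t\<bar> \<le> b" unfolding bounded_iff by auto
  show ?thesis by (rule that[of "max 1 b"]) (use b in force)+
qed

text \<open>
  Along the filter \<open>n\<close> tends to infinity while \<open>n / a(n)\<^bsup>1 + 2h\<^esup>\<close> tends to zero, so that \<open>a(n)\<close> cannot remain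
  bounded on arbitrarily large \<open>n\<close>.
\<close>

lemma scale_tendsto_infinity:
  fixes a :: "nat \<Rightarrow> nat" and F :: "nat filter"
  assumes F: "F \<le> sequentially" and a: "\<forall>\<^sub>F n in F. 1 \<le> a n" and h: "0 < h"
    and lim: "((\<lambda>n. real (a n) / real n + real n / real (a n) powr (1 + 2 * h)) \<longlongrightarrow> 0) F"
  shows "filterlim (\<lambda>n. real (a n)) at_top F"
unfolding filterlim_at_top_gt[where c = "1 :: real"]
proof (intro allI impI)
  fix Z :: real assume Z: "1 < Z"
  have 1: "\<forall>\<^sub>F n in F. real (a n) / real n + real n / real (a n) powr (1 + 2 * h) < 1"
    using order_tendstoD(2)[OF lim, of 1] by simp
  have "filterlim real at_top F" by (rule filterlim_mono[OF filterlim_real_sequentially order_refl F])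
  then have 2: "\<forall>\<^sub>F n in F. Z powr (1 + 2 * h) \<le> real n" unfolding filterlim_at_top by blast
  show "\<forall>\<^sub>F n in F. Z \<le> real (a n)"
    using 1 2 a
  proof eventually_elim
    case (elim n)
    have "real n / real (a n) powr (1 + 2 * h) < 1"
      using elim(1) divide_nonneg_nonneg[of "real (a n)" "real n"] by linarith
    then have "real n < real (a n) powr (1 + 2 * h)" using elim(3) by (simp add: field_simps)
    then have lt: "Z powr (1 + 2 * h) < real (a n) powr (1 + 2 * h)" using elim(2) by linarith
    show "Z \<le> real (a n)"
    proof (rule ccontr)
      assume "\<not> Z \<le> real (a n)"
      then have "real (a n) powr (1 + 2 * h) \<le> Z powr (1 + 2 * h)" using h by (intro powr_mono2) auto
      then show False using lt by simp
    qed
  qed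
qed

theorem theorem3p1:
  fixes M :: "'a measure"
    and \<pi> :: "real measure"
    and S :: "nat set"
    and a p :: "nat \<Rightarrow> nat"
    and j N\<^sub>\<psi> :: nat
    and H :: "nat \<Rightarrow> nat \<Rightarrow> 'a \<Rightarrow> real"
    and X :: "nat \<Rightarrow> nat \<Rightarrow> real \<Rightarrow> 'a \<Rightarrow> real"
    and P :: "nat \<Rightarrow> 'a \<Rightarrow> real Matrix.mat"
    and Y :: "nat \<Rightarrow> real \<Rightarrow> 'a \<Rightarrow> real Matrix.vec"
    and \<phi> \<psi> :: "real \<Rightarrow> real"
    and A \<alpha> H\<^sub>m\<^sub>i\<^sub>n :: real
  defines "F \<equiv> inf sequentially (principal S)"
  assumes M: "prob_space M"
    \<comment> \<open>the sample sizes; no dyadic \<open>a\<close> that tends to infinity satisfies \<open>dvd\<close> below for all \<open>n\<close>\<close>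
    and S: "infinite S"
    and p_pos: "\<And>n. n \<in> S \<Longrightarrow> p n \<ge> 1"
    and A1: "real_distribution \<pi>" "measure \<pi> {0<..<1} = 1"
      "finite (measure_supp \<pi>)" "measure_supp \<pi> \<subseteq> {0<..<1}"
      "H\<^sub>m\<^sub>i\<^sub>n = Min (measure_supp \<pi>)"
      "\<And>n. n \<in> S \<Longrightarrow> prob_space.indep_vars M (\<lambda>_. borel) (H n) {..<p n}"
      "\<And>n l. n \<in> S \<Longrightarrow> l < p n \<Longrightarrow> distr M borel (H n l) = \<pi>"
    and A2: "\<And>n. n \<in> S \<Longrightarrow> rH_fBm_paths M (p n) (H n) (X n)"
      \<comment> \<open>a measurable version of the process, for the wavelet integrals to be random variables\<close>
      "\<And>n l. n \<in> S \<Longrightarrow> l < p n \<Longrightarrow>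
         (\<lambda>(t, \<omega>). X n l t \<omega>) \<in> borel_measurable (lborel \<Otimes>\<^sub>M M)"
    and A3: "\<And>n t \<omega>. n \<in> S \<Longrightarrow> \<omega> \<in> space M \<Longrightarrow>
         Y n t \<omega> = P n \<omega> *\<^sub>v Matrix.vec (p n) (\<lambda>l. X n l t \<omega>)"
      "\<And>n \<omega>. n \<in> S \<Longrightarrow> \<omega> \<in> space M \<Longrightarrow>
         P n \<omega> \<in> carrier_mat (p n) (p n) \<and> invertible_mat (P n \<omega>)"
      "\<And>n. n \<in> S \<Longrightarrow> indep_rvs M
         (Pi\<^sub>M ({..<p n} \<times> {..<p n}) (\<lambda>_. borel))
         (\<lambda>\<omega>. \<lambda>il\<in>{..<p n} \<times> {..<p n}. index_mat (P n \<omega>) il)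
         (Pi\<^sub>M ({..<p n} \<times> UNIV) (\<lambda>_. borel))
         (\<lambda>\<omega>. \<lambda>(l, t)\<in>{..<p n} \<times> UNIV. X n l t \<omega>)"
    and A4: "\<And>n. n \<in> S \<Longrightarrow> \<exists>k. a n = 2 ^ k"
      "\<And>n. n \<in> S \<Longrightarrow> real (a n) \<le> real n / 2 ^ j"
      "((\<lambda>n. real (a n) / real n + real n / real (a n) powr (1 + 2 * H\<^sub>m\<^sub>i\<^sub>n)) \<longlongrightarrow> 0) F"
      "\<And>n. n \<in> S \<Longrightarrow> real (p n) < real n / (real (a n) * 2 ^ j)"
      "filterlim p at_top F"
      "(\<lambda>n. real (p n)) \<in> o[F](\<lambda>n. sqrt (real n / real (a n)))"
      "\<And>n. n \<in> S \<Longrightarrow> a n * 2 ^ j dvd n"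
    and A5: "tendsto_in_prob M F
         (\<lambda>n \<omega>. ln (ordered_singular_value 1 (P n \<omega>)) / ln (real (a n))) 0"
      "tendsto_in_prob M F
         (\<lambda>n \<omega>. ln (ordered_singular_value (p n) (P n \<omega>)) / ln (real (a n))) 0"
    and MRA: "MRA_scaling_wavelet \<phi> \<psi>"
    and W1: "\<psi> \<in> L2R" "(LINT t|lborel. (\<psi> t)\<^sup>2) = 1" "N\<^sub>\<psi> \<ge> 2"
      "\<And>q. q < N\<^sub>\<psi> \<Longrightarrow> (LINT t|lborel. t ^ q * \<psi> t) = 0"
      "(LINT t|lborel. t ^ N\<^sub>\<psi> * \<psi> t) \<noteq> 0"
    and W2: "integrable lborel \<phi>" "integrable lborel \<psi>"
      "compact (closure {t. \<phi> t \<noteq> 0})" "compact (closure {t. \<psi> t \<noteq> 0})"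
      "fourier \<phi> 0 = 1"
    and W3: "0 < A" "\<alpha> > 1"
      "(SUP x. ereal (cmod (fourier \<psi> x) * (1 + \<bar>x\<bar>) powr \<alpha>)) < ereal A"
  shows "\<forall>g :: real \<Rightarrow> real. continuous_on UNIV g \<and> bounded (range g) \<longrightarrow>
    (\<forall>\<epsilon>>0. ((\<lambda>n. measure M {\<omega> \<in> space M.
       \<bar>(LINT \<upsilon>|log_esd (real (a n))
            (wavelet_matrix \<psi> (real (a n) * 2 ^ j) (n div (a n * 2 ^ j)) (p n) (\<lambda>t. Y n t \<omega>)).
          g \<upsilon>)
        - (LINT \<upsilon>|distr \<pi> borel (\<lambda>h. 2 * h + 1). g \<upsilon>)\<bar> > \<epsilon>}) \<longlongrightarrow> 0) F)"
proof (intro allI impI)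
  fix g :: "real \<Rightarrow> real" and \<epsilon> :: real
  assume g: "continuous_on UNIV g \<and> bounded (range g)" and \<epsilon>: "0 < \<epsilon>"
  obtain R where R: "1 \<le> R" "\<And>t. R < \<bar>t\<bar> \<Longrightarrow> \<psi> t = 0"
    using bounded_support[OF W2(4)] by metis
  interpret compact_wavelet \<psi> R
  proof
    show "(LINT t|lborel. \<psi> t) = 0" "(LINT t|lborel. t * \<psi> t) = 0"
      using W1(3) W1(4)[of 0] W1(4)[of 1] by simp_all
  qed (use W2(2) R in auto)
  interpret \<pi>: real_distribution \<pi> by fact
  define Hs where "Hs = measure_supp \<pi>"
  have Hs: "finite Hs" "Hs \<subseteq> {0<..<1}" using A1(3,4) by (simp_all add: Hs_def)
  have sets\<pi>: "sets \<pi> = sets borel" by simp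
  have AE\<pi>: "AE x in \<pi>. x \<in> Hs" unfolding Hs_def by (rule AE_measure_supp[OF sets\<pi>])
  have ne: "Hs \<noteq> {}"
  proof
    assume "Hs = {}"
    then have "AE x in \<pi>. False" using AE\<pi> by simp
    then show False using \<pi>.AE_const by blast
  qed
  have hmin: "0 < H\<^sub>m\<^sub>i\<^sub>n" using Min_in[OF Hs(1) ne] Hs(2) A1(5) by (auto simp: Hs_def)
  \<comment> \<open>bounds of the wavelet variances that are uniform over the finite support of the exponents\<close>
  define r0 where "r0 = Min ((\<lambda>h. wavelet_cov \<psi> h 0) ` Hs)"
  define r1 where "r1 = Max ((\<lambda>h. wavelet_cov \<psi> h 0) ` Hs)"
  have fin: "finite ((\<lambda>h. wavelet_cov \<psi> h 0) ` Hs)" "(\<lambda>h. wavelet_cov \<psi> h 0) ` Hs \<noteq> {}" using Hs ne by auto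
  have r0: "0 < r0"
    unfolding r0_def using fin Hs(2) by (subst Min_gr_iff) (auto intro!: wavelet_cov_0_pos[OF W1(4,5)])
  have r: "r0 \<le> wavelet_cov \<psi> h 0" "wavelet_cov \<psi> h 0 \<le> r1" if "h \<in> Hs" for h
    unfolding r0_def r1_def using that fin by auto
  have r01: "r0 \<le> r1" using r ne by (meson all_not_in_conv order_trans)
  obtain b where b: "\<And>x. \<bar>g x\<bar> \<le> b" using g by (auto simp: bounded_iff)
  define G where "G = max 1 b"
  have G: "0 < G" "\<And>x. \<bar>g x\<bar> \<le> G" using b by (auto simp: G_def intro: le_max_iff_disj[THEN iffD2])
  have gm: "g \<in> borel_measurable borel" using g by (intro borel_measurable_continuous_onI) auto
  have "uniformly_continuous_on {0..4} g"
    using g by (intro compact_uniformly_continuous) (auto intro: continuous_on_subset)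
  then obtain d where d: "0 < d" "\<And>x y. x \<in> {0..4} \<Longrightarrow> y \<in> {0..4} \<Longrightarrow> \<bar>x - y\<bar> < d \<Longrightarrow> \<bar>g x - g y\<bar> < \<epsilon> / 2"
    unfolding uniformly_continuous_on_def dist_real_def using \<epsilon> by (metis half_gt_zero)
  \<comment> \<open>the factor 3 is the one of the logarithmic bound; \<open>3 \<delta> \<le> 1\<close> keeps the log-eigenvalues in \<open>[0, 4]\<close>\<close>
  define \<delta> where "\<delta> = min (1 / 3) (d / 6)"
  have \<delta>: "0 < \<delta>" "3 * \<delta> \<le> 1" "3 * \<delta> < d" using d(1) by (auto simp: \<delta>_def min_def)
  have uc: "\<bar>g x - g (2 * h + 1)\<bar> \<le> \<epsilon> / 2" if "h \<in> Hs" "\<bar>x - (2 * h + 1)\<bar> \<le> 3 * \<delta>" for h x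
  proof -
    have h: "0 < h" "h < 1" using that(1) Hs(2) by auto
    have "x \<in> {0..4}" "2 * h + 1 \<in> {0..4}" using h that(2) \<delta>(2) by auto
    then show ?thesis using d(2)[of x "2 * h + 1"] that(2) \<delta>(3) by simp
  qed
  define N where "N n = n div (a n * 2 ^ j)" for n
  define C where "C = \<bar>ln (r0 / 2)\<bar> + \<bar>ln (2 * r1)\<bar> + 3 * real j * ln 2"
  define t1 where "t1 n = measure M {\<omega> \<in> space M. \<bar>ln (ordered_singular_value 1 (P n \<omega>)) / ln (real (a n)) - 0\<bar> > \<delta>}" for n
  define t2 where "t2 n = measure M {\<omega> \<in> space M. \<bar>ln (ordered_singular_value (p n) (P n \<omega>)) / ln (real (a n)) - 0\<bar> > \<delta>}" for n
  define q where "q n = (real (p n))\<^sup>2 * (8 * cov_bound\<^sup>2 / real (N n)) / (r0 / 2)\<^sup>2" for n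
  define e where "e n = 2 * exp (- (real (p n) * (\<epsilon> / 2)\<^sup>2 / (2 * G\<^sup>2)))" for n
  have FS: "\<forall>\<^sub>F n in F. n \<in> S" unfolding F_def by (simp add: eventually_inf_principal)
  have a1: "1 \<le> a n" if "n \<in> S" for n using A4(1)[OF that] by auto
  have Nr: "real (N n) = real n / (real (a n) * 2 ^ j)" if "n \<in> S" for n
    unfolding N_def using A4(7)[OF that] by (simp add: real_of_nat_div)
  have N1: "1 \<le> N n" if "n \<in> S" for n
    using A4(4)[OF that] p_pos[OF that] unfolding Nr[OF that, symmetric] by linarith
  have a_lim: "filterlim (\<lambda>n. real (a n)) at_top F"
    by (rule scale_tendsto_infinity[OF _ _ hmin A4(3)]) (use FS a1 in \<open>auto simp: F_def elim: eventually_mono\<close>)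
  have "filterlim (\<lambda>n. ln (real (a n))) at_top F" by (rule filterlim_compose[OF ln_at_top a_lim])
  then have "((\<lambda>n. C / ln (real (a n))) \<longlongrightarrow> 0) F" by (intro real_tendsto_divide_at_top[OF tendsto_const])
  then have C: "\<forall>\<^sub>F n in F. C / ln (real (a n)) < \<delta>" by (rule order_tendstoD(2)[OF _ \<delta>(1)])
  have a2: "\<forall>\<^sub>F n in F. 1 < real (a n)" using a_lim unfolding filterlim_at_top_dense by blast
  have bound: "\<forall>\<^sub>F n in F. measure M {\<omega> \<in> space M.
       \<bar>(LINT \<upsilon>|log_esd (real (a n))
            (wavelet_matrix \<psi> (real (a n) * 2 ^ j) (n div (a n * 2 ^ j)) (p n) (\<lambda>t. Y n t \<omega>)).
          g \<upsilon>)
        - (LINT \<upsilon>|distr \<pi> borel (\<lambda>h. 2 * h + 1). g \<upsilon>)\<bar> > \<epsilon>} \<le> q n + t1 n + t2 n + e n"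
    using FS C a2
  proof eventually_elim
    case (elim n)
    note nS = elim(1)
    have Pm: "(\<lambda>\<omega>. P n \<omega> $$ (i, k)) \<in> borel_measurable M" if "i < p n" "k < p n" for i k
    proof -
      have "(\<lambda>\<omega>. \<lambda>il\<in>{..<p n} \<times> {..<p n}. P n \<omega> $$ il) \<in> M \<rightarrow>\<^sub>M Pi\<^sub>M ({..<p n} \<times> {..<p n}) (\<lambda>_. borel)"
        using A3(3)[OF nS] unfolding indep_rvs_def by blast
      from measurable_compose[OF this measurable_component_singleton[of "(i, k)"]]
      show ?thesis using that by simp
    qed
    show ?case
      unfolding q_def t1_def t2_def e_def N_def[symmetric]
      by (rule esd_deviation[OF M Hs r0 r r01 p_pos[OF nS] N1[OF nS] elim(3) refl A1(6)[OF nS] A1(7)[OF nS]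
            sets\<pi> AE\<pi> A2(1)[OF nS] A2(2)[OF nS] A3(1)[OF nS] conjunct1[OF A3(2)[OF nS]] conjunct2[OF A3(2)[OF nS]]
            Pm gm G(2) G(1) \<epsilon> less_imp_le[OF elim(2)[unfolded C_def]] uc])
  qed
  have t1: "(t1 \<longlongrightarrow> 0) F" and t2: "(t2 \<longlongrightarrow> 0) F"
    using A5 \<delta>(1) unfolding tendsto_in_prob_def t1_def[abs_def] t2_def[abs_def] by blast+
  \<comment> \<open>this is where \<open>p(n) = o(sqrt(n / a(n)))\<close> enters: \<open>q n\<close> is of order \<open>p(n)\<^sup>2 a(n) / n\<close>\<close>
  have q: "(q \<longlongrightarrow> 0) F"
  proof -
    have "((\<lambda>n. real (p n) / sqrt (real n / real (a n))) \<longlongrightarrow> 0) F" by (rule smalloD_tendsto[OF A4(6)])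
    then have "((\<lambda>n. 8 * cov_bound\<^sup>2 / (r0 / 2)\<^sup>2 * 2 ^ j * (real (p n) / sqrt (real n / real (a n)))\<^sup>2) \<longlongrightarrow> 8 * cov_bound\<^sup>2 / (r0 / 2)\<^sup>2 * 2 ^ j * 0\<^sup>2) F"
      by (intro tendsto_intros)
    moreover have "\<forall>\<^sub>F n in F. 8 * cov_bound\<^sup>2 / (r0 / 2)\<^sup>2 * 2 ^ j * (real (p n) / sqrt (real n / real (a n)))\<^sup>2 = q n"
      using FS
    proof eventually_elim
      case (elim n)
      have "(sqrt (real n / real (a n)))\<^sup>2 = real n / real (a n)" by simp
      then show ?case unfolding q_def Nr[OF elim] power_divide by (simp add: field_simps)
    qed
    ultimately show ?thesis by (auto elim: Lim_transform_eventually)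
  qed
  have e: "(e \<longlongrightarrow> 0) F"
  proof -
    have c: "0 < (\<epsilon> / 2)\<^sup>2 / (2 * G\<^sup>2)" using \<epsilon> G by simp
    have "filterlim (\<lambda>n. real (p n)) at_top F" by (rule filterlim_compose[OF filterlim_real_sequentially A4(5)])
    from filterlim_at_top_mult_tendsto_pos[OF tendsto_const c this]
    have "filterlim (\<lambda>n. - (real (p n) * ((\<epsilon> / 2)\<^sup>2 / (2 * G\<^sup>2)))) at_bot F" by (simp add: filterlim_uminus_at_bot)
    from tendsto_mult_right_zero[OF filterlim_compose[OF exp_at_bot this], of 2]
    show ?thesis unfolding e_def[abs_def] by simp
  qed
  have lim0: "((\<lambda>n. q n + t1 n + t2 n + e n) \<longlongrightarrow> 0) F"
    using tendsto_add[OF tendsto_add[OF tendsto_add[OF q t1] t2] e] by simp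
  show "((\<lambda>n. measure M {\<omega> \<in> space M.
       \<bar>(LINT \<upsilon>|log_esd (real (a n))
            (wavelet_matrix \<psi> (real (a n) * 2 ^ j) (n div (a n * 2 ^ j)) (p n) (\<lambda>t. Y n t \<omega>)).
          g \<upsilon>)
        - (LINT \<upsilon>|distr \<pi> borel (\<lambda>h. 2 * h + 1). g \<upsilon>)\<bar> > \<epsilon>}) \<longlongrightarrow> 0) F"
    by (rule tendsto_sandwich[OF _ bound tendsto_const lim0]) simp
qed

end
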